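(* Let $N\ge 2$, $K\ge2$, let $P$ be an irreducible gossip matrix, let $\alpha>3$, and let the communication budget $(B_t)_{t\in\mathbb N}$ and $\varepsilon>0$ form an admissible pair. Suppose that either all agents run the synchronous GosInE algorithm with these parameters, or all agents run the asynchronous GosInE algorithm with these parameters and some slack $\delta>0$. Then for every agent $i\in[N]$, $$\limsup_{T\to\infty}\frac{\mathbb{E}[R_T^{(i)}]}{\ln(T)}\le\sum_{j=2}^{\lceil K/N\rceil+2}\frac{4\alpha}{\Delta_j}.$$
   Context: **Model.** $[N]=\{1,\dots,N\}$ is the set of agents, $\{1,\dots,K\}$ the set of arms. Arm $l$ has mean $\mu_l\in(0,1)$ with $1>\mu_1>\mu_2\ge\dots\ge\mu_K$ (agents do not know the ordering); $\Delta_j=\mu_1-\mu_j$ for $2\le j\le K$. The gossip matrix $P$ is an $N\times N$ row-stochastic matrix. In each time slot $t=1,2,\dots$ every agent $i$ pulls an arm $I_t^{(i)}$ and observes a Bernoulli reward with mean $\mu_{I_t^{(i)}}$, independent of everything else. $R_T^{(i)}=\sum_{t=1}^T(\mu_1-\mu_{I_t^{(i)}})$; expectations are over all randomness. In sums over arms, terms with $j>K$ are omitted. **Schedule.** A communication budget is a non-negative non-decreasing sequence $(B_t)_{t\in\mathbb N}$. Given it and $\varepsilon>0$, set $A_x=\max(\min\{t\in\mathbb N: B_t\ge x\},\lceil(1+x)^{1+\varepsilon}\rceil)$ for $x=0,1,2,\dots$, and $A_{-1}=0$. **Admissible pair.** $((B_t),\varepsilon)$ is admissible if: (i) for every $D>0$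 there is $t_0(D)$ with $B_t\ge D\log t$ for all $t\ge t_0(D)$; (ii) $A_{\lfloor\lambda x+(1-\lambda)y\rfloor}\le\lambda A_x+(1-\lambda)A_y$ for all $x,y\in\mathbb N$, $\lambda\in[0,1]$; (iii) $\sum_{l\ge2}A_{2l}/A_{l-1}^3<\infty$. **Irreducible.** For all $i\ne j$ in $[N]$ there is a path $i=k_1,\dots,k_l=j$ with $P(k_1,k_2)\cdots P(k_{l-1},k_l)>0$. **Synchronous GosInE algorithm (agent $i$).** Let $c=\lceil K/N\rceil$. Sticky set: $\widehat S^{(i)}=\{((i-1)c \bmod K)+1,\dots,((ic-1)\bmod K)+1\}$ ($c$ cyclically consecutive arms). Initially $U_0^{(i)}=(ic\bmod K)+1$, $L_0^{(i)}=((ic+1)\bmod K)+1$, and $S_0^{(i)}=\widehat S^{(i)}\cup\{U_0^{(i)},L_0^{(i)}\}$. Phase $j\ge0$ consists of time slots $A_{j-1}+1,\dots,A_j$. In a slot $t$ of phase $j$ agent $i$ pulls an arm maximizing, over $l\in S_j^{(i)}$, the index $\widehat\mu_l^{(i)}(t-1)+\sqrt{\alpha\ln(t)/T_l^{(i)}(t-1)}$ ($+\infty$ if $T_l^{(i)}(t-1)=0$), where $T_l^{(i)}(t)$ is the number of pulls of arm $l$ by agent $i$ up to and including time $t$ and $\widehat\mu_l^{(i)}(t)$ is the corresponding empirical mean reward. At the end of slot $A_j$, agent $i$ samples an agent $m\sim P(i,\cdot)$ independently of everything else and receives $\mathcal O_j^{(i)}$, the arm that agent $m$ pulled most often during phase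 $j$. If $\mathcal O_j^{(i)}\in S_j^{(i)}$, then $S_{j+1}^{(i)}=S_j^{(i)}$ (with $U,L$ unchanged). Otherwise $U_{j+1}^{(i)}$ is whichever of $U_j^{(i)},L_j^{(i)}$ agent $i$ pulled more often in phase $j$, $L_{j+1}^{(i)}=\mathcal O_j^{(i)}$, and $S_{j+1}^{(i)}=\widehat S^{(i)}\cup\{U_{j+1}^{(i)},L_{j+1}^{(i)}\}$. **Asynchronous GosInE algorithm (agent $i$, slack $\delta>0$).** Identical to the synchronous algorithm except for the following. (1) For each phase $j\ge0$ agent $i$ draws, independently of everything else, a phase length $\mathcal P_j^{(i)}$ uniformly distributed on the integers in $[A_j-A_{j-1},(1+\delta)(A_j-A_{j-1})]$, and its phase $j$ consists of time slots $\sum_{y=0}^{j-1}\mathcal P_y^{(i)}+1,\dots,\sum_{y=0}^{j}\mathcal P_y^{(i)}$; information is pulled at the last slot of each of its phases. (2) When agent $i$ contacts $m$ at time $t$, it receives the arm that $m$ pulled most often during agent $m$'s phase $j'-1$, where $j'=\inf\{r\ge0:\sum_{y=0}^r\mathcal P_y^{(m)}\ge t\}$ is the phase of $m$ at time $t$ (if $j'=0$, an arbitrary arm of $S_0^{(m)}$). *)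

theory Defs
  imports "HOL-Probability.Probability"
begin

text \<open>
  Phase ends, indexed by integers so that index \<open>-1\<close> is available. Whether
  time starts at 0 or 1 is immaterial for the minimum, because the other argument of \<open>max\<close> is
  at least 1.
\<close>

definition phase_end :: "(nat \<Rightarrow> real) \<Rightarrow> real \<Rightarrow> int \<Rightarrow> nat" where
  "phase_end B \<epsilon> x =
     (if x < 0 then 0
      else max (LEAST t. B t \<ge> of_int x) (nat \<lceil>(1 + of_int x :: real) powr (1 + \<epsilon>)\<rceil>))"

definition budget :: "(nat \<Rightarrow> real) \<Rightarrow> bool" where
  "budget B \<longleftrightarrow> (\<forall>t. 0 \<le> B t) \<and> mono B"

definition admissible :: "(nat \<Rightarrow> real) \<Rightarrow> real \<Rightarrow> bool" where
  "admissible B \<epsilon> \<longleftrightarrow>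
     (\<forall>D>0. \<exists>t0. \<forall>t\<ge>t0. B t \<ge> D * ln (real t)) \<and>
     (\<forall>x y :: nat. \<forall>w\<in>{0..1::real}.
        real (phase_end B \<epsilon> \<lfloor>w * real x + (1 - w) * real y\<rfloor>)
          \<le> w * real (phase_end B \<epsilon> (int x)) + (1 - w) * real (phase_end B \<epsilon> (int y))) \<and>
     (\<lambda>l::nat. real (phase_end B \<epsilon> (2 * int l)) / real (phase_end B \<epsilon> (int l - 1)) ^ 3)
        summable_on {2..}"

definition gossip_matrix :: "nat \<Rightarrow> (nat \<Rightarrow> nat \<Rightarrow> real) \<Rightarrow> bool" where
  "gossip_matrix N P \<longleftrightarrow>
     (\<forall>i\<in>{1..N}. (\<forall>m\<in>{1..N}. 0 \<le> P i m) \<and> (\<Sum>m\<in>{1..N}. P i m) = 1)"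

definition irreducible_gossip :: "nat \<Rightarrow> (nat \<Rightarrow> nat \<Rightarrow> real) \<Rightarrow> bool" where
  "irreducible_gossip N P \<longleftrightarrow>
     (\<forall>i\<in>{1..N}. \<forall>j\<in>{1..N}. i \<noteq> j \<longrightarrow>
        (\<exists>(k :: nat \<Rightarrow> nat) l. 1 \<le> l \<and> k 1 = i \<and> k l = j \<and> (\<forall>n\<in>{1..l}. k n \<in> {1..N}) \<and>
           (\<Prod>n\<in>{1..<l}. P (k n) (k (n + 1))) > 0))"

text \<open>
  The predicates below, up to the datatype of draws, concern one realisation. \<open>I i t\<close> is the arm
  pulled by agent \<open>i\<close> in slot \<open>t\<close>, \<open>X i t\<close> the reward observed there, \<open>U i j\<close> and \<open>L i j\<close> the
  two non-sticky arms in phase \<open>j\<close>, \<open>G i j\<close> the arm received by gossip at the end of phase \<open>j\<close>,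
  and \<open>ph i j\<close> the set of slots of phase \<open>j\<close> of agent \<open>i\<close>. All maximisations are stated
  relationally, so ties may be broken in any way.
\<close>

definition pulls :: "(nat \<Rightarrow> nat) \<Rightarrow> nat \<Rightarrow> nat set \<Rightarrow> nat" where
  "pulls I l A = card {t\<in>A. I t = l}"

definition emp_mean :: "(nat \<Rightarrow> nat) \<Rightarrow> (nat \<Rightarrow> nat) \<Rightarrow> nat \<Rightarrow> nat \<Rightarrow> real" where
  "emp_mean I X l t = (\<Sum>s | s \<in> {1..t} \<and> I s = l. real (X s)) / real (pulls I l {1..t})"

definition ucb_index :: "real \<Rightarrow> (nat \<Rightarrow> nat) \<Rightarrow> (nat \<Rightarrow> nat) \<Rightarrow> nat \<Rightarrow> nat \<Rightarrow> ereal" where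
  "ucb_index \<alpha> I X t l =
     (if pulls I l {1..t - 1} = 0 then \<infinity>
      else ereal (emp_mean I X l (t - 1)
             + sqrt (\<alpha> * ln (real t) / real (pulls I l {1..t - 1}))))"

definition sticky_size :: "nat \<Rightarrow> nat \<Rightarrow> nat" where
  "sticky_size N K = nat \<lceil>real K / real N\<rceil>"

definition sticky :: "nat \<Rightarrow> nat \<Rightarrow> nat \<Rightarrow> nat set" where
  "sticky N K i = (\<lambda>k. ((i - 1) * sticky_size N K + k) mod K + 1) ` {..<sticky_size N K}"

definition active :: "nat \<Rightarrow> nat \<Rightarrow> (nat \<Rightarrow> nat \<Rightarrow> nat) \<Rightarrow> (nat \<Rightarrow> nat \<Rightarrow> nat) \<Rightarrow> nat \<Rightarrow> nat \<Rightarrow> nat set"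
  where "active N K U L i j = sticky N K i \<union> {U i j, L i j}"

definition most_pulled :: "nat \<Rightarrow> (nat \<Rightarrow> nat) \<Rightarrow> nat set \<Rightarrow> nat \<Rightarrow> bool" where
  "most_pulled K I A a \<longleftrightarrow> is_arg_max (\<lambda>l. pulls I l A) (\<lambda>l. l \<in> {1..K}) a"

definition insert_eliminate ::
  "real \<Rightarrow> nat \<Rightarrow> nat \<Rightarrow> (nat \<Rightarrow> nat \<Rightarrow> nat set) \<Rightarrow> (nat \<Rightarrow> nat \<Rightarrow> nat) \<Rightarrow> (nat \<Rightarrow> nat \<Rightarrow> nat) \<Rightarrow>
   (nat \<Rightarrow> nat \<Rightarrow> nat) \<Rightarrow> (nat \<Rightarrow> nat \<Rightarrow> nat) \<Rightarrow> (nat \<Rightarrow> nat \<Rightarrow> nat) \<Rightarrow> bool" where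
  "insert_eliminate \<alpha> N K ph I X U L G \<longleftrightarrow>
     (\<forall>i\<in>{1..N}.
        U i 0 = (i * sticky_size N K) mod K + 1 \<and>
        L i 0 = (i * sticky_size N K + 1) mod K + 1 \<and>
        (\<forall>j. \<forall>t\<in>ph i j.
           is_arg_max (ucb_index \<alpha> (I i) (X i) t) (\<lambda>l. l \<in> active N K U L i j) (I i t)) \<and>
        (\<forall>j. if G i j \<in> active N K U L i j
             then U i (Suc j) = U i j \<and> L i (Suc j) = L i j
             else is_arg_max (\<lambda>l. pulls (I i) l (ph i j)) (\<lambda>l. l \<in> {U i j, L i j}) (U i (Suc j)) \<and>
                  L i (Suc j) = G i j))"

text \<open>\<open>C i j\<close> is the agent contacted by agent \<open>i\<close> at the end of its phase \<open>j\<close>.\<close>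

definition sync_phase :: "(int \<Rightarrow> nat) \<Rightarrow> nat \<Rightarrow> nat \<Rightarrow> nat set" where
  "sync_phase A i j = {A (int j - 1) <.. A (int j)}"

definition sync_run ::
  "real \<Rightarrow> nat \<Rightarrow> nat \<Rightarrow> (int \<Rightarrow> nat) \<Rightarrow> (nat \<Rightarrow> nat \<Rightarrow> nat) \<Rightarrow> (nat \<Rightarrow> nat \<Rightarrow> nat) \<Rightarrow>
   (nat \<Rightarrow> nat \<Rightarrow> nat) \<Rightarrow> (nat \<Rightarrow> nat \<Rightarrow> nat) \<Rightarrow> (nat \<Rightarrow> nat \<Rightarrow> nat) \<Rightarrow> (nat \<Rightarrow> nat \<Rightarrow> nat) \<Rightarrow> bool" where
  "sync_run \<alpha> N K A C I X U L G \<longleftrightarrow>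
     insert_eliminate \<alpha> N K (sync_phase A) I X U L G \<and>
     (\<forall>i\<in>{1..N}. \<forall>j. most_pulled K (I (C i j)) (sync_phase A (C i j) j) (G i j))"

text \<open>\<open>D i j\<close> is the length of phase \<open>j\<close> of agent \<open>i\<close>.\<close>

definition async_phase :: "(nat \<Rightarrow> nat \<Rightarrow> nat) \<Rightarrow> nat \<Rightarrow> nat \<Rightarrow> nat set" where
  "async_phase D i j = {(\<Sum>y<j. D i y) <.. (\<Sum>y\<le>j. D i y)}"

definition phase_at :: "(nat \<Rightarrow> nat \<Rightarrow> nat) \<Rightarrow> nat \<Rightarrow> nat \<Rightarrow> nat" where
  "phase_at D m t = (LEAST r. (\<Sum>y\<le>r. D m y) \<ge> t)"

definition async_run ::
  "real \<Rightarrow> nat \<Rightarrow> nat \<Rightarrow> (nat \<Rightarrow> nat \<Rightarrow> nat) \<Rightarrow> (nat \<Rightarrow> nat \<Rightarrow> nat) \<Rightarrow> (nat \<Rightarrow> nat \<Rightarrow> nat) \<Rightarrow>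
   (nat \<Rightarrow> nat \<Rightarrow> nat) \<Rightarrow> (nat \<Rightarrow> nat \<Rightarrow> nat) \<Rightarrow> (nat \<Rightarrow> nat \<Rightarrow> nat) \<Rightarrow> (nat \<Rightarrow> nat \<Rightarrow> nat) \<Rightarrow> bool" where
  "async_run \<alpha> N K D C I X U L G \<longleftrightarrow>
     insert_eliminate \<alpha> N K (async_phase D) I X U L G \<and>
     (\<forall>i\<in>{1..N}. \<forall>j.
        let m = C i j; j' = phase_at D m (\<Sum>y\<le>j. D i y)
        in if j' = 0 then G i j \<in> active N K U L m 0
           else most_pulled K (I m) (async_phase D m (j' - 1)) (G i j))"

text \<open>
  All randomness comes from one independent family of natural-number valued draws:
  \<open>Reward i l t\<close> is the 0/1 reward agent \<open>i\<close> gets if it pulls arm \<open>l\<close> in slot \<open>t\<close> (only the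
  entry of the pulled arm is observed), \<open>Contact i j\<close> the agent contacted by \<open>i\<close> at the end of
  its phase \<open>j\<close>, and \<open>Duration i j\<close> the length of phase \<open>j\<close> of agent \<open>i\<close> (used only by the
  asynchronous algorithm). The draws \<open>Tie n\<close>, of arbitrary law, permit randomised tie-breaking.
\<close>

datatype draw =
    Reward nat nat nat
  | Contact nat nat
  | Duration nat nat
  | Tie nat

fun not_future :: "nat \<Rightarrow> draw \<Rightarrow> bool" where
  "not_future t (Reward i l s) \<longleftrightarrow> s < t"
| "not_future t d \<longleftrightarrow> True"

text \<open>
  \<open>\<nu> l\<close> is the mean of the arm with label \<open>l\<close>. The agents do not know the ordering of the means,
  so \<open>\<nu>\<close> need not be decreasing in the labels: with sorted means \<open>\<mu>\<close> one takes \<open>\<nu> = \<mu> \<circ> \<sigma>\<close>,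
  where the permutation \<open>\<sigma>\<close> maps a label to its rank.

  The assumption \<open>nonanticipating\<close> only constrains how ties are broken: the pull of slot \<open>t\<close> must
  not depend on rewards of slot \<open>t\<close> or later. Without it, the observed reward need not be
  Bernoulli with the mean of the pulled arm.
\<close>

locale gossip_bandit = prob_space M for M :: "'w measure" +
  fixes N K :: nat
    and \<nu> :: "nat \<Rightarrow> real"
    and P :: "nat \<Rightarrow> nat \<Rightarrow> real"
    and Z :: "draw \<Rightarrow> 'w \<Rightarrow> nat"
    and I U L G :: "nat \<Rightarrow> nat \<Rightarrow> 'w \<Rightarrow> nat"
  assumes indep_draws: "indep_vars (\<lambda>_. count_space UNIV) Z UNIV"
    and reward_law: "\<And>i l t. i \<in> {1..N} \<Longrightarrow> l \<in> {1..K} \<Longrightarrow> 1 \<le> t \<Longrightarrow>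
          distr M (count_space UNIV) (Z (Reward i l t))
            = measure_pmf (map_pmf of_bool (bernoulli_pmf (\<nu> l)))"
    and contact_law: "\<And>i j m. i \<in> {1..N} \<Longrightarrow> m \<in> {1..N} \<Longrightarrow>
          prob {\<omega> \<in> space M. Z (Contact i j) \<omega> = m} = P i m"
    and nonanticipating: "\<And>i t. i \<in> {1..N} \<Longrightarrow> 1 \<le> t \<Longrightarrow>
          I i t \<in> measurable
            (sigma (space M) {Z d -` E \<inter> space M | d E. not_future t d}) (count_space UNIV)"
    and U_measurable: "\<And>i j. i \<in> {1..N} \<Longrightarrow> U i j \<in> measurable M (count_space UNIV)"
    and L_measurable: "\<And>i j. i \<in> {1..N} \<Longrightarrow> L i j \<in> measurable M (count_space UNIV)"
    and G_measurable: "\<And>i j. i \<in> {1..N} \<Longrightarrow> G i j \<in> measurable M (count_space UNIV)"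

locale gosine_sync = gossip_bandit M N K \<nu> P Z I U L G
  for M :: "'w measure" and N K \<nu> P Z I U L G +
  fixes \<alpha> :: real and B :: "nat \<Rightarrow> real" and \<epsilon> :: real
  assumes run: "AE \<omega> in M. sync_run \<alpha> N K (phase_end B \<epsilon>) (\<lambda>i j. Z (Contact i j) \<omega>)
                  (\<lambda>i t. I i t \<omega>) (\<lambda>i t. Z (Reward i (I i t \<omega>) t) \<omega>)
                  (\<lambda>i j. U i j \<omega>) (\<lambda>i j. L i j \<omega>) (\<lambda>i j. G i j \<omega>)"

definition duration_range :: "(int \<Rightarrow> nat) \<Rightarrow> real \<Rightarrow> nat \<Rightarrow> nat set" where
  "duration_range A \<delta> j =
     {n. real (A (int j)) - real (A (int j - 1)) \<le> real n \<and>
         real n \<le> (1 + \<delta>) * (real (A (int j)) - real (A (int j - 1)))}"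

locale gosine_async = gossip_bandit M N K \<nu> P Z I U L G
  for M :: "'w measure" and N K \<nu> P Z I U L G +
  fixes \<alpha> :: real and B :: "nat \<Rightarrow> real" and \<epsilon> \<delta> :: real
  assumes duration_law: "\<And>i j. i \<in> {1..N} \<Longrightarrow>
          distr M (count_space UNIV) (Z (Duration i j))
            = measure_pmf (pmf_of_set (duration_range (phase_end B \<epsilon>) \<delta> j))"
    and run: "AE \<omega> in M. async_run \<alpha> N K (\<lambda>i j. Z (Duration i j) \<omega>) (\<lambda>i j. Z (Contact i j) \<omega>)
                (\<lambda>i t. I i t \<omega>) (\<lambda>i t. Z (Reward i (I i t \<omega>) t) \<omega>)
                (\<lambda>i j. U i j \<omega>) (\<lambda>i j. L i j \<omega>) (\<lambda>i j. G i j \<omega>)"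

definition regret :: "real \<Rightarrow> (nat \<Rightarrow> real) \<Rightarrow> (nat \<Rightarrow> 'w \<Rightarrow> nat) \<Rightarrow> nat \<Rightarrow> 'w \<Rightarrow> real" where
  "regret best \<nu> I T \<omega> = (\<Sum>t\<in>{1..T}. best - \<nu> (I t \<omega>))"

end

theory Submission
  imports Defs "HOL-Real_Asymp.Real_Asymp"
begin

text \<open>
  Time is measured against the deterministic phase ends \<open>A\<close>. A UCB index deviates from its mean at
  time \<open>t\<close> with probability \<open>O(t powr (1 - 2 * \<alpha>))\<close>, so after time \<open>s\<close> no deviation occurs
  except with probability \<open>O(1 / s ^ 4)\<close>. Without deviations an agent holding the best arm pulls it
  most often in every later phase, hence keeps and recommends it. Along an edge of the gossip graph
  of positive probability the recommendation arrives within \<open>O(ln s)\<close> contacts except with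
  probability \<open>1 / s ^ 4\<close>. Convexity of \<open>A\<close> and the bound \<open>A (2 * l) = O(A (l - 1) ^ 3)\<close>, which
  follows from the summability condition, show that by time \<open>O(s ^ 3)\<close> all agents hold the best arm.
  With \<open>t = O(s ^ 3)\<close>, the best arm is missing at time \<open>t\<close> with probability \<open>O(t powr (- 4 / 3))\<close>,
  which is summable, so these slots contribute bounded regret. Moreover all active sets are almost
  surely eventually constant, so that in the limit only the at most \<open>\<lceil>K / N\<rceil> + 1\<close> suboptimal arms of
  the final set contribute, each with the usual UCB bound; the passage to expectations is by
  dominated convergence.
\<close>

section \<open>Phase schedules\<close>

text \<open>The obstacle is that \<open>A\<close> may grow faster than every power, so a delay
  counted in phases has no fixed price in time. If each hop of a gossip path were converted back
  into time, the cubic bound would be spent once per hop and the power of \<open>s\<close> would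
  grow with the length of the path. Delays are therefore kept in phases, as \<open>c * ln s\<close>
  beyond a reference index \<open>z\<close> with \<open>A z = O(s)\<close>. A hop changes only the
  constants, and the cubic bound is used a single time, after the last hop. A second obstacle is
  that no moment of the time at which the active sets freeze is controlled. The regret is split by
  pull counts instead of by good events: pulls below the UCB threshold are bounded on every path by
  a multiple of \<open>ln T\<close>, which supplies the dominating function, and pulls above it have
  summable probabilities. The exponents fit together as follows: \<alpha> > 3 puts
  \<open>1 - 2 * \<alpha>\<close> below -5, whose tail sum is of order \<open>1 / s ^ 4\<close>, and
  the choice of \<open>s\<close> of order \<open>t powr (1 / 3)\<close> leaves 4 / 3 > 1.\<close>

locale phase_schedule =
  fixes A :: "nat \<Rightarrow> nat" and \<epsilon> :: real
  assumes eps_pos: "\<epsilon> > 0"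
    and mono_A: "mono A"
    and powr_le_A: "(1 + real x) powr (1 + \<epsilon>) \<le> real (A x)"
    and convex_A: "x < y \<Longrightarrow> y < z \<Longrightarrow>
      (real (A y) - real (A x)) * (real z - real y) \<le> (real (A z) - real (A y)) * (real y - real x)"
    and cubic_doubling: "\<exists>c>0. \<forall>l\<ge>2. real (A (2 * l)) \<le> c * real (A (l - 1)) ^ 3"
    and subexponential: "D > 0 \<Longrightarrow> \<forall>\<^sub>F x in sequentially. D * ln (real (A x)) \<le> real x"

lemma phase_end_nat:
  "phase_end B \<epsilon> (int x) =
     max (LEAST t. B t \<ge> real x) (nat \<lceil>(1 + real x) powr (1 + \<epsilon>)\<rceil>)"
  by (simp add: phase_end_def)

text \<open>Already \<open>D = 1\<close> forces the budget above \<open>ln\<close>. This makes the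
  \<open>LEAST\<close> in \<open>phase_end\<close> an attained minimum instead of an unspecified
  value.\<close>

lemma admissible_unbounded:
  assumes "admissible B \<epsilon>"
  shows "\<exists>t. B t \<ge> x"
proof -
  from assms obtain t0 where t0: "\<And>t. t \<ge> t0 \<Longrightarrow> B t \<ge> 1 * ln (real t)"
    unfolding admissible_def by (metis zero_less_one)
  have "filterlim (\<lambda>t::nat. ln (real t)) at_top sequentially" by real_asymp
  then have "\<forall>\<^sub>F t::nat in sequentially. ln (real t) \<ge> x"
    by (simp add: filterlim_at_top)
  then obtain t1 where "\<And>t::nat. t \<ge> t1 \<Longrightarrow> ln (real t) \<ge> x"
    unfolding eventually_sequentially by blast
  from this[of "max t0 t1"] t0[of "max t0 t1"] have "B (max t0 t1) \<ge> x" by simp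
  then show ?thesis ..
qed

lemma mono_phase_end:
  assumes "admissible B \<epsilon>" "\<epsilon> > 0"
  shows "mono (\<lambda>x::nat. phase_end B \<epsilon> (int x))"
proof (rule monoI)
  fix x y :: nat assume xy: "x \<le> y"
  have "B (LEAST t. B t \<ge> real y) \<ge> real y"
    using admissible_unbounded[OF assms(1)] by (rule LeastI_ex)
  then have "(LEAST t. B t \<ge> real x) \<le> (LEAST t. B t \<ge> real y)"
    using xy by (intro Least_le) linarith
  moreover have "(1 + real x) powr (1 + \<epsilon>) \<le> (1 + real y) powr (1 + \<epsilon>)"
    using xy assms by (intro powr_mono2) auto
  then have "nat \<lceil>(1 + real x) powr (1 + \<epsilon>)\<rceil> \<le> nat \<lceil>(1 + real y) powr (1 + \<epsilon>)\<rceil>"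
    by (intro nat_mono ceiling_mono)
  ultimately show "phase_end B \<epsilon> (int x) \<le> phase_end B \<epsilon> (int y)"
    unfolding phase_end_nat by linarith
qed

text \<open>At \<open>t = \<lceil>exp (x / (2 * D))\<rceil>\<close> the budget is at least
  \<open>2 * D * ln t\<close>, hence at least \<open>x\<close>. Using \<open>2 * D\<close> in the
  budget condition leaves room between \<open>exp (x / (2 * D))\<close> and
  \<open>exp (x / D)\<close> for the rounding; the polynomial term of the maximum is
  negligible.\<close>

lemma subexponential_phase_end:
  assumes adm: "admissible B \<epsilon>" and "\<epsilon> > 0" and "D > 0"
  shows "\<forall>\<^sub>F x in sequentially. D * ln (real (phase_end B \<epsilon> (int x))) \<le> real x"
proof -
  from adm \<open>D > 0\<close> obtain t0 where t0: "\<And>t. t \<ge> t0 \<Longrightarrow> B t \<ge> 2 * D * ln (real t)"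
    unfolding admissible_def by (metis mult_pos_pos zero_less_numeral)
  let ?e = "\<lambda>x::nat. exp (real x / (2 * D))"
  have "\<forall>\<^sub>F x::nat in sequentially. ?e x \<ge> real t0"
    and "\<forall>\<^sub>F x::nat in sequentially. ?e x + 1 \<le> exp (real x / D)"
    and "\<forall>\<^sub>F x::nat in sequentially. (1 + real x) powr (1 + \<epsilon>) + 1 \<le> exp (real x / D)"
    using assms(2,3) by real_asymp+
  then show ?thesis
  proof eventually_elim
    case (elim x)
    define t where "t = nat \<lceil>?e x\<rceil>"
    have t: "?e x \<le> real t" unfolding t_def by (rule of_nat_ceiling)
    have t': "real t \<le> ?e x + 1"
      unfolding t_def using of_int_ceiling_le_add_one[of "?e x"]
      by (simp add: of_nat_nat order.trans[OF less_imp_le[OF exp_gt_zero]])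
    have "t \<ge> t0" using t elim(1) by linarith
    have "ln (?e x) \<le> ln (real t)"
      using t less_le_trans[OF exp_gt_zero[of "real x / (2 * D)"] t] by (subst ln_le_cancel_iff) auto
    then have "real x \<le> 2 * D * ln (real t)"
      using \<open>D > 0\<close> by (simp add: field_simps)
    also have "\<dots> \<le> B t" using t0[OF \<open>t \<ge> t0\<close>] .
    finally have "(LEAST t. B t \<ge> real x) \<le> t" by (rule Least_le)
    then have 1: "real (LEAST t. B t \<ge> real x) \<le> exp (real x / D)"
      using t' elim(2) by linarith
    have "real (nat \<lceil>(1 + real x) powr (1 + \<epsilon>)\<rceil>) \<le> (1 + real x) powr (1 + \<epsilon>) + 1"
      using ceiling_correct[of "(1 + real x) powr (1 + \<epsilon>)"] powr_ge_zero[of "1 + real x" "1 + \<epsilon>"]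
      by linarith
    with elim(3) have 2: "real (nat \<lceil>(1 + real x) powr (1 + \<epsilon>)\<rceil>) \<le> exp (real x / D)" by linarith
    have le: "real (phase_end B \<epsilon> (int x)) \<le> exp (real x / D)"
      using 1 2 unfolding phase_end_nat by (simp add: max_def)
    have "(1 + real x) powr (1 + \<epsilon>) > 0" by simp
    then have "real (phase_end B \<epsilon> (int x)) > 0"
      unfolding phase_end_nat by linarith
    then have "ln (real (phase_end B \<epsilon> (int x))) \<le> ln (exp (real x / D))"
      using le by (subst ln_le_cancel_iff) auto
    then show ?case using \<open>D > 0\<close> by (simp add: field_simps)
  qed
qed

lemma phase_schedule_phase_end:
  assumes adm: "admissible B \<epsilon>" and "\<epsilon> > 0"
  shows "phase_schedule (\<lambda>x. phase_end B \<epsilon> (int x)) \<epsilon>"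
proof
  show "\<epsilon> > 0" by fact
  show "mono (\<lambda>x::nat. phase_end B \<epsilon> (int x))"
    using assms by (rule mono_phase_end)
  show "\<forall>\<^sub>F x in sequentially. D * ln (real (phase_end B \<epsilon> (int x))) \<le> real x" if "D > 0" for D
    using subexponential_phase_end assms that by blast
  show lower: "(1 + real x) powr (1 + \<epsilon>) \<le> real (phase_end B \<epsilon> (int x))" for x
    unfolding phase_end_nat by linarith
  show "\<exists>c>0. \<forall>l\<ge>2. real (phase_end B \<epsilon> (int (2 * l)))
          \<le> c * real (phase_end B \<epsilon> (int (l - 1))) ^ 3"
  proof -
    let ?f = "\<lambda>l::nat. real (phase_end B \<epsilon> (2 * int l)) / real (phase_end B \<epsilon> (int l - 1)) ^ 3"
    have sm: "?f summable_on {2..}" using adm unfolding admissible_def by blast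
    \<comment> \<open>The sum of a nonnegative series bounds each of its terms; the added 1 only
      makes the constant positive.\<close>
    define c where "c = infsum ?f {2..} + 1"
    have nn: "?f l \<ge> 0" for l by simp
    have "infsum ?f {2..} \<ge> 0" by (rule infsum_nonneg) (rule nn)
    then have "c > 0" unfolding c_def by linarith
    moreover have "real (phase_end B \<epsilon> (int (2 * l))) \<le> c * real (phase_end B \<epsilon> (int (l - 1))) ^ 3"
      if "l \<ge> 2" for l
    proof -
      have "sum ?f {l} \<le> infsum ?f {2..}"
        using that by (intro finite_sum_le_infsum sm nn) auto
      then have "?f l \<le> c" unfolding c_def by simp
      moreover have "(1 + real (l - 1)) powr (1 + \<epsilon>) > 0" by simp
      then have "real (phase_end B \<epsilon> (int (l - 1))) > 0" using lower[of "l - 1"] by linarith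
      moreover have "int l - 1 = int (l - 1)" using that by simp
      ultimately show ?thesis by (metis divide_le_eq zero_less_power of_nat_mult of_nat_numeral)
    qed
    ultimately show ?thesis by blast
  qed
  show "(real (phase_end B \<epsilon> (int y)) - real (phase_end B \<epsilon> (int x))) * (real z - real y)
      \<le> (real (phase_end B \<epsilon> (int z)) - real (phase_end B \<epsilon> (int y))) * (real y - real x)"
    if xy: "x < y" and yz: "y < z" for x y z
  proof -
    define d where "d = real z - real x"
    \<comment> \<open>With this weight the convex combination of \<open>x\<close> and
      \<open>z\<close> is exactly the integer \<open>y\<close>, so the floor in the admissibility
      condition disappears.\<close>
    define w where "w = (real z - real y) / d"
    have d: "d > 0" using xy yz by (simp add: d_def)
    have w: "w \<in> {0..1}" using xy yz by (auto simp: w_def d_def)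
    have wd: "w * d = real z - real y" using d by (simp add: w_def)
    then have "w * real x + (1 - w) * real z = real y"
      by (simp add: d_def algebra_simps)
    moreover have "real (phase_end B \<epsilon> \<lfloor>w * real x + (1 - w) * real z\<rfloor>)
        \<le> w * real (phase_end B \<epsilon> (int x)) + (1 - w) * real (phase_end B \<epsilon> (int z))"
      using adm w unfolding admissible_def by blast
    ultimately have "real (phase_end B \<epsilon> (int y))
        \<le> w * real (phase_end B \<epsilon> (int x)) + (1 - w) * real (phase_end B \<epsilon> (int z))" by simp
    then have "d * real (phase_end B \<epsilon> (int y))
        \<le> d * (w * real (phase_end B \<epsilon> (int x)) + (1 - w) * real (phase_end B \<epsilon> (int z)))"
      using d by simp
    also have "\<dots> = (w * d) * real (phase_end B \<epsilon> (int x)) + (d - w * d) * real (phase_end B \<epsilon> (int z))"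
      by (simp add: algebra_simps)
    finally show ?thesis
      unfolding wd by (simp add: d_def algebra_simps)
  qed
qed

context phase_schedule
begin

lemma A_ge_1: "1 \<le> real (A x)"
proof -
  have "1 \<le> (1 + real x) powr (1 + \<epsilon>)"
    using eps_pos by (intro ge_one_powr_ge_zero) auto
  then show ?thesis using powr_le_A[of x] by linarith
qed

lemma A_le: "x \<le> y \<Longrightarrow> A x \<le> A y"
  using mono_A by (rule monoD)

lemma filterlim_A: "filterlim (\<lambda>x. real (A x)) at_top sequentially"
proof (rule filterlim_at_top_mono)
  show "filterlim (\<lambda>x::nat. (1 + real x) powr (1 + \<epsilon>)) at_top sequentially"
    using eps_pos by real_asymp
qed (use powr_le_A in auto)

lemma A_reaches: "\<exists>x. y \<le> real (A x)"
  using filterlim_A unfolding filterlim_at_top eventually_sequentially by blast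

lemma A_exceeds: "\<exists>x. y < real (A x)"
  using A_reaches[of "y + 1"] by (metis less_add_one order_less_le_trans)

text \<open>By convexity the last increment is at least the average increment
  \<open>(A j - A 0) / j\<close>, and \<open>j \<le> A j powr q\<close> by the lower bound on
  \<open>A\<close>. Phase lengths thus grow at least like a positive power of \<open>A j\<close>,
  which beats the logarithm.\<close>

lemma eventually_phase_long:
  "\<forall>\<^sub>F j in sequentially. c * (ln (real (A j)) + 1) < real (A j) - real (A (j - 1))"
proof -
  define q where "q = 1 / (1 + \<epsilon>)"
  have q: "0 < q" "q < 1" using eps_pos by (auto simp: q_def)
  let ?a = "real (A 0)"
  have "filterlim (\<lambda>y::real. (y - ?a) / y powr q - c * (ln y + 1)) at_top at_top"
    using q by real_asymp
  from filterlim_compose[OF this filterlim_A]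
  have "\<forall>\<^sub>F j in sequentially. (real (A j) - ?a) / real (A j) powr q - c * (ln (real (A j)) + 1) > 0"
    unfolding filterlim_at_top_dense by blast
  then show ?thesis using eventually_gt_at_top[of 1]
  proof eventually_elim
    case (elim j)
    have "(1 + real j) = ((1 + real j) powr (1 + \<epsilon>)) powr q"
      using eps_pos by (simp add: powr_powr q_def)
    also have "\<dots> \<le> real (A j) powr q"
      using powr_le_A[of j] q by (intro powr_mono2) auto
    finally have j: "real j \<le> real (A j) powr q" by simp
    have "(real (A (j - 1)) - ?a) * (real j - real (j - 1))
        \<le> (real (A j) - real (A (j - 1))) * (real (j - 1) - real 0)"
      using elim by (intro convex_A) auto
    then have "real (A j) - ?a \<le> (real (A j) - real (A (j - 1))) * real j"
      using elim by (simp add: of_nat_diff algebra_simps)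
    then have "(real (A j) - ?a) / real j \<le> real (A j) - real (A (j - 1))"
      using elim by (simp add: divide_le_eq)
    moreover have "(real (A j) - ?a) / real (A j) powr q \<le> (real (A j) - ?a) / real j"
      using j elim A_le[of 0 j] A_ge_1[of j] by (intro divide_left_mono mult_pos_pos) auto
    ultimately show ?case using elim(1) by linarith
  qed
qed

text \<open>
  The invariant of the spreading argument: \<open>w\<close> exceeds by at most \<open>h\<close> phases an index \<open>z\<close> whose
  phase ends within a constant factor of the starting time. Either the new index \<open>v - 1\<close> is
  such an index itself, or \<open>A\<close> has already become so steep beyond \<open>z\<close> that, by convexity, stretching
  time by the factor \<open>1 + \<delta>\<close> costs few phases.
\<close>

lemma overtake:
  fixes \<delta> h \<Theta> :: real
  assumes "\<delta> \<ge> 0" "h \<ge> 0" and z: "real (A z) \<le> \<Theta>" and w: "real w \<le> real z + h"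
  defines "v \<equiv> LEAST v. (1 + \<delta>) * real (A (w + 1)) < real (A v)"
  shows "(1 + \<delta>) * real (A (w + 1)) < real (A v)" and "w + 1 < v"
    and "\<exists>z'\<ge>z. real (A z') \<le> 2 * (1 + \<delta>) * \<Theta> \<and> real v \<le> real z' + (1 + 2 * \<delta>) * (h + 1) + 1"
proof -
  show v: "(1 + \<delta>) * real (A (w + 1)) < real (A v)"
    unfolding v_def using A_exceeds by (rule LeastI_ex)
  have "real (A (w + 1)) \<le> (1 + \<delta>) * real (A (w + 1))"
    using \<open>\<delta> \<ge> 0\<close> by (simp add: algebra_simps)
  with v have "A (w + 1) < A v" by linarith
  then show wv: "w + 1 < v" using A_le by (meson linorder_not_less)
  have v1: "real (A (v - 1)) \<le> (1 + \<delta>) * real (A (w + 1))"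
    using not_less_Least[of "v - 1" "\<lambda>v. (1 + \<delta>) * real (A (w + 1)) < real (A v)"] wv
    unfolding v_def[symmetric] by simp
  have "\<Theta> \<ge> 0" using z by linarith
  then have \<Theta>: "\<Theta> \<le> 2 * (1 + \<delta>) * \<Theta>"
    using \<open>\<delta> \<ge> 0\<close> by (simp add: algebra_simps)
  show "\<exists>z'\<ge>z. real (A z') \<le> 2 * (1 + \<delta>) * \<Theta> \<and> real v \<le> real z' + (1 + 2 * \<delta>) * (h + 1) + 1"
  proof (cases "real (A (v - 1)) \<le> 2 * (1 + \<delta>) * \<Theta>")
    case True
    have "real v \<le> real (max z (v - 1)) + 1" by linarith
    also have "\<dots> \<le> real (max z (v - 1)) + (1 + 2 * \<delta>) * (h + 1) + 1"
      using \<open>\<delta> \<ge> 0\<close> \<open>h \<ge> 0\<close> by simp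
    finally show ?thesis
      using True z \<Theta> by (intro exI[of _ "max z (v - 1)"]) (auto simp: max_def)
  next
    case False
    \<comment> \<open>The factor 2 in the bound \<open>2 * (1 + \<delta>) * \<Theta>\<close> is made
      for this point: \<open>A (w + 1)\<close> exceeds twice \<open>A z\<close>, so the rise of
      \<open>A\<close> from \<open>z\<close> to \<open>w + 1\<close> is at least half of
      \<open>A (w + 1)\<close>.\<close>
    have "(1 + \<delta>) * (2 * \<Theta>) < (1 + \<delta>) * real (A (w + 1))"
      using False v1 by (simp add: algebra_simps)
    then have big: "2 * \<Theta> < real (A (w + 1))" using \<open>\<delta> \<ge> 0\<close> by simp
    then have "A z < A (w + 1)" using z \<open>\<Theta> \<ge> 0\<close> by linarith
    then have zw: "z < w + 1" using A_le by (meson linorder_not_less)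
    have "real v - 1 - (real w + 1) \<le> 2 * \<delta> * (real w + 1 - real z)"
    proof (cases "v - 1 = w + 1")
      case True
      then have "real v - 1 - (real w + 1) = 0" using wv by linarith
      moreover have "0 \<le> 2 * \<delta> * (real w + 1 - real z)" using zw \<open>\<delta> \<ge> 0\<close> by simp
      ultimately show ?thesis by linarith
    next
      case False
      define a where "a = real (A (w + 1)) - real (A z)"
      have a: "a > 0" "real (A (w + 1)) \<le> 2 * a"
        using big z \<open>\<Theta> \<ge> 0\<close> by (auto simp: a_def)
      \<comment> \<open>Beyond \<open>w + 1\<close> the slope of \<open>A\<close> is at least
        \<open>a / (w + 1 - z)\<close>, while the rise up to \<open>v - 1\<close> is at most
        \<open>\<delta> * A (w + 1)\<close> by minimality of \<open>v\<close>, hence at most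
        \<open>2 * \<delta> * a\<close>.\<close>
      have "a * (real v - 1 - (real w + 1))
          \<le> (real (A (v - 1)) - real (A (w + 1))) * (real w + 1 - real z)"
        using convex_A[of z "w + 1" "v - 1"] False wv zw by (simp add: a_def of_nat_diff add.commute)
      also have "\<dots> \<le> (\<delta> * (2 * a)) * (real w + 1 - real z)"
      proof (rule mult_right_mono)
        have "real (A (v - 1)) - real (A (w + 1)) \<le> \<delta> * real (A (w + 1))"
          using v1 by (simp add: algebra_simps)
        also have "\<dots> \<le> \<delta> * (2 * a)" using a \<open>\<delta> \<ge> 0\<close> by (intro mult_left_mono)
        finally show "real (A (v - 1)) - real (A (w + 1)) \<le> \<delta> * (2 * a)" .
      qed (use zw in simp)
      also have "\<dots> = a * (2 * \<delta> * (real w + 1 - real z))" by simp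
      finally show ?thesis using a(1) by (metis mult_le_cancel_left_pos)
    qed
    then have "real v \<le> real z + (1 + 2 * \<delta>) * (real w + 1 - real z) + 1"
      by (simp add: algebra_simps)
    also have "\<dots> \<le> real z + (1 + 2 * \<delta>) * (h + 1) + 1"
      using w \<open>\<delta> \<ge> 0\<close> by (intro add_mono mult_left_mono) auto
    finally show ?thesis using z \<Theta> by (intro exI[of _ z]) auto
  qed
qed

section \<open>Translating times into phase indices\<close>

definition reach :: "real \<Rightarrow> nat" where
  "reach s = (LEAST x. s \<le> real (A x))"

lemma le_A_reach: "s \<le> real (A (reach s))"
  unfolding reach_def using A_reaches by (rule LeastI_ex)

lemma A_less_reach: "x < reach s \<Longrightarrow> real (A x) < s"
  unfolding reach_def by (auto dest: not_less_Least)

lemma filterlim_reach: "filterlim reach sequentially at_top"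
proof -
  have "\<forall>\<^sub>F s in at_top. n \<le> reach s" for n
  proof -
    have "n \<le> reach s" if "s > real (A n)" for s
    proof (rule ccontr)
      assume "\<not> n \<le> reach s"
      then have "A (reach s) \<le> A n" by (intro A_le) simp
      with that le_A_reach[of s] show False by linarith
    qed
    then show ?thesis by (metis (mono_tags, lifting) eventually_gt_at_top eventually_mono)
  qed
  then show ?thesis by (simp add: filterlim_at_top)
qed

text \<open>Subexponential growth means that reaching time \<open>s\<close> takes at least any given
  multiple of \<open>ln s\<close> phases. A logarithmic delay therefore at most about doubles an
  index near \<open>reach s\<close>.\<close>

lemma eventually_ln_le_reach:
  assumes "c > 0"
  shows "\<forall>\<^sub>F s in at_top. c * ln s \<le> real (reach s)"
proof -
  have "\<forall>\<^sub>F s in at_top. c * ln (real (A (reach s))) \<le> real (reach s)"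
    using eventually_compose_filterlim[OF subexponential[OF assms] filterlim_reach] .
  then show ?thesis using eventually_gt_at_top[of 0]
  proof eventually_elim
    case (elim s)
    have "c * ln s \<le> c * ln (real (A (reach s)))"
      using le_A_reach[of s] elim(2) assms by simp
    with elim(1) show ?case by linarith
  qed
qed

text \<open>
  Here the summability condition enters: \<open>w\<close> is at most twice an index whose phase ends at a time of
  order \<open>s\<close>, hence has phase end of order \<open>s ^ 3\<close>.
\<close>

lemma eventually_A_le_cube:
  assumes "c > 0" "\<Lambda> > 0"
  shows "\<exists>c'>0. \<forall>\<^sub>F s in at_top. \<forall>w z. reach s \<le> z + 1 \<longrightarrow> real (A z) \<le> \<Lambda> * s \<longrightarrow>
           real w \<le> real z + c * ln s \<longrightarrow> real (A w) \<le> c' * s ^ 3"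
proof -
  obtain d where d: "d > 0" "\<And>l. l \<ge> 2 \<Longrightarrow> real (A (2 * l)) \<le> d * real (A (l - 1)) ^ 3"
    using cubic_doubling by blast
  have "\<forall>\<^sub>F s in at_top. 2 \<le> reach s"
    using filterlim_reach by (simp add: filterlim_at_top)
  with eventually_ln_le_reach[OF assms(1)]
  have "\<forall>\<^sub>F s in at_top. \<forall>w z. reach s \<le> z + 1 \<longrightarrow> real (A z) \<le> \<Lambda> * s \<longrightarrow>
           real w \<le> real z + c * ln s \<longrightarrow> real (A w) \<le> (d * \<Lambda> ^ 3) * s ^ 3"
  proof eventually_elim
    case (elim s)
    show ?case
    proof (intro allI impI)
      fix w z assume *: "reach s \<le> z + 1" "real (A z) \<le> \<Lambda> * s" "real w \<le> real z + c * ln s"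
      \<comment> \<open>The delay is at most \<open>reach s\<close>, hence at most
        \<open>z + 1\<close>. The doubling bound is then used with \<open>l = z + 1\<close>, which
        is at least 2 because \<open>reach s\<close> is.\<close>
      have "real w \<le> real (2 * (z + 1))" using elim * by simp
      then have "real (A w) \<le> real (A (2 * (z + 1)))" by (simp only: of_nat_le_iff A_le)
      also have "\<dots> \<le> d * real (A z) ^ 3" using d(2)[of "z + 1"] elim * by simp
      also have "\<dots> \<le> d * (\<Lambda> * s) ^ 3"
        using d(1) * by (intro mult_left_mono power_mono) auto
      finally show "real (A w) \<le> (d * \<Lambda> ^ 3) * s ^ 3" by (simp add: power_mult_distrib)
    qed
  qed
  then show ?thesis using d assms by (intro exI[of _ "d * \<Lambda> ^ 3"]) simp
qed

end

section \<open>Concentration of adaptively sampled rewards\<close>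

context gossip_bandit
begin

text \<open>Contacts, durations and ties of all times belong to it, even future ones; only the
  rewards of slot \<open>t\<close> or later are left out.\<close>

definition past :: "nat \<Rightarrow> 'w measure" where
  "past t = sigma (space M) {Z d -` E \<inter> space M | d E. not_future t d}"

lemma Z_measurable [measurable]: "Z d \<in> measurable M (count_space UNIV)"
  using indep_draws unfolding indep_vars_def2 by blast

lemma space_past [simp]: "space (past t) = space M"
  unfolding past_def by (rule space_measure_of) auto

lemma sets_past: "sets (past t) = sigma_sets (space M) {Z d -` E \<inter> space M | d E. not_future t d}"
  unfolding past_def by (rule sets_measure_of) auto

lemma sets_past_subset: "sets (past t) \<subseteq> events"
  unfolding sets_past by (rule sets.sigma_sets_subset) (auto intro: measurable_sets)

lemma measurable_from_past: "f \<in> measurable (past t) Y \<Longrightarrow> f \<in> measurable M Y"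
  using measurable_mono[of Y Y "past t" M] sets_past_subset by auto

lemma not_future_mono: "s \<le> t \<Longrightarrow> not_future s d \<Longrightarrow> not_future t d"
  by (cases d) auto

lemma measurable_past_mono:
  assumes "s \<le> t" "f \<in> measurable (past s) Y"
  shows "f \<in> measurable (past t) Y"
proof -
  have "sets (past s) \<subseteq> sets (past t)"
    unfolding sets_past by (rule sigma_sets_mono') (use not_future_mono[OF assms(1)] in blast)
  then show ?thesis using assms(2) measurable_mono[of Y Y "past s" "past t"] by auto
qed

lemma Z_measurable_past: "not_future t d \<Longrightarrow> Z d \<in> measurable (past t) (count_space UNIV)"
  by (rule measurableI) (auto simp: sets_past intro!: sigma_sets.Basic)

lemma I_measurable_past:
  assumes "i \<in> {1..N}" "1 \<le> s" "s \<le> t"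
  shows "I i s \<in> measurable (past t) (count_space UNIV)"
  using nonanticipating[OF assms(1,2)] measurable_past_mono[OF assms(3)]
  unfolding past_def by blast

lemma I_measurable: "i \<in> {1..N} \<Longrightarrow> 1 \<le> s \<Longrightarrow> I i s \<in> measurable M (count_space UNIV)"
  using I_measurable_past measurable_from_past by blast

text \<open>The draw \<open>Reward i l t\<close> is not among those generating
  \<open>past t\<close>, and disjoint groups of independent draws generate independent
  sigma-algebras.\<close>

lemma indep_var_past_reward:
  fixes f :: "nat \<Rightarrow> real"
  assumes X: "X \<in> borel_measurable (past t)"
  shows "indep_var borel X borel (\<lambda>\<omega>. f (Z (Reward i l t) \<omega>))"
proof -
  let ?E = "\<lambda>d. {Z d -` A \<inter> space M |A. A \<in> sets (count_space (UNIV :: nat set))}"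
  let ?I = "\<lambda>b. if b then {d. not_future t d} else {Reward i l t}"
  let ?Y = "\<lambda>\<omega>. f (Z (Reward i l t) \<omega>)"
  have "indep_sets ?E UNIV"
    using indep_draws unfolding indep_vars_def2 by blast
  then have "indep_sets ?E (\<Union>b\<in>UNIV. ?I b)"
    by (rule indep_sets_mono_index[rotated]) auto
  moreover have "Int_stable (?E d)" for d
  proof (rule Int_stableI)
    fix a b assume "a \<in> ?E d" "b \<in> ?E d"
    then obtain A B where "a = Z d -` A \<inter> space M" "b = Z d -` B \<inter> space M" by blast
    then have "a \<inter> b = Z d -` (A \<inter> B) \<inter> space M" by blast
    then show "a \<inter> b \<in> ?E d" by (intro CollectI exI[of _ "A \<inter> B"] conjI) simp_all
  qed
  moreover have "disjoint_family_on ?I UNIV"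
    by (auto simp: disjoint_family_on_def)
  ultimately have ind: "indep_sets (\<lambda>b. sigma_sets (space M) (\<Union>d\<in>?I b. ?E d)) UNIV"
    by (intro indep_sets_collect_sigma) auto
  have past: "sigma_sets (space M) (\<Union>d\<in>?I True. ?E d) = sets (past t)"
    unfolding sets_past by (rule arg_cong[of _ _ "sigma_sets (space M)"]) auto
  have 1: "sigma_sets (space M) {X -` A \<inter> space M | A. A \<in> sets borel} \<subseteq> sets (past t)"
    using measurable_sets[OF X] by (intro sets.sigma_sets_subset[of _ "past t", simplified]) auto
  have 2: "sigma_sets (space M) {?Y -` A \<inter> space M | A. A \<in> sets borel}
      \<subseteq> sigma_sets (space M) (\<Union>d\<in>?I False. ?E d)"
  proof (rule sigma_sets_mono', safe)
    fix A :: "real set"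
    have "?Y -` A \<inter> space M = Z (Reward i l t) -` (f -` A) \<inter> space M" by auto
    then show "?Y -` A \<inter> space M \<in> (\<Union>d\<in>?I False. ?E d)" by auto
  qed
  have "indep_set (sigma_sets (space M) {X -` A \<inter> space M | A. A \<in> sets borel})
          (sigma_sets (space M) {?Y -` A \<inter> space M | A. A \<in> sets borel})"
    unfolding indep_set_def
    by (rule indep_sets_mono_sets[OF ind]) (use 1 2 past in \<open>auto split: bool.split\<close>)
  moreover have "X \<in> borel_measurable M" using X by (rule measurable_from_past)
  moreover have "?Y \<in> borel_measurable M" by measurable
  ultimately show ?thesis unfolding indep_var_eq by blast
qed

end

locale unit_mean_bandit = gossip_bandit M N K \<nu> P Z I U L G
  for M :: "'w measure" and N K \<nu> P Z I U L G +
  assumes mean_unit: "\<And>l. l \<in> {1..K} \<Longrightarrow> 0 \<le> \<nu> l \<and> \<nu> l \<le> 1"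
begin

lemma AE_reward:
  assumes "i \<in> {1..N}" "l \<in> {1..K}" "1 \<le> t"
  shows "AE \<omega> in M. Z (Reward i l t) \<omega> \<in> {0, 1}"
proof -
  have "AE x in distr M (count_space UNIV) (Z (Reward i l t)). x \<in> {0, 1}"
    unfolding reward_law[OF assms] by (auto simp: AE_measure_pmf_iff)
  then show ?thesis by (subst (asm) AE_distr_iff) auto
qed

lemma expectation_reward:
  assumes "i \<in> {1..N}" "l \<in> {1..K}" "1 \<le> t"
  shows "expectation (\<lambda>\<omega>. real (Z (Reward i l t) \<omega>)) = \<nu> l"
proof -
  have "expectation (\<lambda>\<omega>. real (Z (Reward i l t) \<omega>))
      = integral\<^sup>L (distr M (count_space UNIV) (Z (Reward i l t))) real"
    by (rule integral_distr[symmetric]) auto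
  also have "\<dots> = measure_pmf.expectation (bernoulli_pmf (\<nu> l)) (\<lambda>b. real (of_bool b))"
    unfolding reward_law[OF assms] by simp
  also have "\<dots> = \<nu> l" using mean_unit[OF assms(2)] by simp
  finally show ?thesis .
qed

text \<open>Hoeffding's lemma for a centred variable with values in an interval of length 1. The
  sign \<open>sg\<close> treats upper and lower deviations together; it only moves the
  interval.\<close>

lemma expectation_exp_reward:
  fixes \<eta> sg :: real
  assumes "i \<in> {1..N}" "l \<in> {1..K}" "1 \<le> t" and "\<eta> > 0" and sg: "sg = 1 \<or> sg = -1"
  shows "expectation (\<lambda>\<omega>. exp (\<eta> * (sg * (real (Z (Reward i l t) \<omega>) - \<nu> l)) - \<eta>\<^sup>2 / 8)) \<le> 1"
proof -
  let ?f = "\<lambda>\<omega>. sg * (real (Z (Reward i l t) \<omega>) - \<nu> l)"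
  define a where "a = (if sg = 1 then - \<nu> l else \<nu> l - 1)"
  have AE: "AE \<omega> in M. ?f \<omega> \<in> {a..a + 1}"
    using AE_reward[OF assms(1-3)] by eventually_elim (use sg in \<open>auto simp: a_def\<close>)
  interpret f: interval_bounded_random_variable M ?f a "a + 1"
    by unfold_locales (use AE in auto)
  have int: "integrable M (\<lambda>\<omega>. real (Z (Reward i l t) \<omega>))"
  proof (rule integrable_const_bound[where B = 1])
    show "AE \<omega> in M. norm (real (Z (Reward i l t) \<omega>)) \<le> 1"
      using AE_reward[OF assms(1-3)] by eventually_elim auto
  qed simp
  have "expectation ?f = 0"
    using int by (simp add: expectation_reward[OF assms(1-3)] prob_space)
  from f.Hoeffdings_lemma_nn_integral_0[OF \<open>\<eta> > 0\<close> this]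
  have le: "(\<integral>\<^sup>+ x. ennreal (exp (\<eta> * ?f x)) \<partial>M) \<le> ennreal (exp (\<eta>\<^sup>2 / 8))" by simp
  have "integrable M (\<lambda>\<omega>. exp (\<eta> * ?f \<omega>))"
    by (rule integrableI_bounded) (use le in \<open>auto simp: top_unique intro: le_less_trans\<close>)
  then have "expectation (\<lambda>\<omega>. exp (\<eta> * ?f \<omega>)) \<le> exp (\<eta>\<^sup>2 / 8)"
    using le by (subst (asm) nn_integral_eq_integral) auto
  then have "expectation (\<lambda>\<omega>. exp (\<eta> * ?f \<omega>) / exp (\<eta>\<^sup>2 / 8)) \<le> 1" by simp
  then show ?thesis by (simp add: exp_diff)
qed

definition reward_dev :: "nat \<Rightarrow> nat \<Rightarrow> nat \<Rightarrow> 'w \<Rightarrow> real" where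
  "reward_dev i l t \<omega> =
     (\<Sum>s | s \<in> {1..t} \<and> I i s \<omega> = l. real (Z (Reward i (I i s \<omega>) s) \<omega>) - \<nu> l)"

text \<open>The exponential supermartingale of the sampled deviations. The reward is read at the
  fixed arm \<open>l\<close>, not at the arm pulled, so that each factor involves a draw independent
  of the past; the two agree on the slots that count.\<close>

definition exp_weight :: "real \<Rightarrow> real \<Rightarrow> nat \<Rightarrow> nat \<Rightarrow> nat \<Rightarrow> 'w \<Rightarrow> real" where
  "exp_weight sg \<eta> i l t \<omega> = (\<Prod>s\<in>{1..t}.
     if I i s \<omega> = l then exp (\<eta> * (sg * (real (Z (Reward i l s) \<omega>) - \<nu> l)) - \<eta>\<^sup>2 / 8) else 1)"

lemma exp_weight_eq:
  "exp_weight sg \<eta> i l t \<omega>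
     = exp (\<eta> * (sg * reward_dev i l t \<omega>) - \<eta>\<^sup>2 / 8 * real (pulls (\<lambda>s. I i s \<omega>) l {1..t}))"
proof -
  let ?S = "{s \<in> {1..t}. I i s \<omega> = l}"
  have "exp_weight sg \<eta> i l t \<omega>
      = (\<Prod>s\<in>?S. exp (\<eta> * (sg * (real (Z (Reward i (I i s \<omega>) s) \<omega>) - \<nu> l)) - \<eta>\<^sup>2 / 8))"
    unfolding exp_weight_def by (subst prod.inter_filter) (auto intro!: prod.cong)
  also have "\<dots> = exp (\<Sum>s\<in>?S. \<eta> * (sg * (real (Z (Reward i (I i s \<omega>) s) \<omega>) - \<nu> l)) - \<eta>\<^sup>2 / 8)"
    by (subst exp_sum) auto
  also have "(\<Sum>s\<in>?S. \<eta> * (sg * (real (Z (Reward i (I i s \<omega>) s) \<omega>) - \<nu> l)) - \<eta>\<^sup>2 / 8)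
      = \<eta> * (sg * reward_dev i l t \<omega>) - \<eta>\<^sup>2 / 8 * real (pulls (\<lambda>s. I i s \<omega>) l {1..t})"
    unfolding reward_dev_def pulls_def
    by (simp only: sum_subtractf sum_distrib_left[symmetric] sum_constant) simp
  finally show ?thesis .
qed

lemma exp_weight_measurable_past:
  assumes "i \<in> {1..N}" "l \<in> {1..K}"
  shows "exp_weight sg \<eta> i l t \<in> borel_measurable (past (Suc t))"
  unfolding exp_weight_def
proof (rule borel_measurable_prod)
  fix s assume "s \<in> {1..t}"
  then have [measurable]: "I i s \<in> measurable (past (Suc t)) (count_space UNIV)"
    "Z (Reward i l s) \<in> measurable (past (Suc t)) (count_space UNIV)"
    using I_measurable_past[OF assms(1)] by (auto intro!: Z_measurable_past)
  show "(\<lambda>\<omega>. if I i s \<omega> = l then exp (\<eta> * (sg * (real (Z (Reward i l s) \<omega>) - \<nu> l)) - \<eta>\<^sup>2 / 8) else 1)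
      \<in> borel_measurable (past (Suc t))"
    by measurable
qed

lemma exp_weight_supermartingale:
  assumes i: "i \<in> {1..N}" and l: "l \<in> {1..K}" and "\<eta> > 0" and sg: "sg = 1 \<or> sg = -1"
  shows "integrable M (exp_weight sg \<eta> i l t) \<and> expectation (exp_weight sg \<eta> i l t) \<le> 1"
proof (induction t)
  case 0
  have "exp_weight sg \<eta> i l 0 = (\<lambda>_. 1)" by (auto simp: exp_weight_def)
  then show ?case by (simp add: prob_space)
next
  case (Suc t)
  let ?W = "exp_weight sg \<eta> i l t"
  let ?e = "\<lambda>\<omega>. exp (\<eta> * (sg * (real (Z (Reward i l (Suc t)) \<omega>) - \<nu> l)) - \<eta>\<^sup>2 / 8)"
  \<comment> \<open>Whether slot \<open>Suc t\<close> pulls \<open>l\<close> is decided by the past.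
    On that event the weight gains the independent factor \<open>?e\<close>, of mean at most 1; off
    it the weight does not change.\<close>
  let ?V = "\<lambda>\<omega>. if I i (Suc t) \<omega> = l then ?W \<omega> else 0"
  let ?V' = "\<lambda>\<omega>. if I i (Suc t) \<omega> = l then 0 else ?W \<omega>"
  have eq: "exp_weight sg \<eta> i l (Suc t) = (\<lambda>\<omega>. ?V \<omega> * ?e \<omega> + ?V' \<omega>)"
    by (auto simp: exp_weight_def fun_eq_iff)
  have nonneg: "?W \<omega> \<ge> 0" for \<omega> by (simp add: exp_weight_eq)
  have Wp [measurable]: "?W \<in> borel_measurable (past (Suc t))"
    using exp_weight_measurable_past[OF i l] .
  have Ip [measurable]: "I i (Suc t) \<in> measurable (past (Suc t)) (count_space UNIV)"
    using I_measurable_past[OF i] by simp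
  have Vp: "?V \<in> borel_measurable (past (Suc t))" "?V' \<in> borel_measurable (past (Suc t))"
    by measurable
  note VM = Vp[THEN measurable_from_past]
  have intW: "integrable M ?W" and EW: "expectation ?W \<le> 1" using Suc by auto
  have intV: "integrable M ?V" "integrable M ?V'"
    by (rule Bochner_Integration.integrable_bound[OF intW VM(1)], simp add: nonneg)
       (rule Bochner_Integration.integrable_bound[OF intW VM(2)], simp add: nonneg)
  have ind: "indep_var borel ?V borel ?e"
    using indep_var_past_reward[OF Vp(1), of "\<lambda>x. exp (\<eta> * (sg * (real x - \<nu> l)) - \<eta>\<^sup>2 / 8)"] by simp
  have inte: "integrable M ?e"
  proof (rule integrable_const_bound[where B = "exp \<eta>"])
    show "AE \<omega> in M. norm (?e \<omega>) \<le> exp \<eta>"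
      using AE_reward[OF i l, of "Suc t", simplified]
    proof eventually_elim
      case (elim \<omega>)
      have "sg * (real (Z (Reward i l (Suc t)) \<omega>) - \<nu> l) \<le> 1"
        using sg elim mean_unit[OF l] by auto
      then have "\<eta> * (sg * (real (Z (Reward i l (Suc t)) \<omega>) - \<nu> l)) \<le> \<eta> * 1"
        using \<open>\<eta> > 0\<close> by (intro mult_left_mono) auto
      then have "\<eta> * (sg * (real (Z (Reward i l (Suc t)) \<omega>) - \<nu> l)) - \<eta>\<^sup>2 / 8 \<le> \<eta>"
        using zero_le_power2[of \<eta>] by linarith
      then show ?case by simp
    qed
  qed measurable
  have Ve: "integrable M (\<lambda>\<omega>. ?V \<omega> * ?e \<omega>)"
    "expectation (\<lambda>\<omega>. ?V \<omega> * ?e \<omega>) = expectation ?V * expectation ?e"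
    using indep_var_integrable[OF ind intV(1) inte] indep_var_lebesgue_integral[OF ind intV(1) inte] by auto
  have "expectation (exp_weight sg \<eta> i l (Suc t)) = expectation ?V * expectation ?e + expectation ?V'"
    unfolding eq using Ve intV by simp
  also have "\<dots> \<le> expectation ?V * 1 + expectation ?V'"
    using expectation_exp_reward[OF i l _ \<open>\<eta> > 0\<close> sg, of "Suc t"]
    by (intro add_right_mono mult_left_mono Bochner_Integration.integral_nonneg) (auto simp: nonneg)
  also have "\<dots> = expectation (\<lambda>\<omega>. ?V \<omega> + ?V' \<omega>)" using intV by simp
  also have "(\<lambda>\<omega>. ?V \<omega> + ?V' \<omega>) = ?W" by auto
  finally show ?case using EW Ve intV unfolding eq by simp
qed

lemma pulls_measurable:
  assumes "i \<in> {1..N}"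
  shows "(\<lambda>\<omega>. pulls (\<lambda>s. I i s \<omega>) l {1..t}) \<in> measurable M (count_space UNIV)"
proof -
  have "pulls (\<lambda>s. I i s \<omega>) l {1..t} = (\<Sum>s\<in>{1..t}. if I i s \<omega> = l then 1 else 0)" for \<omega>
    by (simp add: pulls_def sum.If_cases Int_def)
  moreover have "(\<lambda>\<omega>. \<Sum>s\<in>{1..t}. if I i s \<omega> = l then 1 else 0 :: nat) \<in> measurable M (count_space UNIV)"
  proof (rule measurable_sum_nat)
    fix s assume "s \<in> {1..t}"
    then have [measurable]: "I i s \<in> measurable M (count_space UNIV)" using assms I_measurable by auto
    show "(\<lambda>\<omega>. if I i s \<omega> = l then 1 else 0 :: nat) \<in> measurable M (count_space UNIV)" by measurable
  qed
  ultimately show ?thesis by simp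
qed

lemma reward_dev_measurable:
  assumes "i \<in> {1..N}"
  shows "reward_dev i l t \<in> borel_measurable M"
proof -
  have "reward_dev i l t = (\<lambda>\<omega>. \<Sum>s\<in>{1..t}. if I i s \<omega> = l then real (Z (Reward i l s) \<omega>) - \<nu> l else 0)"
    by (auto simp: reward_dev_def fun_eq_iff sum.inter_filter[symmetric] intro!: sum.cong)
  moreover have "(\<lambda>\<omega>. \<Sum>s\<in>{1..t}. if I i s \<omega> = l then real (Z (Reward i l s) \<omega>) - \<nu> l else 0)
      \<in> borel_measurable M"
  proof (rule borel_measurable_sum)
    fix s assume "s \<in> {1..t}"
    then have [measurable]: "I i s \<in> measurable M (count_space UNIV)" using assms I_measurable by auto
    show "(\<lambda>\<omega>. if I i s \<omega> = l then real (Z (Reward i l s) \<omega>) - \<nu> l else 0) \<in> borel_measurable M"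
      by measurable
  qed
  ultimately show ?thesis by simp
qed

text \<open>A Chernoff bound with the number of pulls fixed at \<open>n\<close>. Fixing
  \<open>n\<close> allows \<eta> to depend on it; the randomness of the count is dealt with
  afterwards by a union bound.\<close>

lemma prob_reward_dev:
  assumes i: "i \<in> {1..N}" and l: "l \<in> {1..K}" and sg: "sg = 1 \<or> sg = -1" and "n > 0" "x > 0"
  shows "prob {\<omega> \<in> space M. pulls (\<lambda>s. I i s \<omega>) l {1..t} = n \<and> x < sg * reward_dev i l t \<omega>}
           \<le> exp (- 2 * x\<^sup>2 / real n)"
proof -
  \<comment> \<open>The maximiser of \<open>\<eta> * x - \<eta>^2 / 8 * n\<close>, with maximum
    \<open>2 * x^2 / n\<close>.\<close>
  define \<eta> where "\<eta> = 4 * x / real n"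
  have "\<eta> > 0" using assms by (simp add: \<eta>_def)
  note W = exp_weight_supermartingale[OF i l this sg, of t]
  note [measurable] = pulls_measurable[OF i] reward_dev_measurable[OF i]
  have "{\<omega> \<in> space M. pulls (\<lambda>s. I i s \<omega>) l {1..t} = n \<and> x < sg * reward_dev i l t \<omega>}
      \<subseteq> {\<omega> \<in> space M. exp (2 * x\<^sup>2 / real n) \<le> exp_weight sg \<eta> i l t \<omega>}"
  proof safe
    fix \<omega> assume n: "n = pulls (\<lambda>s. I i s \<omega>) l {1..t}" and x: "x < sg * reward_dev i l t \<omega>"
    have "2 * x\<^sup>2 / real n = \<eta> * x - \<eta>\<^sup>2 / 8 * real n"
      using \<open>n > 0\<close> by (simp add: \<eta>_def field_simps power2_eq_square)
    also have "\<dots> \<le> \<eta> * (sg * reward_dev i l t \<omega>) - \<eta>\<^sup>2 / 8 * real n"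
      using x \<open>\<eta> > 0\<close> by simp
    finally show "exp (2 * x\<^sup>2 / real (pulls (\<lambda>s. I i s \<omega>) l {1..t})) \<le> exp_weight sg \<eta> i l t \<omega>"
      unfolding exp_weight_eq n by simp
  qed
  then have "prob {\<omega> \<in> space M. pulls (\<lambda>s. I i s \<omega>) l {1..t} = n \<and> x < sg * reward_dev i l t \<omega>}
      \<le> prob {\<omega> \<in> space M. exp (2 * x\<^sup>2 / real n) \<le> exp_weight sg \<eta> i l t \<omega>}"
    using W by (intro finite_measure_mono) (auto dest: borel_measurable_integrable)
  also have "\<dots> \<le> expectation (exp_weight sg \<eta> i l t) / exp (2 * x\<^sup>2 / real n)"
  proof (rule integral_Markov_inequality_measure[where A = "{}", simplified])
    show "AE \<omega> in M. 0 \<le> exp_weight sg \<eta> i l t \<omega>" by (simp add: exp_weight_eq)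
  qed (use W in auto)
  also have "\<dots> \<le> 1 / exp (2 * x\<^sup>2 / real n)"
    using W by (intro divide_right_mono) auto
  also have "\<dots> = exp (- 2 * x\<^sup>2 / real n)" by (simp add: exp_minus field_simps)
  finally show ?thesis .
qed

text \<open>Violation of the confidence radius of the UCB index, multiplied by the number of pulls
  so that the sum \<open>reward_dev\<close> appears instead of an empirical mean.\<close>

definition deviates :: "real \<Rightarrow> nat \<Rightarrow> nat \<Rightarrow> 'w \<Rightarrow> bool" where
  "deviates \<alpha> i t \<omega> \<longleftrightarrow> (\<exists>l\<in>{1..K}. pulls (\<lambda>s. I i s \<omega>) l {1..t - 1} > 0 \<and>
     sqrt (\<alpha> * real (pulls (\<lambda>s. I i s \<omega>) l {1..t - 1}) * ln (real t)) < \<bar>reward_dev i l (t - 1) \<omega>\<bar>)"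

lemma deviates_sets:
  "i \<in> {1..N} \<Longrightarrow> {\<omega> \<in> space M. deviates \<alpha> i t \<omega>} \<in> events"
proof -
  assume i: "i \<in> {1..N}"
  note [measurable] = pulls_measurable[OF i] reward_dev_measurable[OF i]
  show ?thesis unfolding deviates_def by measurable
qed

text \<open>Each combination of arm, count and sign contributes
  \<open>t powr (- 2 * \<alpha>)\<close>, because the count cancels in the Chernoff exponent. The
  union over at most \<open>t\<close> counts costs the extra power of \<open>t\<close>.\<close>

lemma prob_deviates:
  assumes i: "i \<in> {1..N}" and "\<alpha> > 0" "t \<ge> 2"
  shows "prob {\<omega> \<in> space M. deviates \<alpha> i t \<omega>} \<le> 2 * real K * real t powr (1 - 2 * \<alpha>)"
proof -
  let ?x = "\<lambda>n. sqrt (\<alpha> * real n * ln (real t))"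
  let ?E = "\<lambda>l n sg. {\<omega> \<in> space M. pulls (\<lambda>s. I i s \<omega>) l {1..t - 1} = n \<and>
                ?x n < sg * reward_dev i l (t - 1) \<omega>}"
  note [measurable] = pulls_measurable[OF i] reward_dev_measurable[OF i]
  have E [measurable]: "?E l n sg \<in> events" for l n sg by measurable
  have single: "prob (?E l n sg) \<le> real t powr (- 2 * \<alpha>)"
    if "l \<in> {1..K}" "n \<in> {1..t}" "sg \<in> {1, -1}" for l n sg
  proof -
    have "prob (?E l n sg) \<le> exp (- 2 * (?x n)\<^sup>2 / real n)"
      using that assms by (intro prob_reward_dev) auto
    also have "- 2 * (?x n)\<^sup>2 / real n = - 2 * \<alpha> * ln (real t)"
      using that assms by simp
    finally show ?thesis using assms by (simp add: powr_def)
  qed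
  have "pulls (\<lambda>s. I i s \<omega>) l {1..t - 1} \<le> card {1..t - 1}" for \<omega> l
    unfolding pulls_def by (rule card_mono) auto
  then have le: "pulls (\<lambda>s. I i s \<omega>) l {1..t - 1} \<le> t" for \<omega> l
    using le_trans[of _ "t - 1" t] by simp
  have "{\<omega> \<in> space M. deviates \<alpha> i t \<omega>} \<subseteq> (\<Union>l\<in>{1..K}. \<Union>n\<in>{1..t}. \<Union>sg\<in>{1, -1}. ?E l n sg)"
    (is "_ \<subseteq> ?U")
  proof safe
    fix \<omega> assume "\<omega> \<in> space M" "deviates \<alpha> i t \<omega>"
    then obtain l where l: "l \<in> {1..K}" "pulls (\<lambda>s. I i s \<omega>) l {1..t - 1} > 0"
      "?x (pulls (\<lambda>s. I i s \<omega>) l {1..t - 1}) < \<bar>reward_dev i l (t - 1) \<omega>\<bar>"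
      unfolding deviates_def by blast
    define n where "n = pulls (\<lambda>s. I i s \<omega>) l {1..t - 1}"
    have "n \<in> {1..t}" using l(2) le[of \<omega> l] by (simp add: n_def)
    moreover have "\<omega> \<in> ?E l n 1 \<or> \<omega> \<in> ?E l n (-1)"
      using l(3) \<open>\<omega> \<in> space M\<close> by (auto simp: n_def abs_if split: if_splits)
    ultimately show "\<omega> \<in> ?U" using l(1) by blast
  qed
  then have "prob {\<omega> \<in> space M. deviates \<alpha> i t \<omega>} \<le> prob ?U"
    by (intro finite_measure_mono sets.finite_UN E finite_atLeastAtMost finite.intros)
  also have "\<dots> \<le> (\<Sum>l\<in>{1..K}. prob (\<Union>n\<in>{1..t}. \<Union>sg\<in>{1, -1}. ?E l n sg))"
    by (intro finite_measure_subadditive_finite image_subsetI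
      sets.finite_UN E finite_atLeastAtMost finite.intros)
  also have "\<dots> \<le> (\<Sum>l\<in>{1..K}. \<Sum>n\<in>{1..t}. prob (\<Union>sg\<in>{1, -1}. ?E l n sg))"
    by (intro sum_mono finite_measure_subadditive_finite image_subsetI
      sets.finite_UN E finite_atLeastAtMost finite.intros)
  also have "\<dots> \<le> (\<Sum>l\<in>{1..K}. \<Sum>n\<in>{1..t}. \<Sum>sg\<in>{1, -1::real}. prob (?E l n sg))"
    by (intro sum_mono finite_measure_subadditive_finite image_subsetI
      sets.finite_UN E finite_atLeastAtMost finite.intros)
  also have "\<dots> \<le> (\<Sum>l\<in>{1..K}. \<Sum>n\<in>{1..t}. \<Sum>sg\<in>{1, -1::real}. real t powr (- 2 * \<alpha>))"
    by (intro sum_mono single)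
  also have "\<dots> = 2 * real K * (real t * real t powr (- 2 * \<alpha>))" by simp
  also have "real t * real t powr (- 2 * \<alpha>) = real t powr (1 - 2 * \<alpha>)"
    using assms by (simp add: powr_diff powr_minus field_simps)
  finally show ?thesis .
qed

end

section \<open>Runs without deviations\<close>

text \<open>
  The common abstraction of both algorithms, with \<open>e i j\<close> the last slot before phase \<open>j\<close> of
  agent \<open>i\<close>; synchronous runs have \<open>\<delta> = 0\<close>. All that is used about the source of a received arm
  is that it is a phase of index at least \<open>r\<close> as soon as every agent must have completed phase \<open>r\<close>.
\<close>

definition slack_run ::
  "real \<Rightarrow> nat \<Rightarrow> nat \<Rightarrow> (nat \<Rightarrow> nat) \<Rightarrow> real \<Rightarrow> (nat \<Rightarrow> nat \<Rightarrow> nat) \<Rightarrow> (nat \<Rightarrow> nat \<Rightarrow> nat) \<Rightarrow>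
   (nat \<Rightarrow> nat \<Rightarrow> nat) \<Rightarrow> (nat \<Rightarrow> nat \<Rightarrow> nat) \<Rightarrow> (nat \<Rightarrow> nat \<Rightarrow> nat) \<Rightarrow> (nat \<Rightarrow> nat \<Rightarrow> nat) \<Rightarrow>
   (nat \<Rightarrow> nat \<Rightarrow> nat) \<Rightarrow> bool" where
  "slack_run \<alpha> N K A \<delta> e C I X U L G \<longleftrightarrow>
     insert_eliminate \<alpha> N K (\<lambda>i j. {e i j<..e i (Suc j)}) I X U L G \<and>
     (\<forall>i\<in>{1..N}. e i 0 = 0 \<and>
        real (A 0) \<le> real (e i 1) \<and> real (e i 1) \<le> (1 + \<delta>) * real (A 0) \<and>
        (\<forall>j. real (A (Suc j)) - real (A j) \<le> real (e i (Suc (Suc j))) - real (e i (Suc j)) \<and>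
             real (e i (Suc (Suc j))) - real (e i (Suc j)) \<le> (1 + \<delta>) * (real (A (Suc j)) - real (A j)))) \<and>
     (\<forall>i\<in>{1..N}. \<forall>j. C i j \<in> {1..N} \<and> G i j \<in> {1..K} \<and>
        (\<forall>r. (1 + \<delta>) * real (A r) < real (A j) \<longrightarrow>
          (\<exists>j'\<ge>r. most_pulled K (I (C i j)) {e (C i j) j'<..e (C i j) (Suc j')} (G i j))))"

text \<open>All clocks agree, so \<delta> = 0, and the received arm stems from phase
  \<open>j\<close> itself. The value 0 of \<open>phase_end\<close> at -1 provides the start of phase
  0.\<close>

lemma sync_run_imp_slack_run:
  assumes run: "sync_run \<alpha> N K (phase_end B \<epsilon>) C I X U L G"
    and "mono (\<lambda>x::nat. phase_end B \<epsilon> (int x))"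
    and C: "\<And>i j. i \<in> {1..N} \<Longrightarrow> C i j \<in> {1..N}"
  shows "slack_run \<alpha> N K (\<lambda>x. phase_end B \<epsilon> (int x)) 0 (\<lambda>i j. phase_end B \<epsilon> (int j - 1)) C I X U L G"
proof -
  have ph: "sync_phase (phase_end B \<epsilon>)
      = (\<lambda>i j. {phase_end B \<epsilon> (int j - 1)<..phase_end B \<epsilon> (int (Suc j) - 1)})"
    by (simp add: sync_phase_def fun_eq_iff)
  have mp: "most_pulled K (I (C i j)) (sync_phase (phase_end B \<epsilon>) (C i j) j) (G i j)" if "i \<in> {1..N}" for i j
    using run that unfolding sync_run_def by blast
  have "\<exists>j'\<ge>r. most_pulled K (I (C i j)) {phase_end B \<epsilon> (int j' - 1)<..phase_end B \<epsilon> (int (Suc j') - 1)} (G i j)"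
    if "i \<in> {1..N}" "(1 + 0) * real (phase_end B \<epsilon> (int r)) < real (phase_end B \<epsilon> (int j))" for i j r
  proof (intro exI conjI)
    have "\<not> j \<le> r" using that(2) monoD[OF assms(2), of j r] by auto
    then show "r \<le> j" by simp
  qed (use mp[OF that(1), of j] in \<open>simp add: ph\<close>)
  moreover have "phase_end B \<epsilon> (-1) = 0" by (simp add: phase_end_def)
  moreover have "G i j \<in> {1..K}" if "i \<in> {1..N}" for i j
    using mp[OF that, of j] by (simp add: most_pulled_def is_arg_max_def)
  ultimately show ?thesis
    using run C unfolding slack_run_def sync_run_def ph by (simp add: add.commute[of 1])
qed

lemma sticky_subset: "K > 0 \<Longrightarrow> sticky N K i \<subseteq> {1..K}"
  by (auto simp: sticky_def Suc_le_eq)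

lemma active_0_subset:
  assumes "insert_eliminate \<alpha> N K ph I X U L G" "i \<in> {1..N}" "K > 0"
  shows "active N K U L i 0 \<subseteq> {1..K}"
  using assms sticky_subset[of K N i] by (auto simp: insert_eliminate_def active_def Suc_le_eq)

text \<open>Summing the durations, every agent ends phase \<open>j\<close> between
  \<open>A j\<close> and \<open>(1 + \<delta>) * A j\<close>. If
  \<open>(1 + \<delta>) * A r < A j\<close>, the contacted agent has completed phase
  \<open>r\<close> by the time of the contact, so its current phase \<open>j'\<close> exceeds
  \<open>r\<close>. In particular \<open>j'\<close> is not 0, the arbitrary answer does not occur,
  and the source phase \<open>j' - 1\<close> is at least \<open>r\<close>.\<close>

lemma async_run_imp_slack_run:
  assumes run: "async_run \<alpha> N K D C I X U L G" and "K > 0" "\<delta> \<ge> 0"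
    and sched: "phase_schedule (\<lambda>x. phase_end B \<epsilon> (int x)) \<epsilon>"
    and D: "\<And>i j. i \<in> {1..N} \<Longrightarrow> D i j \<in> duration_range (phase_end B \<epsilon>) \<delta> j"
    and C: "\<And>i j. i \<in> {1..N} \<Longrightarrow> C i j \<in> {1..N}"
  shows "slack_run \<alpha> N K (\<lambda>x. phase_end B \<epsilon> (int x)) \<delta> (\<lambda>i j. \<Sum>y<j. D i y) C I X U L G"
proof -
  interpret phase_schedule "\<lambda>x. phase_end B \<epsilon> (int x)" \<epsilon> by fact
  let ?A = "\<lambda>x::nat. phase_end B \<epsilon> (int x)"
  have ph: "async_phase D = (\<lambda>i j. {\<Sum>y<j. D i y<..\<Sum>y<Suc j. D i y})"
    unfolding async_phase_def lessThan_Suc_atMost ..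
  have minus1: "phase_end B \<epsilon> (-1) = 0" by (simp add: phase_end_def)
  have D0: "real (?A 0) \<le> real (D i 0)" "real (D i 0) \<le> (1 + \<delta>) * real (?A 0)" if "i \<in> {1..N}" for i
    using D[OF that, of 0] by (auto simp: duration_range_def minus1)
  have DS: "real (?A (Suc j)) - real (?A j) \<le> real (D i (Suc j))"
    "real (D i (Suc j)) \<le> (1 + \<delta>) * (real (?A (Suc j)) - real (?A j))" if "i \<in> {1..N}" for i j
    using D[OF that, of "Suc j"] by (auto simp: duration_range_def)
  have sums: "real (?A j) \<le> real (\<Sum>y\<le>j. D i y)" "real (\<Sum>y\<le>j. D i y) \<le> (1 + \<delta>) * real (?A j)"
    if "i \<in> {1..N}" for i j
  proof -
    show "real (?A j) \<le> real (\<Sum>y\<le>j. D i y)"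
    proof (induction j)
      case (Suc j) then show ?case using DS(1)[OF that, of j] unfolding sum.atMost_Suc of_nat_add by linarith
    qed (use D0[OF that] in simp)
    show "real (\<Sum>y\<le>j. D i y) \<le> (1 + \<delta>) * real (?A j)"
    proof (induction j)
      case (Suc j) then show ?case
        using DS(2)[OF that, of j] unfolding sum.atMost_Suc of_nat_add right_diff_distrib by linarith
    qed (use D0[OF that] in simp)
  qed
  have ie: "insert_eliminate \<alpha> N K (async_phase D) I X U L G"
    using run unfolding async_run_def by blast
  have gossip: "G i j \<in> {1..K} \<and> (\<forall>r. (1 + \<delta>) * real (?A r) < real (?A j) \<longrightarrow>
      (\<exists>j'\<ge>r. most_pulled K (I (C i j)) {\<Sum>y<j'. D (C i j) y<..\<Sum>y<Suc j'. D (C i j) y} (G i j)))"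
    if i: "i \<in> {1..N}" for i j
  proof -
    define m where "m = C i j"
    define t where "t = (\<Sum>y\<le>j. D i y)"
    define j' where "j' = phase_at D m t"
    have m: "m \<in> {1..N}" using C[OF i] by (simp add: m_def)
    have G: "if j' = 0 then G i j \<in> active N K U L m 0
             else most_pulled K (I m) (async_phase D m (j' - 1)) (G i j)"
      using run i unfolding async_run_def Let_def j'_def t_def m_def by blast
    have "\<exists>r. t \<le> (\<Sum>y\<le>r. D m y)"
    proof -
      obtain r where "real t \<le> real (?A r)" using A_reaches by blast
      then show ?thesis using sums(1)[OF m, of r] by (intro exI[of _ r]) linarith
    qed
    then have t: "t \<le> (\<Sum>y\<le>j'. D m y)" unfolding j'_def phase_at_def by (rule LeastI_ex)
    have "G i j \<in> {1..K}"
      using G active_0_subset[OF ie m \<open>K > 0\<close>]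
      by (auto simp: most_pulled_def is_arg_max_def split: if_splits)
    moreover have "\<exists>j'\<ge>r. most_pulled K (I m) {\<Sum>y<j'. D m y<..\<Sum>y<Suc j'. D m y} (G i j)"
      if "(1 + \<delta>) * real (?A r) < real (?A j)" for r
    proof -
      have "(\<Sum>y\<le>r. D m y) < (\<Sum>y\<le>j'. D m y)"
        using that sums(2)[OF m, of r] sums(1)[OF i, of j] t unfolding t_def by linarith
      moreover have "(\<Sum>y\<le>j'. D m y) \<le> (\<Sum>y\<le>r. D m y)" if "j' \<le> r"
        using that by (intro sum_mono2) auto
      ultimately have "r < j'" by (meson linorder_not_less)
      then show ?thesis using G unfolding ph by (intro exI[of _ "j' - 1"]) auto
    qed
    ultimately show ?thesis unfolding m_def by blast
  qed
  show ?thesis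
    unfolding slack_run_def using ie gossip C D0 DS unfolding ph by simp
qed

text \<open>All members of \<open>S\<close> except the last are pulls of \<open>l\<close> before the
  last one, and \<open>c\<close> bounds their number.\<close>

lemma card_le_of_pulls_le:
  assumes "c \<ge> 0" "finite S" and S: "\<And>t. t \<in> S \<Longrightarrow> 1 \<le> t \<and> I t = l \<and> real (pulls I l {1..t - 1}) \<le> c"
  shows "real (card S) \<le> c + 1"
proof (cases "S = {}")
  case False
  define m where "m = Max S"
  have m: "m \<in> S" "\<And>t. t \<in> S \<Longrightarrow> t \<le> m" using False assms(2) by (auto simp: m_def)
  have "S - {m} \<subseteq> {t \<in> {1..m - 1}. I t = l}"
  proof
    fix t assume "t \<in> S - {m}"
    then show "t \<in> {t \<in> {1..m - 1}. I t = l}" using S[of t] m(2)[of t] by auto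
  qed
  then have "card (S - {m}) \<le> pulls I l {1..m - 1}"
    unfolding pulls_def by (intro card_mono) auto
  then have "real (card (S - {m})) \<le> c" using S[OF m(1)] by linarith
  then show ?thesis using card_Suc_Diff1[OF assms(2) m(1)] by linarith
qed (use assms in auto)

text \<open>The \<open>N\<close> blocks of length \<open>c = \<lceil>K / N\<rceil>\<close> cover all
  labels because \<open>c * N \<ge> K\<close>. Quotient and remainder of \<open>b - 1\<close> by
  \<open>c\<close> give the agent and the position in its block.\<close>

lemma best_arm_sticky:
  assumes "b \<in> {1..K}" "N > 0"
  shows "\<exists>i\<in>{1..N}. b \<in> sticky N K i"
proof -
  define c where "c = sticky_size N K"
  have "real K / real N \<le> real c" unfolding c_def sticky_size_def by (rule of_nat_ceiling)
  then have "real K \<le> real (c * N)" using assms by (simp add: field_simps)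
  then have K: "K \<le> c * N" by (simp only: of_nat_le_iff)
  then have "c > 0" using assms by (cases c) auto
  have "b - 1 < N * c" using K assms(1) unfolding atLeastAtMost_iff mult.commute[of c] by linarith
  then have "(b - 1) div c < N" using \<open>c > 0\<close> by (simp add: div_less_iff_less_mult)
  moreover have "((b - 1) div c * c + (b - 1) mod c) mod K + 1 = b"
    using assms mod_less[of "b - 1" K] by auto
  then have "b \<in> sticky N K ((b - 1) div c + 1)"
    unfolding sticky_def c_def[symmetric] using \<open>c > 0\<close>
    by (intro image_eqI[of _ _ "(b - 1) mod c"]) auto
  ultimately show ?thesis by (intro bexI[of _ "(b - 1) div c + 1"]) auto
qed

lemma card_sticky_le: "card (sticky N K i) \<le> sticky_size N K"
  unfolding sticky_def using card_image_le[of "{..<sticky_size N K}"] by simp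

text \<open>The sum, times the logarithmic factor, bounds the pulls of all suboptimal arms in an
  accurate phase \<open>j\<close> in which \<open>b\<close> is active; the term
  \<open>ln (1 + \<delta>)\<close> is there because the phase may last until
  \<open>(1 + \<delta>) * A j\<close>. The leading 2 leaves more than half of the slots to
  \<open>b\<close>.\<close>

definition long_phase :: "real \<Rightarrow> nat \<Rightarrow> (nat \<Rightarrow> real) \<Rightarrow> nat \<Rightarrow> real \<Rightarrow> (nat \<Rightarrow> nat) \<Rightarrow> nat \<Rightarrow> bool" where
  "long_phase \<alpha> K \<nu> b \<delta> A j \<longleftrightarrow>
     2 * (\<Sum>l\<in>{1..K} - {b}. 4 * \<alpha> / (\<nu> b - \<nu> l)\<^sup>2 * (1 + ln (1 + \<delta>)) + 1) * (ln (real (A j)) + 1)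
       < real (A j) - real (A (j - 1))"

section \<open>Deterministic analysis of one realisation\<close>

locale slack_path = phase_schedule A \<epsilon> for A \<epsilon> +
  fixes \<alpha> :: real and \<nu> :: "nat \<Rightarrow> real" and b N K :: nat and \<delta> :: real
    and e C I X U L G :: "nat \<Rightarrow> nat \<Rightarrow> nat"
  assumes \<alpha>_pos: "\<alpha> > 0" and \<delta>_nonneg: "\<delta> \<ge> 0" and best: "b \<in> {1..K}" and N_pos: "N > 0"
    and gap: "\<And>l. l \<in> {1..K} \<Longrightarrow> l \<noteq> b \<Longrightarrow> \<nu> l < \<nu> b"
    and run: "slack_run \<alpha> N K A \<delta> e C I X U L G"
begin

abbreviation "act \<equiv> active N K U L"
abbreviation "ph i j \<equiv> {e i j<..e i (Suc j)}"

definition accurate :: "nat \<Rightarrow> nat \<Rightarrow> bool" where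
  "accurate i t \<longleftrightarrow> (\<forall>l\<in>{1..K}. pulls (I i) l {1..t - 1} > 0 \<longrightarrow>
     \<bar>emp_mean (I i) (X i) l (t - 1) - \<nu> l\<bar> \<le> sqrt (\<alpha> * ln (real t) / real (pulls (I i) l {1..t - 1})))"

definition best_dominates :: "nat \<Rightarrow> nat \<Rightarrow> bool" where
  "best_dominates i j \<longleftrightarrow> (\<forall>l\<in>{1..K}. l \<noteq> b \<longrightarrow> pulls (I i) l (ph i j) < pulls (I i) b (ph i j))"

lemma insert_eliminate: "insert_eliminate \<alpha> N K ph I X U L G"
  using run unfolding slack_run_def by blast

lemma contact_range: "i \<in> {1..N} \<Longrightarrow> C i j \<in> {1..N}"
  using run unfolding slack_run_def by blast

lemma gossip_range: "i \<in> {1..N} \<Longrightarrow> G i j \<in> {1..K}"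
  using run unfolding slack_run_def by blast

lemma gossip_source:
  "i \<in> {1..N} \<Longrightarrow> (1 + \<delta>) * real (A r) < real (A j) \<Longrightarrow>
     \<exists>j'\<ge>r. most_pulled K (I (C i j)) (ph (C i j) j') (G i j)"
  using run unfolding slack_run_def by blast

lemma e_0: "i \<in> {1..N} \<Longrightarrow> e i 0 = 0"
  using run unfolding slack_run_def by blast

lemma phase_length_ge:
  "i \<in> {1..N} \<Longrightarrow> 0 < j \<Longrightarrow> real (A j) - real (A (j - 1)) \<le> real (e i (Suc j)) - real (e i j)"
  using run unfolding slack_run_def by (cases j) auto

lemma e_bounds:
  assumes "i \<in> {1..N}"
  shows "real (A j) \<le> real (e i (Suc j))" "real (e i (Suc j)) \<le> (1 + \<delta>) * real (A j)"
proof -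
  have 0: "real (A 0) \<le> real (e i 1)" "real (e i 1) \<le> (1 + \<delta>) * real (A 0)"
    using run assms unfolding slack_run_def by auto
  have S: "real (A (Suc j)) - real (A j) \<le> real (e i (Suc (Suc j))) - real (e i (Suc j))"
    "real (e i (Suc (Suc j))) - real (e i (Suc j)) \<le> (1 + \<delta>) * (real (A (Suc j)) - real (A j))" for j
    using run assms unfolding slack_run_def by auto
  show "real (A j) \<le> real (e i (Suc j))"
  proof (induction j)
    case (Suc j) then show ?case using S(1)[of j] by linarith
  qed (use 0 in simp)
  show "real (e i (Suc j)) \<le> (1 + \<delta>) * real (A j)"
  proof (induction j)
    case (Suc j) then show ?case using S(2)[of j] unfolding right_diff_distrib by linarith
  qed (use 0 in simp)
qed

lemma e_mono:
  assumes i: "i \<in> {1..N}" and "j \<le> j'"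
  shows "e i j \<le> e i j'"
proof -
  have "e i n \<le> e i (Suc n)" for n
  proof (cases n)
    case 0 then show ?thesis using e_0[OF i] by simp
  next
    case (Suc k)
    have "A k \<le> A (Suc k)" by (intro A_le) simp
    then show ?thesis using phase_length_ge[OF i, of n] Suc by simp
  qed
  then show ?thesis using \<open>j \<le> j'\<close> by (rule lift_Suc_mono_le)
qed

lemma slot_in_phase:
  assumes i: "i \<in> {1..N}" and "1 \<le> t"
  shows "\<exists>j. t \<in> ph i j"
proof -
  have ex: "\<exists>j. t \<le> e i (Suc j)"
  proof -
    obtain j where "real t \<le> real (A j)" using A_reaches by blast
    then show ?thesis using e_bounds(1)[OF i, of j] by (intro exI[of _ j]) linarith
  qed
  define j where "j = (LEAST j. t \<le> e i (Suc j))"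
  have "t \<le> e i (Suc j)" unfolding j_def using ex by (rule LeastI_ex)
  moreover have "e i j < t"
  proof (cases j)
    case 0 then show ?thesis using e_0[OF i] assms(2) by simp
  next
    case (Suc k)
    then have "\<not> t \<le> e i (Suc k)" using not_less_Least[of k "\<lambda>j. t \<le> e i (Suc j)"] j_def by simp
    then show ?thesis using Suc by simp
  qed
  ultimately show ?thesis by auto
qed

lemma phase_index_ge:
  assumes "i \<in> {1..N}" "t \<in> ph i j" "e i w < t"
  shows "w \<le> j"
proof (rule ccontr)
  assume "\<not> w \<le> j"
  then have "e i (Suc j) \<le> e i w" using assms(1) by (intro e_mono) auto
  with assms show False by auto
qed

lemma K_pos: "K > 0"
  using best by simp

lemma ucb_pull:
  "i \<in> {1..N} \<Longrightarrow> t \<in> ph i j \<Longrightarrow> is_arg_max (ucb_index \<alpha> (I i) (X i) t) (\<lambda>l. l \<in> act i j) (I i t)"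
  using insert_eliminate unfolding insert_eliminate_def by blast

lemma act_step:
  assumes "i \<in> {1..N}"
  shows "G i j \<in> act i j \<Longrightarrow> act i (Suc j) = act i j"
    and "G i j \<notin> act i j \<Longrightarrow> L i (Suc j) = G i j \<and>
           is_arg_max (\<lambda>l. pulls (I i) l (ph i j)) (\<lambda>l. l \<in> {U i j, L i j}) (U i (Suc j))"
  using insert_eliminate assms unfolding insert_eliminate_def active_def by metis+

lemma act_subset: "i \<in> {1..N} \<Longrightarrow> act i j \<subseteq> {1..K}"
proof (induction j)
  case 0
  show ?case using active_0_subset[OF insert_eliminate 0 K_pos] .
next
  case (Suc j)
  show ?case
  proof (cases "G i j \<in> act i j")
    case True
    then show ?thesis using act_step(1)[OF Suc.prems True] Suc by simp
  next
    case False
    note step = act_step(2)[OF Suc.prems False]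
    have "U i (Suc j) \<in> {U i j, L i j}" using step by (simp add: is_arg_max_def)
    then have "U i (Suc j) \<in> {1..K}" using Suc by (auto simp: active_def)
    then show ?thesis
      using step gossip_range[OF Suc.prems, of j] sticky_subset[OF K_pos] by (simp add: active_def)
  qed
qed

lemma pull_range:
  assumes "i \<in> {1..N}" "1 \<le> t"
  shows "I i t \<in> {1..K}"
  using slot_in_phase[OF assms] ucb_pull[OF assms(1)] act_subset[OF assms(1)]
  unfolding is_arg_max_def by blast

text \<open>The usual UCB argument: a larger count would make twice the radius of \<open>l\<close>
  smaller than its gap, so the index of \<open>l\<close> would lie below \<open>\<nu> b\<close>,
  hence below the index of \<open>b\<close>. If \<open>b\<close> has not been pulled yet, its index
  is infinite and the contradiction is immediate.\<close>

lemma suboptimal_pulls_le: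
  assumes i: "i \<in> {1..N}" and t: "t \<in> ph i j" and "b \<in> act i j" and acc: "accurate i t"
    and l: "I i t = l" "l \<noteq> b"
  shows "real (pulls (I i) l {1..t - 1}) \<le> 4 * \<alpha> * ln (real t) / (\<nu> b - \<nu> l)\<^sup>2"
proof (rule ccontr)
  assume neg: "\<not> ?thesis"
  let ?T = "\<lambda>l. pulls (I i) l {1..t - 1}" and ?m = "\<lambda>l. emp_mean (I i) (X i) l (t - 1)"
  let ?r = "\<lambda>l. sqrt (\<alpha> * ln (real t) / real (?T l))"
  have t1: "1 \<le> t" using t by simp
  have lK: "l \<in> {1..K}" using pull_range[OF i t1] l by simp
  define \<Delta> where "\<Delta> = \<nu> b - \<nu> l"
  have \<Delta>: "\<Delta> > 0" using gap[OF lK l(2)] by (simp add: \<Delta>_def)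
  have big: "4 * \<alpha> * ln (real t) / \<Delta>\<^sup>2 < real (?T l)" using neg by (simp add: \<Delta>_def)
  moreover have "0 \<le> 4 * \<alpha> * ln (real t) / \<Delta>\<^sup>2" using \<alpha>_pos t1 by simp
  ultimately have Tl: "0 < ?T l" by linarith
  have "4 * (\<alpha> * ln (real t) / real (?T l)) < \<Delta>\<^sup>2"
    using big Tl \<Delta> by (simp add: field_simps)
  then have "sqrt (4 * (\<alpha> * ln (real t) / real (?T l))) < sqrt (\<Delta>\<^sup>2)"
    by (rule real_sqrt_less_mono)
  then have r: "2 * ?r l < \<Delta>"
    using \<Delta> unfolding real_sqrt_mult[of 4] by simp
  have max: "\<not> ucb_index \<alpha> (I i) (X i) t l < ucb_index \<alpha> (I i) (X i) t b"
    using ucb_pull[OF i t] \<open>b \<in> act i j\<close> l unfolding is_arg_max_def by blast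
  have ul: "ucb_index \<alpha> (I i) (X i) t l = ereal (?m l + ?r l)"
    using Tl by (simp add: ucb_index_def)
  have ml: "?m l \<le> \<nu> l + ?r l" using acc lK Tl unfolding accurate_def by fastforce
  show False
  proof (cases "?T b = 0")
    case True
    then show False using max ul by (simp add: ucb_index_def)
  next
    case False
    then have "ucb_index \<alpha> (I i) (X i) t b = ereal (?m b + ?r b)"
      by (simp add: ucb_index_def)
    moreover have "\<nu> b \<le> ?m b + ?r b"
      using acc best False unfolding accurate_def by fastforce
    ultimately show False using max ul ml r unfolding \<Delta>_def by simp
  qed
qed

lemma best_dominates_if_long:
  assumes i: "i \<in> {1..N}" and "b \<in> act i j" and acc: "\<And>t. t \<in> ph i j \<Longrightarrow> accurate i t"
    and long: "long_phase \<alpha> K \<nu> b \<delta> A j" and "0 < j"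
  shows "best_dominates i j"
proof -
  let ?c = "\<lambda>l. 4 * \<alpha> / (\<nu> b - \<nu> l)\<^sup>2 * (1 + ln (1 + \<delta>)) + 1"
  let ?y = "ln (real (A j)) + 1"
  let ?p = "\<lambda>l. pulls (I i) l (ph i j)"
  have A1: "1 \<le> real (A j)" by (rule A_ge_1)
  have le: "real (?p l) \<le> ?c l * ?y" if l: "l \<in> {1..K} - {b}" for l
  proof -
    have "4 * \<alpha> / (\<nu> b - \<nu> l)\<^sup>2 \<ge> 0" using \<alpha>_pos by simp
    have "real (?p l) \<le> 4 * \<alpha> / (\<nu> b - \<nu> l)\<^sup>2 * ((1 + ln (1 + \<delta>)) * ?y) + 1"
      unfolding pulls_def
    proof (rule card_le_of_pulls_le)
      fix t assume "t \<in> {t \<in> ph i j. I i t = l}"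
      then have t: "t \<in> ph i j" "I i t = l" by auto
      have "real t \<le> (1 + \<delta>) * real (A j)" using t(1) e_bounds(2)[OF i, of j] by simp
      then have "ln (real t) \<le> ln ((1 + \<delta>) * real (A j))"
        using t(1) \<delta>_nonneg A1 by (subst ln_le_cancel_iff) auto
      also have "\<dots> = ln (1 + \<delta>) + ln (real (A j))"
        using \<delta>_nonneg A1 by (intro ln_mult_pos) auto
      also have "\<dots> \<le> (1 + ln (1 + \<delta>)) * ?y"
        using \<delta>_nonneg A1 by (simp add: algebra_simps)
      finally have "4 * \<alpha> / (\<nu> b - \<nu> l)\<^sup>2 * ln (real t)
          \<le> 4 * \<alpha> / (\<nu> b - \<nu> l)\<^sup>2 * ((1 + ln (1 + \<delta>)) * ?y)"
        using \<open>4 * \<alpha> / (\<nu> b - \<nu> l)\<^sup>2 \<ge> 0\<close> by (rule mult_left_mono)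
      moreover have "real (pulls (I i) l {1..t - 1}) \<le> 4 * \<alpha> / (\<nu> b - \<nu> l)\<^sup>2 * ln (real t)"
        using suboptimal_pulls_le[OF i t(1) assms(2) acc[OF t(1)] t(2)] l by simp
      ultimately show "1 \<le> t \<and> I i t = l \<and> real (pulls (I i) l {1..t - 1})
          \<le> 4 * \<alpha> / (\<nu> b - \<nu> l)\<^sup>2 * ((1 + ln (1 + \<delta>)) * ?y)"
        using t by auto
    qed (use \<alpha>_pos \<delta>_nonneg A1 in auto)
    \<comment> \<open>The one pull beyond the threshold is absorbed using
      \<open>?y \<ge> 1\<close>.\<close>
    also have "\<dots> \<le> 4 * \<alpha> / (\<nu> b - \<nu> l)\<^sup>2 * ((1 + ln (1 + \<delta>)) * ?y) + ?y"
      using A1 by simp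
    also have "\<dots> = ?c l * ?y" by (simp only: distrib_right mult.assoc mult_1)
    finally show ?thesis .
  qed
  have "card (ph i j) = (\<Sum>l\<in>{1..K}. ?p l)"
  proof -
    have "ph i j = (\<Union>l\<in>{1..K}. {t \<in> ph i j. I i t = l})"
    proof (intro equalityI subsetI)
      fix t assume t: "t \<in> ph i j"
      then have "I i t \<in> {1..K}" by (intro pull_range[OF i]) simp
      with t show "t \<in> (\<Union>l\<in>{1..K}. {t \<in> ph i j. I i t = l})" by blast
    qed blast
    then have "card (ph i j) = card (\<Union>l\<in>{1..K}. {t \<in> ph i j. I i t = l})" by (rule arg_cong)
    also have "card (\<Union>l\<in>{1..K}. {t \<in> ph i j. I i t = l}) = (\<Sum>l\<in>{1..K}. ?p l)"
      unfolding pulls_def by (rule card_UN_disjoint) auto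
    finally show ?thesis .
  qed
  also have "\<dots> = ?p b + (\<Sum>l\<in>{1..K} - {b}. ?p l)" using best by (intro sum.remove) auto
  finally have "real (card (ph i j)) = real (?p b) + (\<Sum>l\<in>{1..K} - {b}. real (?p l))" by simp
  then have tot: "real (e i (Suc j)) - real (e i j) = real (?p b) + (\<Sum>l\<in>{1..K} - {b}. real (?p l))"
    using e_mono[OF i, of j "Suc j"] by (simp add: of_nat_diff)
  have "(\<Sum>l\<in>{1..K} - {b}. real (?p l)) \<le> (\<Sum>l\<in>{1..K} - {b}. ?c l * ?y)"
    by (rule sum_mono) (rule le)
  also have "\<dots> = (\<Sum>l\<in>{1..K} - {b}. ?c l) * ?y" by (simp add: sum_distrib_right)
  finally have "2 * (\<Sum>l\<in>{1..K} - {b}. real (?p l)) \<le> 2 * (\<Sum>l\<in>{1..K} - {b}. ?c l) * ?y" by simp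
  \<comment> \<open>The actual phase is at least as long as the scheduled one, so \<open>b\<close>
    gets more pulls than all other arms together, which is more than domination arm by arm.\<close>
  also have "\<dots> < real (e i (Suc j)) - real (e i j)"
    using long phase_length_ge[OF i \<open>0 < j\<close>] unfolding long_phase_def by linarith
  finally have half: "(\<Sum>l\<in>{1..K} - {b}. real (?p l)) < real (?p b)" unfolding tot by simp
  show ?thesis
    unfolding best_dominates_def
  proof (intro ballI impI)
    fix l assume l: "l \<in> {1..K}" "l \<noteq> b"
    have "real (?p l) \<le> (\<Sum>l\<in>{1..K} - {b}. real (?p l))"
      using l by (intro member_le_sum) auto
    with half show "?p l < ?p b" by simp
  qed
qed

text \<open>A sticky \<open>b\<close> stays anyway. Otherwise \<open>b\<close> is one of the two
  non-sticky arms, and strict domination makes it the one that is retained.\<close>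

lemma best_persists:
  assumes i: "i \<in> {1..N}" and act: "b \<in> act i j" and dom: "best_dominates i j"
  shows "b \<in> act i (Suc j)"
proof (cases "G i j \<in> act i j")
  case False
  note step = act_step(2)[OF i False]
  show ?thesis
  proof (cases "b \<in> {U i j, L i j}")
    case True
    have "U i (Suc j) \<in> {U i j, L i j}" using step by (simp add: is_arg_max_def)
    then have "U i (Suc j) \<in> {1..K}" using act_subset[OF i, of j] by (auto simp: active_def)
    moreover have "\<not> pulls (I i) (U i (Suc j)) (ph i j) < pulls (I i) b (ph i j)"
      using step True unfolding is_arg_max_def by blast
    ultimately have "U i (Suc j) = b" using dom unfolding best_dominates_def by blast
    then show ?thesis by (simp add: active_def)
  qed (use act in \<open>auto simp: active_def\<close>)
next
  case True
  show ?thesis using act unfolding act_step(1)[OF i True] .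
qed

lemma gossip_in_act:
  assumes "i \<in> {1..N}"
  shows "G i j \<in> act i (Suc j)"
proof (cases "G i j \<in> act i j")
  case True
  then show ?thesis using act_step(1)[OF assms True] by simp
next
  case False
  then have "L i (Suc j) = G i j" using act_step(2)[OF assms False] by simp
  then have "G i j \<in> {U i (Suc j), L i (Suc j)}" by simp
  then show ?thesis unfolding active_def by blast
qed

text \<open>A phase of index above \<open>reach s\<close> starts no earlier than
  \<open>A (reach s)\<close>, hence not before \<open>s\<close>, so all its slots are
  accurate.\<close>

lemma best_dominates_late:
  assumes acc: "\<And>i t. i \<in> {1..N} \<Longrightarrow> s < real t \<Longrightarrow> accurate i t"
    and long: "\<And>j. reach s < j \<Longrightarrow> long_phase \<alpha> K \<nu> b \<delta> A j"
    and i: "i \<in> {1..N}" and j: "reach s < j" and act: "b \<in> act i j"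
  shows "best_dominates i j"
proof (rule best_dominates_if_long[OF i act])
  fix t assume t: "t \<in> ph i j"
  obtain k where k: "j = Suc k" using j by (cases j) auto
  have "s \<le> real (A (reach s))" by (rule le_A_reach)
  also have "\<dots> \<le> real (A k)" using j k by (simp add: A_le)
  also have "\<dots> \<le> real (e i j)" using e_bounds(1)[OF i, of k] k by simp
  also have "\<dots> < real t" using t by simp
  finally show "accurate i t" using acc[OF i] by simp
qed (use long j in auto)

lemma best_kept:
  assumes acc: "\<And>i t. i \<in> {1..N} \<Longrightarrow> s < real t \<Longrightarrow> accurate i t"
    and long: "\<And>j. reach s < j \<Longrightarrow> long_phase \<alpha> K \<nu> b \<delta> A j"
    and i: "i \<in> {1..N}" and j: "reach s < j" and act: "b \<in> act i j" and "j \<le> j'"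
  shows "b \<in> act i j'"
  using \<open>j \<le> j'\<close>
proof (induction j' rule: dec_induct)
  case (step n)
  have "best_dominates i n"
    using step j by (intro best_dominates_late[where s = s, OF acc long i]) auto
  then show ?case using best_persists[OF i] step by blast
qed (use act in simp)

lemma gossip_best:
  assumes acc: "\<And>i t. i \<in> {1..N} \<Longrightarrow> s < real t \<Longrightarrow> accurate i t"
    and long: "\<And>j. reach s < j \<Longrightarrow> long_phase \<alpha> K \<nu> b \<delta> A j"
    and i: "i \<in> {1..N}" and w: "reach s \<le> w" and act: "\<And>j'. w \<le> j' \<Longrightarrow> b \<in> act (C i j) j'"
    and j: "(1 + \<delta>) * real (A (w + 1)) < real (A j)"
  shows "G i j = b"
proof -
  \<comment> \<open>The shift from \<open>w\<close> to \<open>w + 1\<close> is needed since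
    domination is known only for indices strictly above \<open>reach s\<close>, whereas
    \<open>w\<close> may equal \<open>reach s\<close>.\<close>
  obtain j' where j': "j' \<ge> w + 1" "most_pulled K (I (C i j)) (ph (C i j) j') (G i j)"
    using gossip_source[OF i j] by blast
  have "best_dominates (C i j) j'"
    using j'(1) w by (intro best_dominates_late[where s = s, OF acc long contact_range[OF i]] act) linarith+
  then show ?thesis
    using j'(2) best unfolding most_pulled_def is_arg_max_def best_dominates_def by blast
qed

lemma best_spreads:
  assumes acc: "\<And>i t. i \<in> {1..N} \<Longrightarrow> s < real t \<Longrightarrow> accurate i t"
    and long: "\<And>j. reach s < j \<Longrightarrow> long_phase \<alpha> K \<nu> b \<delta> A j"
    and i: "i \<in> {1..N}" and w: "reach s \<le> w" and act: "\<And>j. w \<le> j \<Longrightarrow> b \<in> act m j"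
    and v: "(1 + \<delta>) * real (A (w + 1)) < real (A v)" "w + 1 < v"
    and j: "j \<in> {v..<v + n}" "C i j = m" and j': "v + n \<le> j'"
  shows "b \<in> act i j'"
proof -
  have "A v \<le> A j" using j by (intro A_le) simp
  then have "(1 + \<delta>) * real (A (w + 1)) < real (A j)" using v(1) by linarith
  moreover have "b \<in> act (C i j) j'" if "w \<le> j'" for j' using act[OF that] j(2) by simp
  ultimately have "G i j = b" by (intro gossip_best[where s = s, OF acc long i w])
  then have in_act: "b \<in> act i (Suc j)" using gossip_in_act[OF i, of j] by simp
  have le: "reach s < Suc j" "Suc j \<le> j'" using j(1) j' w v(2) by auto
  show ?thesis by (rule best_kept[where s = s, OF acc long i le(1) in_act le(2)])
qed

text \<open>Once all agents hold \<open>b\<close>, all sufficiently late recommendations are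
  \<open>b\<close>, an arm that is already active, so no set changes any more. The limit set has at
  most \<open>sticky_size N K + 2\<close> elements, one of which is \<open>b\<close>.\<close>

lemma active_sets_freeze:
  assumes acc: "\<And>i t. i \<in> {1..N} \<Longrightarrow> s < real t \<Longrightarrow> accurate i t"
    and long: "\<And>j. reach s < j \<Longrightarrow> long_phase \<alpha> K \<nu> b \<delta> A j"
    and act: "\<And>i j. i \<in> {1..N} \<Longrightarrow> w \<le> j \<Longrightarrow> b \<in> act i j"
    and i: "i \<in> {1..N}"
  shows "\<exists>v S. b \<in> S \<and> S \<subseteq> {1..K} \<and> card (S - {b}) \<le> sticky_size N K + 1 \<and> (\<forall>j\<ge>v. act i j = S)"
proof -
  define u where "u = max (reach s) w"
  obtain v where v: "(1 + \<delta>) * real (A (u + 1)) < real (A v)" using A_exceeds by blast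
  have step: "act i (Suc j) = act i j" if "max v w \<le> j" for j
  proof -
    have "A v \<le> A j" using that by (intro A_le) simp
    then have "(1 + \<delta>) * real (A (u + 1)) < real (A j)" using v by linarith
    moreover have "reach s \<le> u" "\<And>j'. u \<le> j' \<Longrightarrow> b \<in> act (C i j) j'"
      using act[OF contact_range[OF i]] by (auto simp: u_def)
    ultimately have "G i j = b" by (intro gossip_best[where s = s, OF acc long i])
    moreover have "b \<in> act i j" using act[OF i] that by simp
    ultimately show ?thesis by (intro act_step(1)[OF i]) simp
  qed
  have const: "act i j = act i (max v w)" if "max v w \<le> j" for j
    using that by (induction j rule: dec_induct) (simp_all add: step)
  define S where "S = act i (max v w)"
  have "b \<in> S" using act[OF i] by (simp add: S_def)
  moreover have "card S \<le> sticky_size N K + 2"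
    using card_sticky_le[of N K i] card_length[of "[U i (max v w), L i (max v w)]"]
      card_Un_le[of "sticky N K i" "{U i (max v w), L i (max v w)}"]
    unfolding active_def S_def by simp
  moreover have "S \<subseteq> {1..K}" unfolding S_def using act_subset[OF i] .
  moreover have "finite S" by (simp add: active_def sticky_def S_def)
  ultimately have "card (S - {b}) \<le> sticky_size N K + 1" by simp
  with \<open>b \<in> S\<close> \<open>S \<subseteq> {1..K}\<close> show ?thesis
    using const unfolding S_def[symmetric] by (intro exI[of _ "max v w"] exI[of _ S]) simp
qed

end

section \<open>Spreading of the best arm\<close>

text \<open>Measurability of \<open>Q\<close> is not assumed: up to a null set, its failures lie in
  the intersection of the complements of the sets \<open>E n\<close>, an event of probability
  0.\<close>

lemma (in prob_space) AE_from_approx: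
  assumes "\<And>\<eta>::real. \<eta> > 0 \<Longrightarrow> \<exists>E\<in>events. prob (space M - E) \<le> \<eta> \<and> (AE \<omega> in M. \<omega> \<in> E \<longrightarrow> Q \<omega>)"
  shows "AE \<omega> in M. Q \<omega>"
proof -
  let ?R = "\<lambda>n E. E \<in> events \<and> prob (space M - E) \<le> 1 / real (Suc n) \<and> (AE \<omega> in M. \<omega> \<in> E \<longrightarrow> Q \<omega>)"
  have "\<exists>E. ?R n E" for n using assms[of "1 / real (Suc n)"] by auto
  then have "\<forall>n. \<exists>E. ?R n E" by blast
  from choice[OF this] obtain E where R: "\<forall>n. ?R n (E n)" ..
  have E: "E n \<in> events" "prob (space M - E n) \<le> 1 / real (Suc n)"
    "AE \<omega> in M. \<omega> \<in> E n \<longrightarrow> Q \<omega>" for n using R[rule_format, of n] by blast+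
  have ev: "(\<Inter>n. space M - E n) \<in> events"
    by (intro sets.countable_INT' sets.compl_sets image_subsetI E(1)) auto
  have "prob (\<Inter>n. space M - E n) \<le> \<eta>" if pos: "\<eta> > 0" for \<eta> :: real
  proof -
    obtain n where "1 / real (Suc n) < \<eta>" by (rule nat_approx_posE[OF pos])
    moreover have "prob (\<Inter>n. space M - E n) \<le> prob (space M - E n)"
      by (intro finite_measure_mono sets.compl_sets E(1)) auto
    ultimately show ?thesis using E(2)[of n] by linarith
  qed
  then have "prob (\<Inter>n. space M - E n) \<le> 0" by (rule field_le_epsilon[of _ 0, simplified])
  then have "prob (\<Inter>n. space M - E n) = 0" by (simp add: measure_le_0_iff)
  then have "AE \<omega> in M. \<omega> \<notin> (\<Inter>n. space M - E n)" using ev by (subst (asm) prob_eq_0) auto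
  moreover have "AE \<omega> in M. \<forall>n. \<omega> \<in> E n \<longrightarrow> Q \<omega>" by (subst AE_all_countable) (use E(3) in blast)
  ultimately show ?thesis using AE_space by eventually_elim auto
qed

text \<open>A telescoping majorant that turns a tail sum of fifth powers into
  \<open>1 / n ^ 4\<close>. After clearing denominators it reads
  \<open>n ^ 4 \<le> (n + 1) * ((n + 1) ^ 4 - n ^ 4)\<close>.\<close>

lemma inverse_power5_le_telescope:
  assumes "n \<ge> 1"
  shows "1 / real (Suc n) ^ 5 \<le> 1 / real n ^ 4 - 1 / real (Suc n) ^ 4"
proof -
  let ?x = "real n"
  have x: "?x > 0" using assms by simp
  have "?x ^ 4 \<le> (?x + 1) * ((?x + 1) ^ 4 - ?x ^ 4)"
    using x by (simp add: power4_eq_xxxx algebra_simps add_nonneg_nonneg)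
  then have "?x ^ 4 / (?x ^ 4 * (?x + 1) ^ 5) \<le> (?x + 1) * ((?x + 1) ^ 4 - ?x ^ 4) / (?x ^ 4 * (?x + 1) ^ 5)"
    using x by (intro divide_right_mono) auto
  moreover have "?x ^ 4 / (?x ^ 4 * (?x + 1) ^ 5) = 1 / (?x + 1) ^ 5" using x by simp
  moreover have "(?x + 1) * ((?x + 1) ^ 4 - ?x ^ 4) / (?x ^ 4 * (?x + 1) ^ 5)
      = ((?x + 1) ^ 4 - ?x ^ 4) / (?x ^ 4 * (?x + 1) ^ 4)"
    using x by (simp add: power_Suc[of _ 4, simplified])
  moreover have "((?x + 1) ^ 4 - ?x ^ 4) / (?x ^ 4 * (?x + 1) ^ 4) = 1 / ?x ^ 4 - 1 / (?x + 1) ^ 4"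
    using x by (simp add: diff_frac_eq)
  ultimately show ?thesis by (simp add: add.commute)
qed

lemma sums_inverse_power4_telescope:
  assumes "n \<ge> 1"
  shows "(\<lambda>k. 1 / real (n + k) ^ 4 - 1 / real (Suc (n + k)) ^ 4) sums (1 / real n ^ 4)"
proof -
  have "(\<lambda>k. 1 / real (n + k) ^ 4) \<longlonglongrightarrow> 0" by real_asymp
  from telescope_sums'[OF this] show ?thesis by simp
qed

text \<open>The relation in \<open>connected\<close> is oriented by the flow of information:
  \<open>i\<close> contacts \<open>m\<close> with probability \<open>P i m\<close>, and the arm
  travels from \<open>m\<close> to \<open>i\<close>. The phase ends \<open>e\<close> are not assumed
  measurable, so consequences of a run are stated as almost sure implications from measurable
  sets.\<close>

locale gosine_slack = unit_mean_bandit M N K \<nu> P Z I U L G + phase_schedule A \<epsilon>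
  for M :: "'w measure" and N K \<nu> P Z I U L G A \<epsilon> +
  fixes \<alpha> \<delta> :: real and b :: nat and e :: "'w \<Rightarrow> nat \<Rightarrow> nat \<Rightarrow> nat"
  assumes \<alpha>_gt_3: "\<alpha> > 3" and \<delta>_nonneg: "\<delta> \<ge> 0" and best: "b \<in> {1..K}" and N_pos: "N > 0"
    and gap: "\<And>l. l \<in> {1..K} \<Longrightarrow> l \<noteq> b \<Longrightarrow> \<nu> l < \<nu> b"
    and connected: "\<And>m i. m \<in> {1..N} \<Longrightarrow> i \<in> {1..N} \<Longrightarrow>
      (m, i) \<in> {(m, i). m \<in> {1..N} \<and> i \<in> {1..N} \<and> P i m > 0}\<^sup>*"
    and run: "AE \<omega> in M. slack_run \<alpha> N K A \<delta> (e \<omega>) (\<lambda>i j. Z (Contact i j) \<omega>)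
      (\<lambda>i t. I i t \<omega>) (\<lambda>i t. Z (Reward i (I i t \<omega>) t) \<omega>)
      (\<lambda>i j. U i j \<omega>) (\<lambda>i j. L i j \<omega>) (\<lambda>i j. G i j \<omega>)"
begin

abbreviation "regular \<omega> \<equiv> slack_path A \<epsilon> \<alpha> \<nu> b N K \<delta> (e \<omega>) (\<lambda>i j. Z (Contact i j) \<omega>)
  (\<lambda>i t. I i t \<omega>) (\<lambda>i t. Z (Reward i (I i t \<omega>) t) \<omega>)
  (\<lambda>i j. U i j \<omega>) (\<lambda>i j. L i j \<omega>) (\<lambda>i j. G i j \<omega>)"

abbreviation "acts i j \<omega> \<equiv> active N K (\<lambda>i j. U i j \<omega>) (\<lambda>i j. L i j \<omega>) i j"

lemma AE_regular: "AE \<omega> in M. regular \<omega>"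
  using run
proof eventually_elim
  case (elim \<omega>)
  then show ?case
    using \<alpha>_gt_3 \<delta>_nonneg best N_pos gap
    by (intro slack_path.intro phase_schedule_axioms slack_path_axioms.intro) auto
qed

lemma accurate_if_not_deviates:
  assumes "regular \<omega>" "\<not> deviates \<alpha> i t \<omega>"
  shows "slack_path.accurate \<alpha> \<nu> K (\<lambda>i t. I i t \<omega>) (\<lambda>i t. Z (Reward i (I i t \<omega>) t) \<omega>) i t"
  unfolding slack_path.accurate_def[OF assms(1)]
proof (intro ballI impI)
  fix l assume l: "l \<in> {1..K}" and pos: "pulls (\<lambda>t. I i t \<omega>) l {1..t - 1} > 0"
  let ?X = "\<lambda>s. Z (Reward i (I i s \<omega>) s) \<omega>"
  let ?S = "{s. s \<in> {1..t - 1} \<and> I i s \<omega> = l}"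
  define n where "n = real (pulls (\<lambda>t. I i t \<omega>) l {1..t - 1})"
  have n: "n > 0" "n = real (card ?S)" using pos by (auto simp: n_def pulls_def)
  have "reward_dev i l (t - 1) \<omega> = (\<Sum>s\<in>?S. real (?X s)) - n * \<nu> l"
    unfolding reward_dev_def sum_subtractf n(2) by simp
  then have "emp_mean (\<lambda>t. I i t \<omega>) ?X l (t - 1) - \<nu> l = reward_dev i l (t - 1) \<omega> / n"
    using n(1) unfolding emp_mean_def n_def[symmetric] by (simp add: field_simps)
  then have "\<bar>emp_mean (\<lambda>t. I i t \<omega>) ?X l (t - 1) - \<nu> l\<bar> = \<bar>reward_dev i l (t - 1) \<omega>\<bar> / n"
    using n(1) by simp
  also have "\<dots> \<le> sqrt (\<alpha> * n * ln (real t)) / n"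
    using assms(2) l pos n(1) unfolding deviates_def n_def by (intro divide_right_mono) force+
  also have "\<dots> = sqrt (\<alpha> * n * ln (real t)) / sqrt (n\<^sup>2)" using n(1) by simp
  also have "\<dots> = sqrt (\<alpha> * n * ln (real t) / n\<^sup>2)" by (simp only: real_sqrt_divide)
  also have "\<alpha> * n * ln (real t) / n\<^sup>2 = \<alpha> * ln (real t) / n"
    using n(1) by (simp add: power2_eq_square)
  finally show "\<bar>emp_mean (\<lambda>t. I i t \<omega>) ?X l (t - 1) - \<nu> l\<bar>
      \<le> sqrt (\<alpha> * ln (real t) / real (pulls (\<lambda>t. I i t \<omega>) l {1..t - 1}))"
    unfolding n_def .
qed

definition late_dev :: "real \<Rightarrow> 'w set" where
  "late_dev s = {\<omega> \<in> space M. \<exists>i\<in>{1..N}. \<exists>t. s < real t \<and> deviates \<alpha> i t \<omega>}"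

lemma late_dev_sets: "late_dev s \<in> events"
proof -
  have "late_dev s = (\<Union>i\<in>{1..N}. \<Union>t\<in>{t. s < real t}. {\<omega> \<in> space M. deviates \<alpha> i t \<omega>})"
    by (auto simp: late_dev_def)
  then show ?thesis
    using deviates_sets by (simp only:) (intro sets.countable_UN' image_subsetI; simp add: countable_finite)
qed

text \<open>With \<alpha> > 3 the slot probabilities are below a multiple of fifth inverse powers,
  summed from \<open>n = \<lfloor>s\<rfloor>\<close> on. As \<open>n \<ge> s / 2\<close> for
  \<open>s \<ge> 2\<close>, replacing \<open>n\<close> by \<open>s\<close> costs 16; the other
  factor 2 comes from the two signs of a deviation.\<close>

lemma prob_late_dev:
  assumes "s \<ge> 2"
  shows "prob (late_dev s) \<le> 32 * real K * real N / s ^ 4"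
proof -
  define n where "n = nat \<lfloor>s\<rfloor>"
  have n: "n \<ge> 2" "s / 2 \<le> real n" "real n \<le> s" using assms 
    unfolding n_def using assms by (simp add: le_nat_floor, linarith, simp)
  let ?D = "\<lambda>i t. {\<omega> \<in> space M. deviates \<alpha> i t \<omega>}"
  let ?t = "\<lambda>k. 1 / real (n + k) ^ 4 - 1 / real (Suc (n + k)) ^ 4"
  have single: "prob (?D i (Suc (n + k))) \<le> 2 * real K * ?t k" if "i \<in> {1..N}" for i k
  proof -
    have "prob (?D i (Suc (n + k))) \<le> 2 * real K * real (Suc (n + k)) powr (1 - 2 * \<alpha>)"
      using that \<alpha>_gt_3 n by (intro prob_deviates) auto
    also have "\<dots> \<le> 2 * real K * ?t k"
    proof (rule mult_left_mono)
      have "real (Suc (n + k)) powr (1 - 2 * \<alpha>) \<le> real (Suc (n + k)) powr (- 5)"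
        using \<alpha>_gt_3 by (intro powr_mono) auto
      also have "\<dots> = 1 / real (Suc (n + k)) ^ 5"
        by (simp add: powr_minus_divide)
      also have "\<dots> \<le> ?t k" using n by (intro inverse_power5_le_telescope) simp
      finally show "real (Suc (n + k)) powr (1 - 2 * \<alpha>) \<le> ?t k" .
    qed simp
    finally show ?thesis .
  qed
  have sums: "(\<lambda>k. 2 * real K * ?t k) sums (2 * real K * (1 / real n ^ 4))"
    using n by (intro sums_mult sums_inverse_power4_telescope) simp
  have row_sets: "(\<Union>k. ?D i (Suc (n + k))) \<in> events" if "i \<in> {1..N}" for i
    using deviates_sets[OF that] by (intro sets.countable_UN) blast
  have row: "prob (\<Union>k. ?D i (Suc (n + k))) \<le> 2 * real K * (1 / real n ^ 4)" if i: "i \<in> {1..N}" for i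
  proof -
    have sm: "summable (\<lambda>k. prob (?D i (Suc (n + k))))"
      by (rule summable_comparison_test'[OF sums_summable[OF sums]]) (use single[OF i] in auto)
    have "prob (\<Union>k. ?D i (Suc (n + k))) \<le> (\<Sum>k. prob (?D i (Suc (n + k))))"
      using deviates_sets[OF i] sm by (intro finite_measure_subadditive_countably) auto
    also have "\<dots> \<le> (\<Sum>k. 2 * real K * ?t k)"
      using single[OF i] sm sums_summable[OF sums] by (intro suminf_le) auto
    also have "\<dots> = 2 * real K * (1 / real n ^ 4)" using sums by (rule sums_unique[symmetric])
    finally show ?thesis .
  qed
  have sub: "late_dev s \<subseteq> (\<Union>i\<in>{1..N}. \<Union>k. ?D i (Suc (n + k)))"
  proof
    fix \<omega> assume "\<omega> \<in> late_dev s"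
    then obtain i t where it: "\<omega> \<in> space M" "i \<in> {1..N}" "s < real t" "deviates \<alpha> i t \<omega>"
      unfolding late_dev_def by blast
    have "t = Suc (n + (t - Suc n))" using it(3) n by simp
    then have "\<omega> \<in> ?D i (Suc (n + (t - Suc n)))" using it by simp
    then show "\<omega> \<in> (\<Union>i\<in>{1..N}. \<Union>k. ?D i (Suc (n + k)))"
      by (intro UN_I[OF it(2)] UN_I[OF UNIV_I])
  qed
  have "1 / real n ^ 4 \<le> 1 / (s / 2) ^ 4"
    using n assms by (intro divide_left_mono power_mono mult_pos_pos) auto
  also have "\<dots> = 16 / s ^ 4" by (simp add: power_divide)
  finally have n4: "1 / real n ^ 4 \<le> 16 / s ^ 4" .
  have "prob (late_dev s) \<le> prob (\<Union>i\<in>{1..N}. \<Union>k. ?D i (Suc (n + k)))"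
    using sub by (intro finite_measure_mono sets.finite_UN row_sets) simp_all
  also have "\<dots> \<le> (\<Sum>i\<in>{1..N}. prob (\<Union>k. ?D i (Suc (n + k))))"
    by (intro finite_measure_subadditive_finite image_subsetI row_sets) simp_all
  also have "\<dots> \<le> (\<Sum>i\<in>{1..N}. 2 * real K * (1 / real n ^ 4))"
    by (rule sum_mono) (rule row)
  also have "\<dots> = 2 * real K * real N * (1 / real n ^ 4)" by simp
  also have "\<dots> \<le> 2 * real K * real N * (16 / s ^ 4)"
    using n4 by (rule mult_left_mono) simp
  finally show ?thesis by simp
qed

lemma prob_contact_missed:
  assumes i: "i \<in> {1..N}" and m: "m \<in> {1..N}"
  shows "prob {\<omega> \<in> space M. \<forall>j\<in>{v..<v + n}. Z (Contact i j) \<omega> \<noteq> m} \<le> exp (- (P i m * real n))"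
\<comment> \<open>The product formula for independent draws requires a nonempty index set; for
  \<open>n = 0\<close> the bound is 1.\<close>
proof (cases "n = 0")
  case False
  let ?J = "Contact i ` {v..<v + n}"
  let ?A = "\<lambda>d. Z d -` (- {m}) \<inter> space M"
  have one: "prob (?A (Contact i j)) = 1 - P i m" for j
  proof -
    have "?A (Contact i j) = space M - {\<omega> \<in> space M. Z (Contact i j) \<omega> = m}" by auto
    moreover have "{\<omega> \<in> space M. Z (Contact i j) \<omega> = m} \<in> events" by measurable
    ultimately show ?thesis using prob_compl contact_law[OF i m, of j] by simp
  qed
  have "P i m \<le> 1" using one[of 0] measure_nonneg[of M "?A (Contact i 0)"] by linarith
  have "{\<omega> \<in> space M. \<forall>j\<in>{v..<v + n}. Z (Contact i j) \<omega> \<noteq> m} = (\<Inter>d\<in>?J. ?A d)"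
    using False by auto
  also have "prob (\<Inter>d\<in>?J. ?A d) = (\<Prod>d\<in>?J. prob (?A d))"
    using False by (intro indep_varsD[OF indep_draws]) auto
  also have "\<dots> = (\<Prod>j\<in>{v..<v + n}. 1 - P i m)"
    by (subst prod.reindex) (auto simp: inj_on_def one)
  also have "\<dots> = (1 - P i m) ^ n" by simp
  also have "\<dots> \<le> exp (- P i m) ^ n"
    using \<open>P i m \<le> 1\<close> exp_ge_add_one_self[of "- P i m"] by (intro power_mono) auto
  also have "\<dots> = exp (- (P i m * real n))" by (simp add: exp_of_nat_mult[symmetric] mult.commute)
  finally show ?thesis .
qed simp

text \<open>
  \<open>z\<close> is the reference index of \<open>overtake\<close>.
\<close>

definition spread_by :: "nat \<Rightarrow> real \<Rightarrow> nat \<Rightarrow> nat \<Rightarrow> 'w set \<Rightarrow> bool" where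
  "spread_by i s w z E \<longleftrightarrow> E \<in> events \<and> reach s \<le> z + 1 \<and> reach s \<le> w \<and>
     (AE \<omega> in M. \<omega> \<in> E \<longrightarrow> \<omega> \<notin> late_dev s \<longrightarrow> (\<forall>j\<ge>w. b \<in> acts i j \<omega>))"

text \<open>The form is chosen to be stable under hops: the order \<open>s\<close> of the reference
  time, the logarithmic delay and the failure rate \<open>1 / s ^ 4\<close> are common to all
  agents, and only \<Lambda>, \<open>c\<close> and \<open>C\<close> depend on the agent.\<close>

definition spreads :: "nat \<Rightarrow> bool" where
  "spreads i \<longleftrightarrow> (\<exists>\<Lambda>>0. \<exists>c>0. \<exists>C\<ge>0. \<forall>\<^sub>F s in at_top. \<exists>w z E. spread_by i s w z E \<and>
     prob (space M - E) \<le> C / s ^ 4 \<and> real (A z) \<le> \<Lambda> * s \<and> real w \<le> real z + c * ln s)"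

lemma eventually_long_phases:
  "\<forall>\<^sub>F s in at_top. \<forall>j>reach s. long_phase \<alpha> K \<nu> b \<delta> A j"
proof -
  have "\<forall>\<^sub>F n in sequentially. \<forall>j\<ge>n. long_phase \<alpha> K \<nu> b \<delta> A j"
    unfolding long_phase_def using eventually_phase_long by (rule eventually_all_ge_at_top)
  from eventually_compose_filterlim[OF this filterlim_reach] show ?thesis
    by eventually_elim auto
qed

lemma accurate_if_not_late:
  assumes "regular \<omega>" "\<omega> \<in> space M" "\<omega> \<notin> late_dev s" "i \<in> {1..N}" "s < real t"
  shows "slack_path.accurate \<alpha> \<nu> K (\<lambda>i t. I i t \<omega>) (\<lambda>i t. Z (Reward i (I i t \<omega>) t) \<omega>) i t"
  using assms by (intro accurate_if_not_deviates) (auto simp: late_dev_def)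

lemma spreads_base:
  assumes "b \<in> sticky N K i"
  shows "spreads i"
proof -
  have "\<forall>\<^sub>F s in at_top. 1 \<le> reach s"
    using filterlim_reach by (simp add: filterlim_at_top)
  moreover have "\<forall>\<^sub>F s::real in at_top. 1 \<le> ln s" by real_asymp
  ultimately have "\<forall>\<^sub>F s in at_top. \<exists>w z E. spread_by i s w z E \<and>
     prob (space M - E) \<le> 0 / s ^ 4 \<and> real (A z) \<le> 1 * s \<and> real w \<le> real z + 1 * ln s"
  proof eventually_elim
    case (elim s)
    \<comment> \<open>A sticky arm is active in every phase, so nothing can fail. The index
      \<open>reach s - 1\<close> is the last one whose phase end lies below \<open>s\<close>;
      \<open>w\<close> exceeds it by 1, which \<open>ln s \<ge> 1\<close> covers.\<close>
    have "spread_by i s (reach s) (reach s - 1) (space M)"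
      using assms by (auto simp: spread_by_def active_def)
    moreover have "real (A (reach s - 1)) < s" using elim by (intro A_less_reach) simp
    ultimately show ?case
      using elim by (intro exI[of _ "reach s"] exI[of _ "reach s - 1"] exI[of _ "space M"]) auto
  qed
  moreover have "(0::real) < 1" "(0::real) \<le> 0" by simp_all
  ultimately show ?thesis unfolding spreads_def by blast
qed

text \<open>From index \<open>v\<close> on, any contact with \<open>m\<close> delivers
  \<open>b\<close>, so one contact in the window of \<open>n\<close> phases suffices, and
  \<open>b\<close> is kept afterwards. The only new source of failure is that the window contains no
  contact with \<open>m\<close>.\<close>

lemma spread_by_step:
  assumes sp: "spread_by m s w z E" and i: "i \<in> {1..N}"
    and long: "\<And>j. reach s < j \<Longrightarrow> long_phase \<alpha> K \<nu> b \<delta> A j"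
    and v: "(1 + \<delta>) * real (A (w + 1)) < real (A v)" "w + 1 < v"
    and z': "z \<le> z'"
  shows "spread_by i s (v + n) z' (E \<inter> {\<omega> \<in> space M. \<exists>j\<in>{v..<v + n}. Z (Contact i j) \<omega> = m})"
  unfolding spread_by_def
proof (intro conjI)
  have "AE \<omega> in M. \<omega> \<in> E \<longrightarrow> \<omega> \<notin> late_dev s \<longrightarrow> (\<forall>j\<ge>w. b \<in> acts m j \<omega>)"
    using sp unfolding spread_by_def by blast
  with AE_regular AE_space
  show "AE \<omega> in M. \<omega> \<in> E \<inter> {\<omega> \<in> space M. \<exists>j\<in>{v..<v + n}. Z (Contact i j) \<omega> = m} \<longrightarrow>
     \<omega> \<notin> late_dev s \<longrightarrow> (\<forall>j\<ge>v + n. b \<in> acts i j \<omega>)"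
  proof eventually_elim
    case (elim \<omega>)
    interpret slack_path A \<epsilon> \<alpha> \<nu> b N K \<delta> "e \<omega>" "\<lambda>i j. Z (Contact i j) \<omega>"
      "\<lambda>i t. I i t \<omega>" "\<lambda>i t. Z (Reward i (I i t \<omega>) t) \<omega>"
      "\<lambda>i j. U i j \<omega>" "\<lambda>i j. L i j \<omega>" "\<lambda>i j. G i j \<omega>" by (rule elim)
    show ?case
    proof (intro impI allI)
      fix j' assume E: "\<omega> \<in> E \<inter> {\<omega> \<in> space M. \<exists>j\<in>{v..<v + n}. Z (Contact i j) \<omega> = m}"
        and late: "\<omega> \<notin> late_dev s" and j': "v + n \<le> j'"
      then obtain j where j: "j \<in> {v..<v + n}" "Z (Contact i j) \<omega> = m" by blast
      have w: "reach s \<le> w" using sp unfolding spread_by_def by blast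
      have actm: "b \<in> acts m j \<omega>" if "w \<le> j" for j using elim(3) E late that by blast
      show "b \<in> acts i j' \<omega>"
        by (rule best_spreads[where s = s, OF accurate_if_not_late[OF elim(1,2) late] long i w actm v j j'])
    qed
  qed
  have "{\<omega> \<in> space M. \<exists>j\<in>{v..<v + n}. Z (Contact i j) \<omega> = m} \<in> events" by measurable
  then show "E \<inter> {\<omega> \<in> space M. \<exists>j\<in>{v..<v + n}. Z (Contact i j) \<omega> = m} \<in> events"
    using sp unfolding spread_by_def by blast
qed (use sp v z' in \<open>auto simp: spread_by_def\<close>)

lemma spreads_step:
  assumes m: "m \<in> {1..N}" and i: "i \<in> {1..N}" and p: "P i m > 0" and sp: "spreads m"
  shows "spreads i"
proof -
  define p where "p = P i m"
  have p: "p > 0" using \<open>P i m > 0\<close> by (simp add: p_def)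
  from sp obtain \<Lambda> c C where *: "\<Lambda> > 0" "c > 0" "C \<ge> 0" and ev: "\<forall>\<^sub>F s in at_top. \<exists>w z E. spread_by m s w z E \<and>
     prob (space M - E) \<le> C / s ^ 4 \<and> real (A z) \<le> \<Lambda> * s \<and> real w \<le> real z + c * ln s"
    unfolding spreads_def by blast
  \<comment> \<open>The first term is the delay from \<open>overtake\<close> with
    \<open>h = c * ln s\<close>, the last one the window of contacts; the 2 absorbs the additive 1
    of \<open>overtake\<close> and the 1 from rounding up the window, both at most
    \<open>ln s\<close>.\<close>
  define c' where "c' = (1 + 2 * \<delta>) * (c + 1) + 2 + 4 / p"
  have ln1: "\<forall>\<^sub>F s::real in at_top. 1 \<le> ln s" by real_asymp
  have "\<forall>\<^sub>F s in at_top. \<exists>w z E. spread_by i s w z E \<and> prob (space M - E) \<le> (C + 1) / s ^ 4 \<and>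
      real (A z) \<le> (2 * (1 + \<delta>) * \<Lambda>) * s \<and> real w \<le> real z + c' * ln s"
    using ev eventually_long_phases ln1 eventually_gt_at_top[of 0]
  proof eventually_elim
    case (elim s)
    from elim(1) obtain w z E where w: "spread_by m s w z E" "prob (space M - E) \<le> C / s ^ 4"
      "real (A z) \<le> \<Lambda> * s" "real w \<le> real z + c * ln s" by blast
    define v where "v = (LEAST v. (1 + \<delta>) * real (A (w + 1)) < real (A v))"
    have "c * ln s \<ge> 0" using *(2) elim(3) by (intro mult_nonneg_nonneg) linarith+
    note over = overtake[OF \<delta>_nonneg this w(3,4), folded v_def]
    obtain z' where z': "z \<le> z'" "real (A z') \<le> 2 * (1 + \<delta>) * (\<Lambda> * s)"
      "real v \<le> real z' + (1 + 2 * \<delta>) * (c * ln s + 1) + 1" using over(3) by blast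
    \<comment> \<open>Long enough that missing \<open>m\<close> throughout has probability at most
      \<open>exp (- (p * n)) \<le> 1 / s ^ 4\<close>.\<close>
    define n where "n = nat \<lceil>4 / p * ln s\<rceil>"
    have n: "4 / p * ln s \<le> real n" "real n \<le> 4 / p * ln s + 1"
      using p elim(3) by (auto simp: n_def of_nat_ceiling)
    let ?F = "{\<omega> \<in> space M. \<exists>j\<in>{v..<v + n}. Z (Contact i j) \<omega> = m}"
    have Ev: "E \<in> events" using w(1) by (simp add: spread_by_def)
    have "spread_by i s (v + n) z' (E \<inter> ?F)"
      using elim(2) by (intro spread_by_step[OF w(1) i _ over(1,2) z'(1)]) auto
    moreover have "prob (space M - E \<inter> ?F) \<le> (C + 1) / s ^ 4"
    proof -
      let ?H = "{\<omega> \<in> space M. \<forall>j\<in>{v..<v + n}. Z (Contact i j) \<omega> \<noteq> m}"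
      have [measurable]: "?H \<in> events" by measurable
      have "space M - E \<inter> ?F = (space M - E) \<union> ?H" by blast
      then have "prob (space M - E \<inter> ?F) \<le> prob (space M - E) + prob ?H"
        using Ev by (simp only:) (intro measure_Un_le; measurable)
      moreover have "prob ?H \<le> exp (- (p * real n))"
        unfolding p_def using i m by (rule prob_contact_missed)
      moreover have "exp (- (p * real n)) \<le> exp (- (4 * ln s))"
        using n(1) p by (simp add: field_simps)
      moreover have "exp (- (4 * ln s)) = 1 / s ^ 4"
      proof -
        have "exp (4 * ln s) = s ^ 4" using exp_of_nat_mult[of 4 "ln s"] elim(4) by simp
        then show ?thesis by (simp add: exp_minus divide_inverse)
      qed
      ultimately show ?thesis using w(2) by (simp add: add_divide_distrib)
    qed
    moreover have "real (v + n) \<le> real z' + c' * ln s"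
    proof -
      have "1 + 2 * \<delta> \<le> (1 + 2 * \<delta>) * ln s" using \<delta>_nonneg elim(3) by simp
      then have "(1 + 2 * \<delta>) * (c * ln s + 1) \<le> (1 + 2 * \<delta>) * (c + 1) * ln s"
        by (simp add: algebra_simps)
      moreover have "c' * ln s = (1 + 2 * \<delta>) * (c + 1) * ln s + 2 * ln s + 4 / p * ln s"
        unfolding c'_def by (simp only: distrib_right)
      ultimately show ?thesis using z'(3) n(2) elim(3) unfolding of_nat_add by linarith
    qed
    ultimately show ?case using z'(2) by (intro exI[of _ "v + n"] exI[of _ z'] exI[of _ "E \<inter> ?F"]) (simp add: mult.assoc)
  qed
  moreover have "2 * (1 + \<delta>) * \<Lambda> > 0" using * \<delta>_nonneg by simp
  moreover have "(1 + 2 * \<delta>) * (c + 1) > 0" using * \<delta>_nonneg by simp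
  then have "c' > 0" unfolding c'_def using p by (simp add: add_pos_pos)
  moreover have "C + 1 \<ge> 0" using * by simp
  ultimately show ?thesis unfolding spreads_def by blast
qed

lemma spreads_all:
  assumes i: "i \<in> {1..N}"
  shows "spreads i"
proof -
  obtain m where m: "m \<in> {1..N}" "b \<in> sticky N K m" using best_arm_sticky[OF best N_pos] by blast
  from connected[OF m(1) i] show ?thesis
  proof (induction rule: rtrancl_induct)
    case base then show ?case using spreads_base[OF m(2)] .
  next
    case (step x y) then show ?case using spreads_step by blast
  qed
qed

end

section \<open>Summability of excessive pulls and freezing of the active sets\<close>

context gosine_slack
begin

text \<open>Here the delay in phases is converted into time: phase \<open>w\<close> ends by
  \<open>(1 + \<delta>) * A w\<close>, which is of order \<open>s ^ 3\<close>, so any later slot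
  belongs to a phase beyond \<open>w\<close>.\<close>

lemma best_active_late:
  assumes i: "i \<in> {1..N}"
  shows "\<exists>c\<ge>1. \<exists>C\<ge>0. \<forall>\<^sub>F s in at_top. \<exists>E\<in>events. prob (space M - E) \<le> C / s ^ 4 \<and>
    (AE \<omega> in M. \<omega> \<in> E \<longrightarrow> \<omega> \<notin> late_dev s \<and>
      (\<forall>t j. c * s ^ 3 < real t \<longrightarrow> t \<in> {e \<omega> i j<..e \<omega> i (Suc j)} \<longrightarrow> b \<in> acts i j \<omega>))"
proof -
  from spreads_all[OF i] obtain \<Lambda> d C where *: "\<Lambda> > 0" "d > 0" "C \<ge> 0" and ev: "\<forall>\<^sub>F s in at_top. \<exists>w z E. spread_by i s w z E \<and>
     prob (space M - E) \<le> C / s ^ 4 \<and> real (A z) \<le> \<Lambda> * s \<and> real w \<le> real z + d * ln s"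
    unfolding spreads_def by blast
  from eventually_A_le_cube[OF *(2,1)] obtain c' where c': "c' > 0"
    "\<forall>\<^sub>F s in at_top. \<forall>w z. reach s \<le> z + 1 \<longrightarrow> real (A z) \<le> \<Lambda> * s \<longrightarrow>
           real w \<le> real z + d * ln s \<longrightarrow> real (A w) \<le> c' * s ^ 3" by blast
  \<comment> \<open>The maximum with 1 ensures \<open>s \<le> c * s ^ 3\<close> for
    \<open>s \<ge> 1\<close>, so that slots after \<open>c * s ^ 3\<close> are also after
    \<open>s\<close>, where indices are accurate.\<close>
  define c where "c = max 1 ((1 + \<delta>) * c')"
  define C' where "C' = C + 32 * real K * real N"
  have "\<forall>\<^sub>F s in at_top. \<exists>E\<in>events. prob (space M - E) \<le> C' / s ^ 4 \<and>
    (AE \<omega> in M. \<omega> \<in> E \<longrightarrow> \<omega> \<notin> late_dev s \<and>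
      (\<forall>t j. c * s ^ 3 < real t \<longrightarrow> t \<in> {e \<omega> i j<..e \<omega> i (Suc j)} \<longrightarrow> b \<in> acts i j \<omega>))"
    using ev c'(2) eventually_ge_at_top[of 2]
  proof eventually_elim
    case (elim s)
    from elim(1) obtain w z E where w: "spread_by i s w z E" "prob (space M - E) \<le> C / s ^ 4"
      "real (A z) \<le> \<Lambda> * s" "real w \<le> real z + d * ln s" by blast
    have "reach s \<le> z + 1" using w(1) unfolding spread_by_def by blast
    with elim(2) w have Aw: "real (A w) \<le> c' * s ^ 3" by blast
    have "(1 + \<delta>) * real (A w) \<le> (1 + \<delta>) * (c' * s ^ 3)"
      using Aw \<delta>_nonneg by (intro mult_left_mono) auto
    also have "\<dots> = ((1 + \<delta>) * c') * s ^ 3" by simp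
    also have "\<dots> \<le> c * s ^ 3"
      using elim(3) by (intro mult_right_mono) (auto simp: c_def)
    finally have cs: "(1 + \<delta>) * real (A w) \<le> c * s ^ 3" .
    have Ev: "E \<in> events" using w(1) unfolding spread_by_def by blast
    have "AE \<omega> in M. \<omega> \<in> E \<longrightarrow> \<omega> \<notin> late_dev s \<longrightarrow> (\<forall>j\<ge>w. b \<in> acts i j \<omega>)"
      using w(1) unfolding spread_by_def by blast
    with AE_regular have "AE \<omega> in M. \<omega> \<in> E - late_dev s \<longrightarrow> \<omega> \<notin> late_dev s \<and>
      (\<forall>t j. c * s ^ 3 < real t \<longrightarrow> t \<in> {e \<omega> i j<..e \<omega> i (Suc j)} \<longrightarrow> b \<in> acts i j \<omega>)"
    proof eventually_elim
      case (elim \<omega>)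
      show ?case
      proof (intro impI conjI allI)
        fix t j assume E: "\<omega> \<in> E - late_dev s" and t: "c * s ^ 3 < real t"
          and j: "t \<in> {e \<omega> i j<..e \<omega> i (Suc j)}"
        have "real (e \<omega> i (Suc w)) \<le> (1 + \<delta>) * real (A w)"
          using slack_path.e_bounds(2)[OF elim(1) i] .
        then have "real (e \<omega> i (Suc w)) < real t" using cs t by linarith
        then have "Suc w \<le> j" using slack_path.phase_index_ge[OF elim(1) i j, of "Suc w"] by simp
        then show "b \<in> acts i j \<omega>" using elim(2) E by simp
      qed simp
    qed
    moreover have "prob (space M - (E - late_dev s)) \<le> C' / s ^ 4"
    proof -
      have "space M - (E - late_dev s) \<subseteq> (space M - E) \<union> late_dev s" by blast
      then have "prob (space M - (E - late_dev s)) \<le> prob ((space M - E) \<union> late_dev s)"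
        using Ev late_dev_sets by (intro finite_measure_mono) auto
      also have "\<dots> \<le> prob (space M - E) + prob (late_dev s)"
        using Ev late_dev_sets by (intro measure_Un_le) auto
      finally show ?thesis
        using w(2) prob_late_dev[OF elim(3)] unfolding C'_def add_divide_distrib by linarith
    qed
    ultimately show ?case using Ev late_dev_sets by (intro bexI[of _ "E - late_dev s"]) auto
  qed
  moreover have "c \<ge> 1" by (simp add: c_def)
  moreover have "C' \<ge> 0" using * by (simp add: C'_def)
  ultimately show ?thesis by blast
qed

text \<open>Such a pull cannot happen when \<open>b\<close> is active and the indices are accurate,
  so its probability is bounded by that of the failure events.\<close>

definition overpulled :: "nat \<Rightarrow> nat \<Rightarrow> 'w \<Rightarrow> bool" where
  "overpulled i t \<omega> \<longleftrightarrow> (\<exists>l\<in>{1..K} - {b}. I i t \<omega> = l \<and>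
     4 * \<alpha> * ln (real t) / (\<nu> b - \<nu> l)\<^sup>2 < real (pulls (\<lambda>s. I i s \<omega>) l {1..t - 1}))"

lemma overpulled_sets:
  assumes i: "i \<in> {1..N}" and "1 \<le> t"
  shows "{\<omega> \<in> space M. overpulled i t \<omega>} \<in> events"
proof -
  note [measurable] = pulls_measurable[OF i] I_measurable[OF assms]
  show ?thesis unfolding overpulled_def by measurable
qed

lemma summable_overpulled:
  assumes i: "i \<in> {1..N}"
  shows "summable (\<lambda>t. prob {\<omega> \<in> space M. overpulled i t \<omega>})"
proof -
  from best_active_late[OF i] obtain c C where c: "c \<ge> 1" "C \<ge> 0"
    and ev: "\<forall>\<^sub>F s in at_top. \<exists>E\<in>events. prob (space M - E) \<le> C / s ^ 4 \<and>
    (AE \<omega> in M. \<omega> \<in> E \<longrightarrow> \<omega> \<notin> late_dev s \<and>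
      (\<forall>t j. c * s ^ 3 < real t \<longrightarrow> t \<in> {e \<omega> i j<..e \<omega> i (Suc j)} \<longrightarrow> b \<in> acts i j \<omega>))" by blast
  \<comment> \<open>Then \<open>c * s ^ 3 = t / 2\<close>, strictly below \<open>t\<close>, so slot
    \<open>t\<close> is late enough, and \<open>C / s ^ 4\<close> is of order
    \<open>t powr (- 4 / 3)\<close>.\<close>
  let ?s = "\<lambda>t::nat. (real t / (2 * c)) powr (1 / 3)"
  have "filterlim ?s at_top sequentially" using c by real_asymp
  from eventually_compose_filterlim[OF ev this] eventually_gt_at_top[of 0]
  have le: "\<forall>\<^sub>F t in sequentially. prob {\<omega> \<in> space M. overpulled i t \<omega>}
      \<le> C / (1 / (2 * c)) powr (4 / 3) * real t powr (- 4 / 3)"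
  proof eventually_elim
    case (elim t)
    define s where "s = ?s t"
    have x: "real t / (2 * c) > 0" using elim(2) c by simp
    have spos: "s > 0" using elim(2) c by (simp add: s_def)
    have pow: "s ^ n = (real t / (2 * c)) powr (real n / 3)" for n
      unfolding powr_realpow[OF spos, symmetric] by (simp add: s_def powr_powr)
    have s3: "s ^ 3 = real t / (2 * c)" using c pow[of 3] by simp
    have s4: "s ^ 4 = (real t / (2 * c)) powr (4 / 3)" using pow[of 4] by simp
    have "c * s ^ 3 < real t" using s3 c elim(2) by simp
    have st: "s < real t"
    proof (cases "s \<le> 1")
      case True
      show ?thesis
      proof (cases "s = 1")
        case True
        then show ?thesis using \<open>c * s ^ 3 < real t\<close> c by simp
      next
        case False
        then show ?thesis using \<open>s \<le> 1\<close> elim(2) by linarith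
      qed
    next
      case False
      then have "s ^ 1 \<le> s ^ 3" by (intro power_increasing) auto
      also have "\<dots> \<le> c * s ^ 3" using c spos by simp
      finally show ?thesis using \<open>c * s ^ 3 < real t\<close> by simp
    qed
    from elim(1) obtain E where E: "E \<in> events" "prob (space M - E) \<le> C / s ^ 4"
      "AE \<omega> in M. \<omega> \<in> E \<longrightarrow> \<omega> \<notin> late_dev s \<and>
        (\<forall>t j. c * s ^ 3 < real t \<longrightarrow> t \<in> {e \<omega> i j<..e \<omega> i (Suc j)} \<longrightarrow> b \<in> acts i j \<omega>)"
      unfolding s_def by blast
    have "AE \<omega> in M. \<omega> \<in> {\<omega> \<in> space M. overpulled i t \<omega>} \<longrightarrow> \<omega> \<in> space M - E"
      using E(3) AE_regular AE_space
    proof eventually_elim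
      case (elim \<omega>)
      show ?case
      proof (intro impI, rule ccontr)
        assume over: "\<omega> \<in> {\<omega> \<in> space M. overpulled i t \<omega>}" and "\<omega> \<notin> space M - E"
        then have "\<omega> \<in> E" by blast
        with elim(1) have late: "\<omega> \<notin> late_dev s"
          and act: "\<And>j. t \<in> {e \<omega> i j<..e \<omega> i (Suc j)} \<Longrightarrow> b \<in> acts i j \<omega>"
          using \<open>c * s ^ 3 < real t\<close> by blast+
        obtain j where j: "t \<in> {e \<omega> i j<..e \<omega> i (Suc j)}"
          using slack_path.slot_in_phase[OF elim(2) i] \<open>0 < t\<close> by (metis One_nat_def Suc_leI)
        obtain l where l: "l \<in> {1..K} - {b}" "I i t \<omega> = l"
          "4 * \<alpha> * ln (real t) / (\<nu> b - \<nu> l)\<^sup>2 < real (pulls (\<lambda>s. I i s \<omega>) l {1..t - 1})"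
          using over unfolding overpulled_def by blast
        have "real (pulls (\<lambda>s. I i s \<omega>) l {1..t - 1}) \<le> 4 * \<alpha> * ln (real t) / (\<nu> b - \<nu> l)\<^sup>2"
          using l(1) accurate_if_not_late[OF elim(2,3) late i st]
          by (intro slack_path.suboptimal_pulls_le[OF elim(2) i j act[OF j] _ l(2)]) auto
        with l(3) show False by linarith
      qed
    qed
    then have "prob {\<omega> \<in> space M. overpulled i t \<omega>} \<le> prob (space M - E)"
      using E(1) by (intro finite_measure_mono_AE) auto
    also have "\<dots> \<le> C / s ^ 4" by (rule E)
    also have "\<dots> = C / ((1 / (2 * c)) * real t) powr (4 / 3)" unfolding s4 by simp
    also have "\<dots> = C / (1 / (2 * c)) powr (4 / 3) * real t powr (- 4 / 3)"
      using c by (subst powr_mult) (simp_all add: powr_minus_divide)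
    finally show ?case .
  qed
  have "summable (\<lambda>t. real t powr (- 4 / 3))"
    by (subst summable_real_powr_iff) simp
  then have "summable (\<lambda>t. C / (1 / (2 * c)) powr (4 / 3) * real t powr (- 4 / 3))"
    by (rule summable_mult)
  then show ?thesis
    by (rule summable_comparison_test_ev[rotated]) (use le in simp)
qed

definition frozen :: "nat \<Rightarrow> 'w \<Rightarrow> nat \<Rightarrow> nat set \<Rightarrow> bool" where
  "frozen i \<omega> v S \<longleftrightarrow> b \<in> S \<and> S \<subseteq> {1..K} \<and> card (S - {b}) \<le> sticky_size N K + 1 \<and>
     (\<forall>j\<ge>v. acts i j \<omega> = S)"

text \<open>Freezing for one agent requires that all agents hold \<open>b\<close>, hence a single
  \<open>s\<close> must serve all of them. For each \<open>s\<close> this may fail, but with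
  probability at most \<open>D / s ^ 4\<close>, which tends to 0.\<close>

lemma AE_frozen:
  assumes i: "i \<in> {1..N}"
  shows "AE \<omega> in M. \<exists>v S. frozen i \<omega> v S"
proof (rule AE_from_approx)
  fix \<eta> :: real assume "\<eta> > 0"
  have "\<forall>i\<in>{1..N}. \<exists>C\<ge>0. \<forall>\<^sub>F s in at_top. \<exists>w z E. spread_by i s w z E \<and> prob (space M - E) \<le> C / s ^ 4"
  proof
    fix i assume "i \<in> {1..N}"
    from spreads_all[OF this] obtain \<Lambda> c C where C: "C \<ge> 0" "\<forall>\<^sub>F s in at_top. \<exists>w z E. spread_by i s w z E \<and>
      prob (space M - E) \<le> C / s ^ 4 \<and> real (A z) \<le> \<Lambda> * s \<and> real w \<le> real z + c * ln s"
      unfolding spreads_def by blast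
    from C(2) have "\<forall>\<^sub>F s in at_top. \<exists>w z E. spread_by i s w z E \<and> prob (space M - E) \<le> C / s ^ 4"
      by (rule eventually_mono) blast
    with C(1) show "\<exists>C\<ge>0. \<forall>\<^sub>F s in at_top. \<exists>w z E. spread_by i s w z E \<and> prob (space M - E) \<le> C / s ^ 4"
      by blast
  qed
  from bchoice[OF this] obtain C where C: "\<And>i. i \<in> {1..N} \<Longrightarrow> C i \<ge> 0"
    "\<And>i. i \<in> {1..N} \<Longrightarrow> \<forall>\<^sub>F s in at_top. \<exists>w z E. spread_by i s w z E \<and> prob (space M - E) \<le> C i / s ^ 4"
    by blast
  \<comment> \<open>The failure constants of all agents together with that of a late
    deviation.\<close>
  define D where "D = (\<Sum>i\<in>{1..N}. C i) + 32 * real K * real N"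
  have "((\<lambda>s. D / s ^ 4) \<longlongrightarrow> 0) at_top" by real_asymp
  then have "\<forall>\<^sub>F s in at_top. D / s ^ 4 < \<eta>" using \<open>\<eta> > 0\<close> by (rule order_tendstoD)
  moreover have "\<forall>\<^sub>F s in at_top. \<forall>i\<in>{1..N}. \<exists>w z E. spread_by i s w z E \<and> prob (space M - E) \<le> C i / s ^ 4"
    using C(2) by (intro eventually_ball_finite) auto
  ultimately have "\<forall>\<^sub>F s in at_top. D / s ^ 4 < \<eta> \<and> 2 \<le> s \<and> (\<forall>j>reach s. long_phase \<alpha> K \<nu> b \<delta> A j) \<and>
      (\<forall>i\<in>{1..N}. \<exists>w z E. spread_by i s w z E \<and> prob (space M - E) \<le> C i / s ^ 4)"
    using eventually_long_phases eventually_ge_at_top[of 2] by eventually_elim blast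
  from eventually_happens'[OF trivial_limit_at_top_linorder this] obtain s where
    s0: "D / s ^ 4 < \<eta> \<and> 2 \<le> s \<and> (\<forall>j>reach s. long_phase \<alpha> K \<nu> b \<delta> A j) \<and>
      (\<forall>i\<in>{1..N}. \<exists>w z E. spread_by i s w z E \<and> prob (space M - E) \<le> C i / s ^ 4)" ..
  then have s: "D / s ^ 4 < \<eta>" "2 \<le> s" "\<And>j. reach s < j \<Longrightarrow> long_phase \<alpha> K \<nu> b \<delta> A j"
    by blast+
  from s0 have ex: "\<forall>i\<in>{1..N}. \<exists>w E. \<exists>z. spread_by i s w z E \<and> prob (space M - E) \<le> C i / s ^ 4"
    by blast
  from bchoice[OF ex] obtain w where
    "\<forall>i\<in>{1..N}. \<exists>E z. spread_by i s (w i) z E \<and> prob (space M - E) \<le> C i / s ^ 4" ..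
  from bchoice[OF this] obtain E where
    sp: "\<And>i. i \<in> {1..N} \<Longrightarrow> \<exists>z. spread_by i s (w i) z (E i) \<and> prob (space M - E i) \<le> C i / s ^ 4"
    by blast
  have Ev: "E i \<in> events" "prob (space M - E i) \<le> C i / s ^ 4"
    "AE \<omega> in M. \<omega> \<in> E i \<longrightarrow> \<omega> \<notin> late_dev s \<longrightarrow> (\<forall>j\<ge>w i. b \<in> acts i j \<omega>)" if "i \<in> {1..N}" for i
    using sp[OF that] unfolding spread_by_def by blast+
  let ?F = "(\<Union>i\<in>{1..N}. space M - E i) \<union> late_dev s"
  have Fev: "?F \<in> events" using Ev(1) late_dev_sets by (intro sets.Un sets.finite_UN) auto
  show "\<exists>E\<in>events. prob (space M - E) \<le> \<eta> \<and> (AE \<omega> in M. \<omega> \<in> E \<longrightarrow> (\<exists>v S. frozen i \<omega> v S))"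
  proof (intro bexI[of _ "space M - ?F"] conjI)
    have "?F \<subseteq> space M" using Fev by (rule sets.sets_into_space)
    then have "space M - (space M - ?F) = ?F" by blast
    then have "prob (space M - (space M - ?F)) = prob ?F" by (rule arg_cong)
    also have "\<dots> \<le> prob (\<Union>i\<in>{1..N}. space M - E i) + prob (late_dev s)"
      using Ev(1) late_dev_sets by (intro measure_Un_le sets.finite_UN) auto
    finally have 1: "prob (space M - (space M - ?F)) \<le> prob (\<Union>i\<in>{1..N}. space M - E i) + prob (late_dev s)" .
    have "prob (\<Union>i\<in>{1..N}. space M - E i) \<le> (\<Sum>i\<in>{1..N}. prob (space M - E i))"
      using Ev(1) by (intro finite_measure_subadditive_finite) auto
    also have "\<dots> \<le> (\<Sum>i\<in>{1..N}. C i / s ^ 4)"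
      by (rule sum_mono) (rule Ev)
    also have "\<dots> = (\<Sum>i\<in>{1..N}. C i) / s ^ 4" by (simp add: sum_divide_distrib)
    finally show "prob (space M - (space M - ?F)) \<le> \<eta>"
      using 1 prob_late_dev[OF s(2)] s(1) unfolding D_def add_divide_distrib by linarith
    have "AE \<omega> in M. \<forall>i\<in>{1..N}. \<omega> \<in> E i \<longrightarrow> \<omega> \<notin> late_dev s \<longrightarrow> (\<forall>j\<ge>w i. b \<in> acts i j \<omega>)"
      by (rule AE_finite_allI) (use Ev(3) in auto)
    with AE_regular AE_space show "AE \<omega> in M. \<omega> \<in> space M - ?F \<longrightarrow> (\<exists>v S. frozen i \<omega> v S)"
    proof eventually_elim
      case (elim \<omega>)
      show ?case
      proof
        assume \<omega>: "\<omega> \<in> space M - ?F"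
        then have late: "\<omega> \<notin> late_dev s" by blast
        have act: "b \<in> acts i j \<omega>" if "i \<in> {1..N}" "Max (w ` {1..N}) \<le> j" for i j
        proof -
          have "w i \<le> Max (w ` {1..N})" using that(1) by (intro Max_ge) auto
          then have "w i \<le> j" using that(2) by simp
          moreover have "\<omega> \<in> E i" using \<omega> that(1) by blast
          ultimately show ?thesis using elim(3) that(1) late by blast
        qed
        show "\<exists>v S. frozen i \<omega> v S"
          unfolding frozen_def
          by (rule slack_path.active_sets_freeze[where s = s,
                OF elim(1) accurate_if_not_late[OF elim(1,2) late] s(3) act i])
      qed
    qed
  qed (use Fev in auto)
qed

end

section \<open>Regret\<close>

context gosine_slack
begin

text \<open>Membership requires only that the count is below the UCB threshold. Hence its size has a
  deterministic logarithmic bound, even on paths where \<open>b\<close> is missing or deviations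
  occur.\<close>

definition valid_pulls :: "nat \<Rightarrow> nat \<Rightarrow> nat \<Rightarrow> 'w \<Rightarrow> nat set" where
  "valid_pulls i l T \<omega> = {t \<in> {1..T}. I i t \<omega> = l \<and>
     real (pulls (\<lambda>s. I i s \<omega>) l {1..t - 1}) \<le> 4 * \<alpha> * ln (real t) / (\<nu> b - \<nu> l)\<^sup>2}"

definition valid_regret :: "nat \<Rightarrow> nat \<Rightarrow> 'w \<Rightarrow> real" where
  "valid_regret i T \<omega> = (\<Sum>l\<in>{1..K} - {b}. (\<nu> b - \<nu> l) * real (card (valid_pulls i l T \<omega>)))"

lemma gap_bounds: "l \<in> {1..K} - {b} \<Longrightarrow> 0 < \<nu> b - \<nu> l \<and> \<nu> b - \<nu> l \<le> 1"
  using gap[of l] mean_unit[of l] mean_unit[OF best] by auto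

lemma valid_regret_measurable:
  assumes i: "i \<in> {1..N}"
  shows "valid_regret i T \<in> borel_measurable M"
proof -
  have "valid_regret i T \<omega> = (\<Sum>l\<in>{1..K} - {b}. (\<nu> b - \<nu> l) * (\<Sum>t\<in>{1..T}.
     if I i t \<omega> = l \<and> real (pulls (\<lambda>s. I i s \<omega>) l {1..t - 1}) \<le> 4 * \<alpha> * ln (real t) / (\<nu> b - \<nu> l)\<^sup>2
     then 1 else 0))" for \<omega>
    unfolding valid_regret_def valid_pulls_def by (simp add: sum.If_cases Int_def)
  moreover have "(\<lambda>\<omega>. \<Sum>l\<in>{1..K} - {b}. (\<nu> b - \<nu> l) * (\<Sum>t\<in>{1..T}.
     if I i t \<omega> = l \<and> real (pulls (\<lambda>s. I i s \<omega>) l {1..t - 1}) \<le> 4 * \<alpha> * ln (real t) / (\<nu> b - \<nu> l)\<^sup>2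
     then 1 else 0)) \<in> borel_measurable M"
  proof (intro borel_measurable_sum borel_measurable_times)
    fix l t assume "t \<in> {1..T}"
    then have [measurable]: "I i t \<in> measurable M (count_space UNIV)" using I_measurable[OF i] by simp
    note [measurable] = pulls_measurable[OF i]
    show "(\<lambda>\<omega>. if I i t \<omega> = l \<and> real (pulls (\<lambda>s. I i s \<omega>) l {1..t - 1}) \<le> 4 * \<alpha> * ln (real t) / (\<nu> b - \<nu> l)\<^sup>2
      then 1 else 0 :: real) \<in> borel_measurable M" by measurable
  qed simp
  ultimately show ?thesis by (simp cong: measurable_cong)
qed

lemma card_valid_pulls_le:
  assumes "1 \<le> T"
  shows "real (card (valid_pulls i l T \<omega>)) \<le> 4 * \<alpha> * ln (real T) / (\<nu> b - \<nu> l)\<^sup>2 + 1"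
proof (rule card_le_of_pulls_le)
  fix t assume t: "t \<in> valid_pulls i l T \<omega>"
  then have "4 * \<alpha> * ln (real t) / (\<nu> b - \<nu> l)\<^sup>2 \<le> 4 * \<alpha> * ln (real T) / (\<nu> b - \<nu> l)\<^sup>2"
    using \<alpha>_gt_3 by (intro divide_right_mono mult_left_mono) (auto simp: valid_pulls_def)
  then show "1 \<le> t \<and> I i t \<omega> = l \<and>
      real (pulls (\<lambda>t. I i t \<omega>) l {1..t - 1}) \<le> 4 * \<alpha> * ln (real T) / (\<nu> b - \<nu> l)\<^sup>2"
    using t unfolding valid_pulls_def by auto
qed (use assms \<alpha>_gt_3 in \<open>auto simp: valid_pulls_def\<close>)

lemma valid_pulls_regret_le:
  assumes "1 \<le> T" and l: "l \<in> {1..K} - {b}"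
  shows "(\<nu> b - \<nu> l) * real (card (valid_pulls i l T \<omega>)) \<le> 4 * \<alpha> / (\<nu> b - \<nu> l) * ln (real T) + 1"
proof -
  have eq: "d * (4 * \<alpha> * ln (real T) / d\<^sup>2 + 1) = 4 * \<alpha> / d * ln (real T) + d" if "d > 0" for d :: real
    using that by (simp add: field_simps power2_eq_square)
  have "(\<nu> b - \<nu> l) * real (card (valid_pulls i l T \<omega>))
      \<le> (\<nu> b - \<nu> l) * (4 * \<alpha> * ln (real T) / (\<nu> b - \<nu> l)\<^sup>2 + 1)"
    using card_valid_pulls_le[OF assms(1)] gap_bounds[OF l] by (intro mult_left_mono) auto
  also have "\<dots> = 4 * \<alpha> / (\<nu> b - \<nu> l) * ln (real T) + (\<nu> b - \<nu> l)"
    using gap_bounds[OF l] by (intro eq) simp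
  finally show ?thesis using gap_bounds[OF l] by linarith
qed

lemma valid_regret_nonneg: "0 \<le> valid_regret i T \<omega>"
  unfolding valid_regret_def using gap_bounds by (intro sum_nonneg mult_nonneg_nonneg) (auto intro: less_imp_le)

lemma valid_regret_le:
  assumes "1 \<le> T"
  shows "valid_regret i T \<omega> \<le> (\<Sum>l\<in>{1..K} - {b}. 4 * \<alpha> / (\<nu> b - \<nu> l)) * ln (real T) + real K"
proof -
  have "valid_regret i T \<omega> \<le> (\<Sum>l\<in>{1..K} - {b}. 4 * \<alpha> / (\<nu> b - \<nu> l) * ln (real T) + 1)"
    unfolding valid_regret_def by (intro sum_mono valid_pulls_regret_le assms)
  also have "\<dots> = (\<Sum>l\<in>{1..K} - {b}. 4 * \<alpha> / (\<nu> b - \<nu> l)) * ln (real T) + real (card ({1..K} - {b}))"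
    by (simp add: sum.distrib sum_distrib_right)
  also have "card ({1..K} - {b}) \<le> K" using card_mono[of "{1..K}" "{1..K} - {b}"] by auto
  finally show ?thesis by simp
qed

text \<open>Each suboptimal pull is either valid, and its gap is counted in
  \<open>valid_regret\<close>, or an overpull, whose cost is at most 1.\<close>

lemma regret_le_valid_regret:
  assumes reg: "regular \<omega>" and i: "i \<in> {1..N}"
  shows "regret (\<nu> b) \<nu> (I i) T \<omega> \<le> valid_regret i T \<omega> + (\<Sum>t\<in>{1..T}. of_bool (overpulled i t \<omega>))"
proof -
  let ?v = "\<lambda>l t. of_bool (t \<in> valid_pulls i l T \<omega>) :: real"
  have "real (card (valid_pulls i l T \<omega>)) = (\<Sum>t\<in>{1..T}. ?v l t)" for l
  proof -
    have "{1..T} \<inter> {t. t \<in> valid_pulls i l T \<omega>} = valid_pulls i l T \<omega>"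
      by (auto simp: valid_pulls_def)
    then show ?thesis by simp
  qed
  then have "valid_regret i T \<omega> = (\<Sum>l\<in>{1..K} - {b}. \<Sum>t\<in>{1..T}. (\<nu> b - \<nu> l) * ?v l t)"
    unfolding valid_regret_def by (simp only: sum_distrib_left)
  also have "\<dots> = (\<Sum>t\<in>{1..T}. \<Sum>l\<in>{1..K} - {b}. (\<nu> b - \<nu> l) * ?v l t)" by (rule sum.swap)
  finally have eq: "valid_regret i T \<omega> = (\<Sum>t\<in>{1..T}. \<Sum>l\<in>{1..K} - {b}. (\<nu> b - \<nu> l) * ?v l t)" .
  have nonneg: "0 \<le> (\<nu> b - \<nu> l) * ?v l t" if "l \<in> {1..K} - {b}" for l t
    using gap_bounds[OF that] by (intro mult_nonneg_nonneg) auto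
  have "\<nu> b - \<nu> (I i t \<omega>) \<le> (\<Sum>l\<in>{1..K} - {b}. (\<nu> b - \<nu> l) * ?v l t) + of_bool (overpulled i t \<omega>)"
    if t: "t \<in> {1..T}" for t
  proof (cases "I i t \<omega> = b")
    case True
    have "0 \<le> (\<Sum>l\<in>{1..K} - {b}. (\<nu> b - \<nu> l) * ?v l t)" by (rule sum_nonneg) (rule nonneg)
    then show ?thesis using True by simp
  next
    case False
    define l where "l = I i t \<omega>"
    have "I i t \<omega> \<in> {1..K}" using slack_path.pull_range[OF reg i] t by simp
    then have l: "l \<in> {1..K} - {b}" using False by (simp add: l_def)
    have "(\<nu> b - \<nu> l) * ?v l t \<le> (\<Sum>l\<in>{1..K} - {b}. (\<nu> b - \<nu> l) * ?v l t)"
      using l by (intro member_le_sum nonneg) auto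
    moreover have "\<nu> b - \<nu> l \<le> (\<nu> b - \<nu> l) * ?v l t + of_bool (overpulled i t \<omega>)"
    proof (cases "t \<in> valid_pulls i l T \<omega>")
      case False
      then have "overpulled i t \<omega>"
        using l t by (auto simp: valid_pulls_def overpulled_def l_def)
      then show ?thesis using False gap_bounds[OF l] by simp
    qed simp
    ultimately show ?thesis unfolding l_def[symmetric] by linarith
  qed
  then show ?thesis
    unfolding eq regret_def sum.distrib[symmetric] by (rule sum_mono)
qed

text \<open>An arm outside \<open>S\<close> is pulled only before phase \<open>v\<close>, in at most
  \<open>e \<omega> i v\<close> slots, so only the arms of \<open>S\<close> contribute
  logarithmically. The path-dependent constant disappears after division by
  \<open>ln T\<close>.\<close>

lemma valid_regret_frozen_le:
  assumes reg: "regular \<omega>" and i: "i \<in> {1..N}" and fr: "frozen i \<omega> v S" and "1 \<le> T"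
    and \<beta>: "(\<Sum>l\<in>S - {b}. 4 * \<alpha> / (\<nu> b - \<nu> l)) \<le> \<beta>"
  shows "valid_regret i T \<omega> \<le> \<beta> * ln (real T) + real K * (1 + real (e \<omega> i v))"
proof -
  let ?\<tau> = "real (e \<omega> i v)"
  have S: "S \<subseteq> {1..K}" "b \<in> S" using fr by (auto simp: frozen_def)
  then have fin: "finite S" using finite_subset by blast
  have out: "real (card (valid_pulls i l T \<omega>)) \<le> ?\<tau>" if "l \<notin> S" for l
  proof -
    have "valid_pulls i l T \<omega> \<subseteq> {1..e \<omega> i v}"
    proof
      fix t assume "t \<in> valid_pulls i l T \<omega>"
      then have t: "1 \<le> t" "I i t \<omega> = l" by (auto simp: valid_pulls_def)
      obtain j where j: "t \<in> {e \<omega> i j<..e \<omega> i (Suc j)}"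
        using slack_path.slot_in_phase[OF reg i t(1)] by blast
      have "I i t \<omega> \<in> acts i j \<omega>"
        using slack_path.ucb_pull[OF reg i j] unfolding is_arg_max_def by blast
      then have "\<not> v \<le> j" using fr that t(2) unfolding frozen_def by blast
      then have "\<not> e \<omega> i v < t" using slack_path.phase_index_ge[OF reg i j] by blast
      then show "t \<in> {1..e \<omega> i v}" using t(1) by simp
    qed
    then have "card (valid_pulls i l T \<omega>) \<le> card {1..e \<omega> i v}" by (intro card_mono) auto
    then show ?thesis by simp
  qed
  have "valid_regret i T \<omega> \<le> (\<Sum>l\<in>{1..K} - {b}.
      (if l \<in> S then 4 * \<alpha> / (\<nu> b - \<nu> l) * ln (real T) else 0) + (1 + ?\<tau>))"
    unfolding valid_regret_def
  proof (rule sum_mono)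
    fix l assume l: "l \<in> {1..K} - {b}"
    show "(\<nu> b - \<nu> l) * real (card (valid_pulls i l T \<omega>))
        \<le> (if l \<in> S then 4 * \<alpha> / (\<nu> b - \<nu> l) * ln (real T) else 0) + (1 + ?\<tau>)"
    proof (cases "l \<in> S")
      case True
      then show ?thesis using valid_pulls_regret_le[OF \<open>1 \<le> T\<close> l, of i \<omega>] by simp
    next
      case False
      have "(\<nu> b - \<nu> l) * real (card (valid_pulls i l T \<omega>)) \<le> 1 * ?\<tau>"
        using gap_bounds[OF l] out[OF False] by (intro mult_mono) auto
      then show ?thesis using False by simp
    qed
  qed
  also have "\<dots> = (\<Sum>l\<in>{1..K} - {b}. if l \<in> S then 4 * \<alpha> / (\<nu> b - \<nu> l) * ln (real T) else 0)
      + real (card ({1..K} - {b})) * (1 + ?\<tau>)"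
    by (simp add: sum.distrib algebra_simps)
  also have "(\<Sum>l\<in>{1..K} - {b}. if l \<in> S then 4 * \<alpha> / (\<nu> b - \<nu> l) * ln (real T) else 0)
      = (\<Sum>l\<in>S - {b}. 4 * \<alpha> / (\<nu> b - \<nu> l)) * ln (real T)"
  proof -
    have "({1..K} - {b}) \<inter> S = S - {b}" using S by blast
    then show ?thesis by (simp add: sum.If_cases sum_distrib_right)
  qed
  finally have "valid_regret i T \<omega> \<le> (\<Sum>l\<in>S - {b}. 4 * \<alpha> / (\<nu> b - \<nu> l)) * ln (real T)
      + real (card ({1..K} - {b})) * (1 + ?\<tau>)" .
  moreover have "(\<Sum>l\<in>S - {b}. 4 * \<alpha> / (\<nu> b - \<nu> l)) * ln (real T) \<le> \<beta> * ln (real T)"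
    using \<beta> \<open>1 \<le> T\<close> by (intro mult_right_mono) auto
  moreover have "real (card ({1..K} - {b})) * (1 + ?\<tau>) \<le> real K * (1 + ?\<tau>)"
    using best by (intro mult_right_mono) auto
  ultimately show ?thesis by linarith
qed

lemma expectation_regret_le:
  assumes i: "i \<in> {1..N}"
  shows "expectation (regret (\<nu> b) \<nu> (I i) T)
    \<le> expectation (valid_regret i T) + (\<Sum>t. prob {\<omega> \<in> space M. overpulled i t \<omega>})"
proof (cases "1 \<le> T")
  case True
  let ?O = "\<lambda>t. {\<omega> \<in> space M. overpulled i t \<omega>}"
  have intV: "integrable M (valid_regret i T)"
    using valid_regret_le[OF True] valid_regret_nonneg
    by (intro integrable_const_bound[OF _ valid_regret_measurable[OF i]] AE_I2) (simp add: abs_of_nonneg)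
  have Oev: "?O t \<in> events" if "t \<in> {1..T}" for t
    using overpulled_sets[OF i] that by simp
  have intO: "integrable M (\<lambda>\<omega>. \<Sum>t\<in>{1..T}. indicator (?O t) \<omega> :: real)"
    using Oev by (intro Bochner_Integration.integrable_sum) (auto simp: less_top[symmetric])
  have "AE \<omega> in M. regret (\<nu> b) \<nu> (I i) T \<omega>
      \<le> valid_regret i T \<omega> + (\<Sum>t\<in>{1..T}. indicator (?O t) \<omega>)"
    using AE_regular AE_space
  proof eventually_elim
    case (elim \<omega>)
    have "indicator (?O t) \<omega> = (of_bool (overpulled i t \<omega>) :: real)" for t
      using elim(2) by (simp add: indicator_def)
    then show ?case using regret_le_valid_regret[OF elim(1) i] by simp
  qed
  moreover have "integrable M (regret (\<nu> b) \<nu> (I i) T)"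
    unfolding regret_def
  proof (rule Bochner_Integration.integrable_sum)
    fix t assume t: "t \<in> {1..T}"
    then have [measurable]: "I i t \<in> measurable M (count_space UNIV)" using I_measurable[OF i] by simp
    show "integrable M (\<lambda>\<omega>. \<nu> b - \<nu> (I i t \<omega>))"
    proof (rule integrable_const_bound)
      show "AE \<omega> in M. norm (\<nu> b - \<nu> (I i t \<omega>)) \<le> 1"
        using AE_regular
      proof eventually_elim
        case (elim \<omega>)
        then have "I i t \<omega> \<in> {1..K}" using slack_path.pull_range[OF elim i] t by simp
        then show ?case using mean_unit[of "I i t \<omega>"] mean_unit[OF best] by auto
      qed
    qed measurable
  qed
  ultimately have "expectation (regret (\<nu> b) \<nu> (I i) T)
      \<le> expectation (\<lambda>\<omega>. valid_regret i T \<omega> + (\<Sum>t\<in>{1..T}. indicator (?O t) \<omega>))"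
    using intV intO by (intro integral_mono_AE) auto
  also have "\<dots> = expectation (valid_regret i T) + expectation (\<lambda>\<omega>. \<Sum>t\<in>{1..T}. indicator (?O t) \<omega>)"
    using intV intO by simp
  also have "expectation (\<lambda>\<omega>. \<Sum>t\<in>{1..T}. indicator (?O t) \<omega>) = (\<Sum>t\<in>{1..T}. prob (?O t))"
    using Oev by (subst Bochner_Integration.integral_sum) (auto simp: less_top[symmetric] Int_absorb2)
  finally have "expectation (regret (\<nu> b) \<nu> (I i) T)
      \<le> expectation (valid_regret i T) + (\<Sum>t\<in>{1..T}. prob (?O t))" .
  moreover have "(\<Sum>t\<in>{1..T}. prob (?O t)) \<le> (\<Sum>t. prob (?O t))"
    using summable_overpulled[OF i] by (intro sum_le_suminf) auto
  ultimately show ?thesis by linarith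
next
  case False
  then have "regret (\<nu> b) \<nu> (I i) T = (\<lambda>_. 0)" by (auto simp: regret_def fun_eq_iff)
  then have "expectation (regret (\<nu> b) \<nu> (I i) T) = 0" by simp
  moreover have "0 \<le> expectation (valid_regret i T)"
    using valid_regret_nonneg by (intro Bochner_Integration.integral_nonneg)
  moreover have "0 \<le> (\<Sum>t. prob {\<omega> \<in> space M. overpulled i t \<omega>})"
    using summable_overpulled[OF i] by (intro suminf_nonneg) auto
  ultimately show ?thesis by linarith
qed

text \<open>On almost every path the excess is at most a path-dependent constant divided by
  \<open>ln T\<close>. That constant need not be integrable, so the limit is interchanged with the
  expectation through the deterministic bound on \<open>valid_regret\<close>.\<close>

lemma valid_regret_excess_tendsto_0:
  assumes i: "i \<in> {1..N}"
    and \<beta>: "\<And>S. b \<in> S \<Longrightarrow> S \<subseteq> {1..K} \<Longrightarrow> card (S - {b}) \<le> sticky_size N K + 1 \<Longrightarrow>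
      (\<Sum>l\<in>S - {b}. 4 * \<alpha> / (\<nu> b - \<nu> l)) \<le> \<beta>"
  shows "(\<lambda>T. expectation (\<lambda>\<omega>. max 0 (valid_regret i T \<omega> / ln (real T) - \<beta>))) \<longlonglongrightarrow> 0"
\<comment> \<open>The shift by 3 gives \<open>ln T \<ge> 1\<close>, as 3 exceeds the base of the
  natural logarithm; this yields a constant dominating function.\<close>
proof (rule LIMSEQ_offset[where k = 3])
  let ?g = "\<lambda>T \<omega>. max 0 (valid_regret i T \<omega> / ln (real T) - \<beta>)"
  define c where "c = (\<Sum>l\<in>{1..K} - {b}. 4 * \<alpha> / (\<nu> b - \<nu> l)) + real K + \<bar>\<beta>\<bar>"
  note [measurable] = valid_regret_measurable[OF i]
  have "(\<lambda>T. expectation (?g (T + 3))) \<longlonglongrightarrow> expectation (\<lambda>_. 0)"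
  proof (rule integral_dominated_convergence[where w = "\<lambda>_. c"])
    show "AE \<omega> in M. (\<lambda>T. ?g (T + 3) \<omega>) \<longlonglongrightarrow> 0"
      using AE_regular AE_frozen[OF i]
    proof eventually_elim
      case (elim \<omega>)
      then obtain v S where fr: "frozen i \<omega> v S" by blast
      let ?c = "real K * (1 + real (e \<omega> i v))"
      have le: "?g (T + 3) \<omega> \<le> ?c / ln (real (T + 3))" for T
      proof -
        have ln: "ln (real (T + 3)) > 0" by simp
        have "valid_regret i (T + 3) \<omega> \<le> \<beta> * ln (real (T + 3)) + ?c"
          using fr by (intro valid_regret_frozen_le[OF elim(1) i fr] \<beta>) (auto simp: frozen_def)
        then have "valid_regret i (T + 3) \<omega> / ln (real (T + 3)) \<le> (\<beta> * ln (real (T + 3)) + ?c) / ln (real (T + 3))"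
          using ln by (intro divide_right_mono) auto
        also have "\<dots> = \<beta> + ?c / ln (real (T + 3))" using ln by (simp add: add_divide_distrib)
        finally show ?thesis using ln by simp
      qed
      have lim: "(\<lambda>T. ?c / ln (real (T + 3))) \<longlonglongrightarrow> 0" by real_asymp
      show ?case
        by (rule tendsto_sandwich[OF _ _ tendsto_const lim]) (use le in \<open>simp_all only: max.cobounded1 eventually_True\<close>)
    qed
    show "AE \<omega> in M. norm (?g (T + 3) \<omega>) \<le> c" for T
    proof (rule AE_I2)
      fix \<omega>
      have "exp 1 \<le> real (T + 3)" using exp_le by simp
      then have "ln (exp 1) \<le> ln (real (T + 3))" by (subst ln_le_cancel_iff) auto
      then have ln: "1 \<le> ln (real (T + 3))" by simp
      have "valid_regret i (T + 3) \<omega>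
          \<le> (\<Sum>l\<in>{1..K} - {b}. 4 * \<alpha> / (\<nu> b - \<nu> l)) * ln (real (T + 3)) + real K"
        by (rule valid_regret_le) simp
      also have "\<dots> \<le> (\<Sum>l\<in>{1..K} - {b}. 4 * \<alpha> / (\<nu> b - \<nu> l)) * ln (real (T + 3)) + real K * ln (real (T + 3))"
        using ln by (intro add_left_mono) (simp add: mult_le_cancel_left1)
      also have "\<dots> = ((\<Sum>l\<in>{1..K} - {b}. 4 * \<alpha> / (\<nu> b - \<nu> l)) + real K) * ln (real (T + 3))"
        by (simp only: distrib_right)
      finally have "valid_regret i (T + 3) \<omega> / ln (real (T + 3)) \<le> (\<Sum>l\<in>{1..K} - {b}. 4 * \<alpha> / (\<nu> b - \<nu> l)) + real K"
        using ln by (subst pos_divide_le_eq) auto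
      moreover have "0 \<le> (\<Sum>l\<in>{1..K} - {b}. 4 * \<alpha> / (\<nu> b - \<nu> l))"
        using gap_bounds \<alpha>_gt_3 by (intro sum_nonneg divide_nonneg_pos) auto
      ultimately show "norm (?g (T + 3) \<omega>) \<le> c" unfolding c_def by (auto simp: max_def)
    qed
  qed auto
  then show "(\<lambda>T. expectation (?g (T + 3))) \<longlonglongrightarrow> 0" by simp
qed

text \<open>Overpulls add a constant to the expected regret, and the valid part is at most \<beta>
  plus the positive part of its excess, so both corrections vanish after division by
  \<open>ln T\<close>.\<close>

lemma limsup_regret_le:
  assumes i: "i \<in> {1..N}"
    and \<beta>: "\<And>S. b \<in> S \<Longrightarrow> S \<subseteq> {1..K} \<Longrightarrow> card (S - {b}) \<le> sticky_size N K + 1 \<Longrightarrow>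
      (\<Sum>l\<in>S - {b}. 4 * \<alpha> / (\<nu> b - \<nu> l)) \<le> \<beta>"
  shows "limsup (\<lambda>T. ereal (expectation (regret (\<nu> b) \<nu> (I i) T) / ln (real T))) \<le> ereal \<beta>"
proof -
  let ?g = "\<lambda>T \<omega>. max 0 (valid_regret i T \<omega> / ln (real T) - \<beta>)"
  define s where "s = (\<Sum>t. prob {\<omega> \<in> space M. overpulled i t \<omega>})"
  note [measurable] = valid_regret_measurable[OF i]
  have "(\<lambda>T::nat. s / ln (real T)) \<longlonglongrightarrow> 0" by real_asymp
  from tendsto_add[OF tendsto_add[OF tendsto_const[of \<beta>] valid_regret_excess_tendsto_0[OF i \<beta>]] this]
  have lim: "(\<lambda>T. \<beta> + expectation (?g T) + s / ln (real T)) \<longlonglongrightarrow> \<beta>" by simp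
  have "\<forall>\<^sub>F T in sequentially. ereal (expectation (regret (\<nu> b) \<nu> (I i) T) / ln (real T))
      \<le> ereal (\<beta> + expectation (?g T) + s / ln (real T))"
    using eventually_ge_at_top[of 2]
  proof eventually_elim
    case (elim T)
    have ln: "ln (real T) > 0" using elim by simp
    let ?c = "(\<Sum>l\<in>{1..K} - {b}. 4 * \<alpha> / (\<nu> b - \<nu> l)) * ln (real T) + real K"
    have b: "valid_regret i T \<omega> \<le> ?c" for \<omega> using elim by (intro valid_regret_le) simp
    have intV: "integrable M (valid_regret i T)"
      using b valid_regret_nonneg
      by (intro integrable_const_bound[OF _ valid_regret_measurable[OF i]] AE_I2) (simp add: abs_of_nonneg)
    then have intg: "integrable M (?g T)"
      by (intro integrable_max) auto
    have "expectation (valid_regret i T) / ln (real T) = expectation (\<lambda>\<omega>. valid_regret i T \<omega> / ln (real T))"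
      by simp
    also have "\<dots> \<le> expectation (\<lambda>\<omega>. \<beta> + ?g T \<omega>)"
      using intV intg by (intro integral_mono) auto
    also have "\<dots> = \<beta> + expectation (?g T)" using intg by (simp add: prob_space)
    finally have "expectation (valid_regret i T) / ln (real T) \<le> \<beta> + expectation (?g T)" .
    moreover have "expectation (regret (\<nu> b) \<nu> (I i) T) / ln (real T)
        \<le> (expectation (valid_regret i T) + s) / ln (real T)"
      unfolding s_def using ln by (intro divide_right_mono expectation_regret_le[OF i]) auto
    ultimately show ?case by (simp add: add_divide_distrib)
  qed
  then have "limsup (\<lambda>T. ereal (expectation (regret (\<nu> b) \<nu> (I i) T) / ln (real T)))
      \<le> limsup (\<lambda>T. ereal (\<beta> + expectation (?g T) + s / ln (real T)))"
    by (rule Limsup_mono)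
  also have "\<dots> = ereal \<beta>"
    using lim by (intro lim_imp_Limsup) auto
  finally show ?thesis .
qed

end

section \<open>Worst choice of the final set, and reduction of both algorithms to the common
  abstraction\<close>

lemma sum_le_sum_initial:
  fixes f :: "nat \<Rightarrow> real"
  assumes anti: "\<And>x y. x \<in> {2..K} \<Longrightarrow> y \<in> {2..K} \<Longrightarrow> x \<le> y \<Longrightarrow> f y \<le> f x"
    and nonneg: "\<And>x. x \<in> {2..K} \<Longrightarrow> 0 \<le> f x"
    and J: "J \<subseteq> {2..K}" "card J \<le> c + 1"
  shows "sum f J \<le> sum f {2..min (c + 2) K}"
proof -
  let ?H = "{2..min (c + 2) K}"
  have fin: "finite J" using J finite_subset by blast
  show ?thesis
  proof (cases "K \<le> c + 2")
    case True
    then have "min (c + 2) K = K" by simp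
    then show ?thesis using J nonneg by (intro sum_mono2) auto
  next
    case False
    \<comment> \<open>The interval from 2 to \<open>h\<close> has \<open>c + 1\<close> elements.
      Exchanging argument: \<open>f h\<close> bounds \<open>f\<close> from above on the part of
      \<open>J\<close> beyond \<open>h\<close> and from below on the part of the interval that
      \<open>J\<close> misses, which is at least as large.\<close>
    define h where "h = c + 2"
    have H: "?H = {2..h}" using False by (simp add: h_def min_def)
    have h: "h \<in> {2..K}" using False by (simp add: h_def)
    have "card J \<le> card {2..h}" using J by (simp add: h_def)
    moreover have "card J = card (J - {2..h}) + card (J \<inter> {2..h})"
      using card_Int_Diff[OF fin, of "{2..h}"] by simp
    moreover have "card {2..h} = card ({2..h} - J) + card (J \<inter> {2..h})"
      using card_Int_Diff[of "{2..h}" J] by (simp add: Int_commute)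
    ultimately have card: "card (J - {2..h}) \<le> card ({2..h} - J)" by linarith
    have "sum f (J - {2..h}) \<le> real (card (J - {2..h})) * f h"
      using J h by (intro sum_bounded_above anti) auto
    also have "\<dots> \<le> real (card ({2..h} - J)) * f h"
      using card nonneg[OF h] by (intro mult_right_mono) auto
    also have "\<dots> \<le> sum f ({2..h} - J)"
      using h by (intro sum_bounded_below anti) auto
    finally have "sum f (J - {2..h}) \<le> sum f ({2..h} - J)" .
    moreover have "sum f J = sum f (J - {2..h}) + sum f (J \<inter> {2..h})"
      using sum.Int_Diff[OF fin, of f "{2..h}"] by simp
    moreover have "sum f {2..h} = sum f ({2..h} - J) + sum f (J \<inter> {2..h})"
      using sum.Int_Diff[of "{2..h}" f J] by (simp add: Int_commute)
    ultimately show ?thesis unfolding H by linarith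
  qed
qed

text \<open>A positive product of nonnegative entries has no zero factor, so every edge on the path
  from \<open>i\<close> to \<open>m\<close> has positive probability. The path is then read
  backwards, in the direction in which information flows.\<close>

lemma irreducible_gossip_connected:
  assumes gm: "gossip_matrix N P" and irr: "irreducible_gossip N P"
    and m: "m \<in> {1..N}" and i: "i \<in> {1..N}"
  shows "(m, i) \<in> {(m, i). m \<in> {1..N} \<and> i \<in> {1..N} \<and> P i m > 0}\<^sup>*"
proof (cases "m = i")
  case False
  let ?R = "{(m, i). m \<in> {1..N} \<and> i \<in> {1..N} \<and> P i m > 0}"
  have "i \<noteq> m" using False by simp
  from irr[unfolded irreducible_gossip_def, rule_format, OF i m this]
  obtain k :: "nat \<Rightarrow> nat" and l :: nat where
    "1 \<le> l \<and> k 1 = i \<and> k l = m \<and> (\<forall>n\<in>{1..l}. k n \<in> {1..N}) \<and>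
      (\<Prod>n\<in>{1..<l}. P (k n) (k (n + 1))) > 0"
    by (elim exE)
  then have k: "1 \<le> l" "k 1 = i" "k l = m" "\<And>n. n \<in> {1..l} \<Longrightarrow> k n \<in> {1..N}"
    and prod: "(\<Prod>n\<in>{1..<l}. P (k n) (k (n + 1))) > 0" by blast+
  have edge: "(k (Suc n), k n) \<in> ?R" if n: "1 \<le> n" "n < l" for n
  proof -
    have kn: "k n \<in> {1..N}" "k (n + 1) \<in> {1..N}" using k(4) n by auto
    then have "P (k n) (k (n + 1)) \<ge> 0" using gm unfolding gossip_matrix_def by blast
    moreover have "P (k n) (k (n + 1)) \<noteq> 0"
    proof
      assume "P (k n) (k (n + 1)) = 0"
      then have "(\<Prod>n\<in>{1..<l}. P (k n) (k (n + 1))) = 0" using n by (intro prod_zero) auto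
      with prod show False by linarith
    qed
    ultimately show ?thesis using kn by auto
  qed
  have "(k n, k 1) \<in> ?R\<^sup>*" if "1 \<le> n" "n \<le> l" for n
    using that
  proof (induction n rule: dec_induct)
    case (step n)
    have "(k (Suc n), k n) \<in> ?R" using step by (intro edge) simp_all
    moreover have "(k n, k 1) \<in> ?R\<^sup>*" using step by simp
    ultimately show ?case by (rule converse_rtrancl_into_rtrancl)
  qed simp
  from this[of l] show ?thesis using k by simp
qed simp

lemma (in gossip_bandit) AE_contact_range:
  assumes gm: "gossip_matrix N P"
  shows "AE \<omega> in M. \<forall>i\<in>{1..N}. \<forall>j. Z (Contact i j) \<omega> \<in> {1..N}"
proof (rule AE_finite_allI)
  fix i assume i: "i \<in> {1..N}"
  have "AE \<omega> in M. Z (Contact i j) \<omega> \<in> {1..N}" for j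
  proof -
    let ?E = "\<lambda>m. {\<omega> \<in> space M. Z (Contact i j) \<omega> = m}"
    have ev: "?E m \<in> events" for m by measurable
    have "prob {\<omega> \<in> space M. Z (Contact i j) \<omega> \<in> {1..N}} = prob (\<Union>m\<in>{1..N}. ?E m)"
      by (rule arg_cong[of _ _ prob]) auto
    also have "\<dots> = (\<Sum>m\<in>{1..N}. prob (?E m))"
      using ev by (intro finite_measure_finite_Union) (auto simp: disjoint_family_on_def)
    also have "\<dots> = (\<Sum>m\<in>{1..N}. P i m)" using i by (intro sum.cong contact_law) auto
    also have "\<dots> = 1" using gm i unfolding gossip_matrix_def by blast
    finally have "prob {\<omega> \<in> space M. Z (Contact i j) \<omega> \<in> {1..N}} = 1" .
    then have "AE \<omega> in M. \<omega> \<in> {\<omega> \<in> space M. Z (Contact i j) \<omega> \<in> {1..N}}" by (rule AE_prob_1)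
    then show ?thesis by eventually_elim simp
  qed
  then show "AE \<omega> in M. \<forall>j. Z (Contact i j) \<omega> \<in> {1..N}" by (subst AE_all_countable) blast
qed simp

lemma (in gosine_async) AE_duration_range:
  assumes sched: "phase_schedule (\<lambda>x. phase_end B \<epsilon> (int x)) \<epsilon>" and "\<delta> \<ge> 0"
  shows "AE \<omega> in M. \<forall>i\<in>{1..N}. \<forall>j. Z (Duration i j) \<omega> \<in> duration_range (phase_end B \<epsilon>) \<delta> j"
proof (rule AE_finite_allI)
  interpret phase_schedule "\<lambda>x. phase_end B \<epsilon> (int x)" \<epsilon> by fact
  fix i assume i: "i \<in> {1..N}"
  have "AE \<omega> in M. Z (Duration i j) \<omega> \<in> duration_range (phase_end B \<epsilon>) \<delta> j" for j
  proof -
    let ?d = "phase_end B \<epsilon> (int j) - phase_end B \<epsilon> (int j - 1)"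
    let ?R = "duration_range (phase_end B \<epsilon>) \<delta> j"
    have le: "phase_end B \<epsilon> (int j - 1) \<le> phase_end B \<epsilon> (int j)"
    proof (cases j)
      case (Suc k)
      then show ?thesis using A_le[of k j] by simp
    qed (simp add: phase_end_def)
    \<comment> \<open>The shortest admissible length shows that the range is nonempty; being finite
      as well, it is the support of \<open>pmf_of_set\<close>.\<close>
    then have "?d \<in> ?R"
      using \<open>\<delta> \<ge> 0\<close> by (simp add: duration_range_def of_nat_diff mult_le_cancel_right1)
    moreover have "?R \<subseteq> {..nat \<lceil>(1 + \<delta>) * (real (phase_end B \<epsilon> (int j)) - real (phase_end B \<epsilon> (int j - 1)))\<rceil>}"
      by (auto simp: duration_range_def) linarith
    then have "finite ?R" using finite_subset by blast
    ultimately have set: "set_pmf (pmf_of_set ?R) = ?R" by (intro set_pmf_of_set) auto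
    have "AE x in distr M (count_space UNIV) (Z (Duration i j)). x \<in> ?R"
      unfolding duration_law[OF i] by (simp add: AE_measure_pmf_iff set)
    then show ?thesis by (subst (asm) AE_distr_iff) auto
  qed
  then show "AE \<omega> in M. \<forall>j. Z (Duration i j) \<omega> \<in> duration_range (phase_end B \<epsilon>) \<delta> j"
    by (subst AE_all_countable) blast
qed simp

theorem corollary5:
  fixes N K :: nat and P :: "nat \<Rightarrow> nat \<Rightarrow> real"
    and \<mu> :: "nat \<Rightarrow> real" and \<sigma> :: "nat \<Rightarrow> nat"
    and \<alpha> \<epsilon> :: real and B :: "nat \<Rightarrow> real"
    and M :: "'w measure" and Z :: "draw \<Rightarrow> 'w \<Rightarrow> nat"
    and I U L G :: "nat \<Rightarrow> nat \<Rightarrow> 'w \<Rightarrow> nat"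
    and i :: nat
  assumes "N \<ge> 2" and "K \<ge> 2"
    and "\<forall>l\<in>{1..K}. 0 < \<mu> l \<and> \<mu> l < 1"
    and "\<mu> 1 > \<mu> 2"
    and "\<forall>l\<in>{2..<K}. \<mu> l \<ge> \<mu> (l + 1)"
    and "bij_betw \<sigma> {1..K} {1..K}"
    and "gossip_matrix N P" and "irreducible_gossip N P"
    and "\<alpha> > 3"
    and "budget B" and "\<epsilon> > 0" and "admissible B \<epsilon>"
    and "gosine_sync M N K (\<mu> \<circ> \<sigma>) P Z I U L G \<alpha> B \<epsilon> \<or>
         (\<exists>\<delta>>0. gosine_async M N K (\<mu> \<circ> \<sigma>) P Z I U L G \<alpha> B \<epsilon> \<delta>)"
    and "i \<in> {1..N}"
  shows "limsup (\<lambda>T. ereal (prob_space.expectation M (regret (\<mu> 1) (\<mu> \<circ> \<sigma>) (I i) T) / ln (real T)))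
           \<le> ereal (\<Sum>j\<in>{2..min (nat \<lceil>real K / real N\<rceil> + 2) K}. 4 * \<alpha> / (\<mu> 1 - \<mu> j))"
proof -
  let ?\<nu> = "\<mu> \<circ> \<sigma>" and ?A = "\<lambda>x::nat. phase_end B \<epsilon> (int x)"
  have sched: "phase_schedule ?A \<epsilon>"
    using assms(12,11) by (rule phase_schedule_phase_end)
  have anti: "\<mu> y \<le> \<mu> x" if "x \<in> {2..K}" "y \<in> {2..K}" "x \<le> y" for x y
    using that(3,1,2)
  proof (induction y rule: dec_induct)
    case (step n)
    then have "\<mu> (n + 1) \<le> \<mu> n" using assms(5) by auto
    with step show ?case by simp
  qed simp
  have top: "\<mu> x < \<mu> 1" if "x \<in> {2..K}" for x
    using anti[of 2 x] that assms(2,4) by simp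
  have img: "\<sigma> ` {1..K} = {1..K}" and inj: "inj_on \<sigma> {1..K}"
    using assms(6) by (auto simp: bij_betw_def)
  have "1 \<in> \<sigma> ` {1..K}" using img assms(2) by simp
  then obtain b where b: "b \<in> {1..K}" "\<sigma> b = 1" by auto
  have rank: "\<sigma> l \<in> {2..K}" if l: "l \<in> {1..K}" "l \<noteq> b" for l
  proof -
    have "\<sigma> l \<in> {1..K}" using img l(1) by blast
    moreover have "\<sigma> l \<noteq> 1" using inj_onD[OF inj, of l b] l b by auto
    ultimately show ?thesis by auto
  qed
  \<comment> \<open>Both disjuncts lead into the same locale: the synchronous one with \<delta> = 0
    and deterministic phase ends, the asynchronous one with partial sums of the drawn
    durations.\<close>
  have "\<exists>\<delta> e. gosine_slack M N K ?\<nu> P Z I U L G ?A \<epsilon> \<alpha> \<delta> b e"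
  proof -
    have slack: "gosine_slack M N K ?\<nu> P Z I U L G ?A \<epsilon> \<alpha> \<delta> b e"
      if gb: "gossip_bandit M N K ?\<nu> P Z I U L G" and "\<delta> \<ge> 0"
        and run: "AE \<omega> in M. slack_run \<alpha> N K ?A \<delta> (e \<omega>) (\<lambda>i j. Z (Contact i j) \<omega>)
          (\<lambda>i t. I i t \<omega>) (\<lambda>i t. Z (Reward i (I i t \<omega>) t) \<omega>)
          (\<lambda>i j. U i j \<omega>) (\<lambda>i j. L i j \<omega>) (\<lambda>i j. G i j \<omega>)" for \<delta> e
    proof (intro gosine_slack.intro unit_mean_bandit.intro unit_mean_bandit_axioms.intro
        gosine_slack_axioms.intro gb sched \<open>\<alpha> > 3\<close> \<open>\<delta> \<ge> 0\<close> b(1) run)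
      fix l assume l: "l \<in> {1..K}"
      then have "\<sigma> l \<in> {1..K}" using img by blast
      then have "0 < \<mu> (\<sigma> l) \<and> \<mu> (\<sigma> l) < 1" using assms(3) by blast
      then show "0 \<le> ?\<nu> l \<and> ?\<nu> l \<le> 1" by simp
    next
      fix l assume "l \<in> {1..K}" "l \<noteq> b"
      then show "?\<nu> l < ?\<nu> b" using top[OF rank] b(2) by simp
    next
      fix m i assume "m \<in> {1..N}" "i \<in> {1..N}"
      then show "(m, i) \<in> {(m, i). m \<in> {1..N} \<and> i \<in> {1..N} \<and> P i m > 0}\<^sup>*"
        by (rule irreducible_gossip_connected[OF assms(7,8)])
    qed (use assms(1) in simp)
    from assms(13) show ?thesis
    proof (elim disjE exE conjE)
      assume "gosine_sync M N K ?\<nu> P Z I U L G \<alpha> B \<epsilon>"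
      then interpret gosine_sync M N K ?\<nu> P Z I U L G \<alpha> B \<epsilon> .
      have "AE \<omega> in M. slack_run \<alpha> N K ?A 0 (\<lambda>i j. phase_end B \<epsilon> (int j - 1)) (\<lambda>i j. Z (Contact i j) \<omega>)
          (\<lambda>i t. I i t \<omega>) (\<lambda>i t. Z (Reward i (I i t \<omega>) t) \<omega>)
          (\<lambda>i j. U i j \<omega>) (\<lambda>i j. L i j \<omega>) (\<lambda>i j. G i j \<omega>)"
        using run AE_contact_range[OF assms(7)]
      proof eventually_elim
        case (elim \<omega>)
        show ?case
          using elim(2) by (intro sync_run_imp_slack_run elim(1) mono_phase_end assms(11,12)) blast
      qed
      then show ?thesis
        using slack[OF gossip_bandit_axioms, where \<delta> = 0 and e = "\<lambda>\<omega> i j. phase_end B \<epsilon> (int j - 1)"]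
        by auto
    next
      fix \<delta> :: real assume "\<delta> > 0" and "gosine_async M N K ?\<nu> P Z I U L G \<alpha> B \<epsilon> \<delta>"
      then interpret gosine_async M N K ?\<nu> P Z I U L G \<alpha> B \<epsilon> \<delta> by simp
      have "\<delta> \<ge> 0" using \<open>\<delta> > 0\<close> by simp
      have "AE \<omega> in M. slack_run \<alpha> N K ?A \<delta> (\<lambda>i j. \<Sum>y<j. Z (Duration i y) \<omega>) (\<lambda>i j. Z (Contact i j) \<omega>)
          (\<lambda>i t. I i t \<omega>) (\<lambda>i t. Z (Reward i (I i t \<omega>) t) \<omega>)
          (\<lambda>i j. U i j \<omega>) (\<lambda>i j. L i j \<omega>) (\<lambda>i j. G i j \<omega>)"
        using run AE_contact_range[OF assms(7)] AE_duration_range[OF sched \<open>\<delta> \<ge> 0\<close>]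
      proof eventually_elim
        case (elim \<omega>)
        show ?case
          by (rule async_run_imp_slack_run[OF elim(1) _ \<open>\<delta> \<ge> 0\<close> sched])
            (use elim(2,3) assms(2) in \<open>blast | simp\<close>)+
      qed
      then show ?thesis
        using slack[OF gossip_bandit_axioms \<open>\<delta> \<ge> 0\<close>, where e = "\<lambda>\<omega> i j. \<Sum>y<j. Z (Duration i y) \<omega>"]
        by blast
    qed
  qed
  then obtain \<delta> e where "gosine_slack M N K ?\<nu> P Z I U L G ?A \<epsilon> \<alpha> \<delta> b e" by blast
  then interpret gosine_slack M N K ?\<nu> P Z I U L G ?A \<epsilon> \<alpha> \<delta> b e .
  have "(\<Sum>l\<in>S - {b}. 4 * \<alpha> / (?\<nu> b - ?\<nu> l))
      \<le> (\<Sum>j\<in>{2..min (sticky_size N K + 2) K}. 4 * \<alpha> / (\<mu> 1 - \<mu> j))"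
    if S: "S \<subseteq> {1..K}" "card (S - {b}) \<le> sticky_size N K + 1" for S
  proof -
    have inj': "inj_on \<sigma> (S - {b})" using inj by (rule inj_on_subset) (use S in blast)
    \<comment> \<open>Relabelling by rank: the gaps become those of the sorted means and increase
      with the rank, so the lowest ranks from 2 on form the worst possible final set.\<close>
    have "(\<Sum>l\<in>S - {b}. 4 * \<alpha> / (?\<nu> b - ?\<nu> l)) = (\<Sum>j\<in>\<sigma> ` (S - {b}). 4 * \<alpha> / (\<mu> 1 - \<mu> j))"
      using b(2) by (simp add: sum.reindex[OF inj'])
    also have "\<dots> \<le> (\<Sum>j\<in>{2..min (sticky_size N K + 2) K}. 4 * \<alpha> / (\<mu> 1 - \<mu> j))"
    proof (rule sum_le_sum_initial)
      show "\<sigma> ` (S - {b}) \<subseteq> {2..K}" using rank S by blast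
      show "card (\<sigma> ` (S - {b})) \<le> sticky_size N K + 1" using S by (simp add: card_image[OF inj'])
      show "4 * \<alpha> / (\<mu> 1 - \<mu> y) \<le> 4 * \<alpha> / (\<mu> 1 - \<mu> x)"
        if "x \<in> {2..K}" "y \<in> {2..K}" "x \<le> y" for x y
        using anti[OF that] top[OF that(1)] top[OF that(2)] assms(9) by (intro divide_left_mono mult_pos_pos) auto
      show "0 \<le> 4 * \<alpha> / (\<mu> 1 - \<mu> x)" if "x \<in> {2..K}" for x
        using top[OF that] assms(9) by (intro divide_nonneg_pos) auto
    qed
    finally show ?thesis .
  qed
  then have "limsup (\<lambda>T. ereal (expectation (regret (?\<nu> b) ?\<nu> (I i) T) / ln (real T)))
      \<le> ereal (\<Sum>j\<in>{2..min (sticky_size N K + 2) K}. 4 * \<alpha> / (\<mu> 1 - \<mu> j))"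
    by (intro limsup_regret_le assms(14))
  then show ?thesis using b(2) by (simp add: sticky_size_def)
qed

end
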